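(* Let $f:[0,1]\to[0,1]$ be continuous and let $U=(a,b)$ be an interval complementary to $\overline{\mathrm{Per}\,f}$. Then up to orientation one of the following four possibilities holds. 1) $\Omega(f)\cap U=\emptyset$. 2) $\Omega(f)\cap U=\{x_1<x_2<\dots<x_n\}$ is a finite set, $\mathrm{card}(\mathrm{orb}\,x_1)<\infty,\dots,\mathrm{card}(\mathrm{orb}\,x_{n-1})<\infty$, $\{x_1,\dots,x_{n-1}\}\cap\omega(f)=\emptyset$, and there exist periodic intervals $J_i=[x_i,y_i]$ such that $x_i\in B'(\mathrm{orb}\,J_i,f)$ for $1\le i\le n-1$ and $J_i\supset J_{i+1}$ for $1\le i\le n-2$. Moreover, for $x_n$ there are two possibilities: a) $x_n$ belongs to a solenoidal set; b) $x_n$ belongs to an $\Omega$-basic set $B'(\mathrm{orb}\,J_n,f)$ where $J_n=[x_n,y_n]\subset J_{n-1}$ (the inclusion being required only if $n\ge2$). 3) $\Omega(f)\cap U=\{x_i\}_{i=1}^\infty\cup\{x\}$, $x_1<x_2<\cdots$, $x=\lim x_i$, and there exist generating intervals $J_i=[x_i,y_i]$ such that: a) $x_i\in B'(\mathrm{orb}\,J_i,f)$ and $\mathrm{card}(\mathrm{orb}\,x_i)<\infty$ for all $i$, and $\{x_i\}_{i=1}^\infty\cap\omega(f)=\emptyset$; b) $x\in\omega(f)\cap\left(\bigcap_{i=1}^\infty\mathrm{orb}\,J_i\right)$. 4) $\Omega(f)\cap U=\{x_i\}_{i=1}^\infty$, $x_1<x_2<\cdots$, $\lim x_i=b$, $\mathrm{card}(\mathrm{orb}\,x_i)<\infty$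 for all $i$, $\{x_i\}_{i=1}^\infty\cap\omega(f)=\emptyset$, and there exist periodic intervals $J_i=[x_i,y_i]$ such that $x_i\in B'(\mathrm{orb}\,J_i,f)$ and $J_i\supset J_{i+1}$ for all $i$, and $\bigcap_{i=1}^\infty J_i=\{b\}$. Moreover, either the periods of $J_i$ tend to infinity, $\{J_i\}$ are generating intervals and $b$ belongs to the corresponding solenoidal set, or the periods of $J_i$ do not tend to infinity and $b$ is a periodic point. In any case $\mathrm{card}\{\omega(f)\cap U\}\le1$.
   Context: $\mathrm{Per}\,f$ is the set of periodic points; an interval $(a,b)\subset[0,1]$ is complementary to $\overline{\mathrm{Per}\,f}$ if it is a maximal open interval disjoint from $\overline{\mathrm{Per}\,f}$. $\mathrm{orb}\,x=\{f^ix:i\ge0\}$; $\omega(x)$ is the set of limit points of $\mathrm{orb}\,x$; $\omega(f)=\bigcup_x\omega(x)$; $\Omega(f)$ is the set of non-wandering points. "Up to orientation" means after possibly replacing $f$ by its conjugate under $t\mapsto1-t$ (and $U$ by its image). A closed interval $I$ is periodic of period $k$ if $I,fI,\dots,f^{k-1}I$ are pairwise disjoint and $f^kI=I$; $\mathrm{orb}\,I=\bigcup_{i=0}^{k-1}f^iI$. For a set $W$, $\mathrm{orb}\,W=\bigcup_{i\ge0}f^iW$. Generating intervals are periodic intervals $I_0\supset I_1\supset\cdots$ whose periods tend to infinity; a solenoidal set is any closed invariant subset of a set $Q=\bigcap_j\mathrm{orb}\,I_j$ of this kind. For a periodic interval $I$ with $M=\mathrm{orb}\,I$, the set $\{x\in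 M:\overline{\mathrm{orb}\,W}=M$ for every relative neighborhood $W$ of $x$ in $M\}$, if infinite, is called a basic set and denoted $B(\mathrm{orb}\,I,f)$. Given a basic set $B=B(\mathrm{orb}\,I,f)$, let $A$ be the set of all endpoints $x$ of the intervals of $\mathrm{orb}\,I$ such that $x\in\Omega(f)$, there is an integer $n\ge0$ with $f^nx\in B$, and if $m$ is the least such integer then $x,fx,\dots,f^{m-1}x\notin\mathrm{int}(\mathrm{orb}\,I)$. The $\Omega$-basic set is $B'(\mathrm{orb}\,I,f)=B\cup A$ (writing $x\in B'(\mathrm{orb}\,I,f)$ presupposes that the basic set $B(\mathrm{orb}\,I,f)$ exists). *)

theory Defs
  imports "HOL-Analysis.Analysis"
begin

text \<open>
  Interval maps are total functions \<^typ>\<open>real \<Rightarrow> real\<close> that map the phase space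
  \<open>{0..1}\<close> into itself; their values outside \<open>{0..1}\<close> are irrelevant. Neighborhoods and
  interiors are relative to the phase space (or to the indicated subspace).
\<close>

definition Per :: "(real \<Rightarrow> real) \<Rightarrow> real set" where
  "Per f = {x \<in> {0..1}. \<exists>n\<ge>1. (f ^^ n) x = x}"

text \<open>Maximality is among the open intervals contained in \<open>{0..1}\<close>, so \<open>a = 0\<close>
  (or \<open>b = 1\<close>) is possible also when \<open>0\<close> (or \<open>1\<close>) is not in \<open>closure (Per f)\<close>.\<close>

definition complementary :: "(real \<Rightarrow> real) \<Rightarrow> real \<Rightarrow> real \<Rightarrow> bool" where
  "complementary f a b \<longleftrightarrow>
     a < b \<and> {a<..<b} \<subseteq> {0..1} \<and> {a<..<b} \<inter> closure (Per f) = {} \<and>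
     (\<forall>c d. {a<..<b} \<subseteq> {c<..<d} \<and> {c<..<d} \<subseteq> {0..1} \<and> {c<..<d} \<inter> closure (Per f) = {}
        \<longrightarrow> {c<..<d} = {a<..<b})"

definition orbit :: "(real \<Rightarrow> real) \<Rightarrow> real \<Rightarrow> real set" where
  "orbit f x = {(f ^^ i) x | i. True}"

definition orbit_set :: "(real \<Rightarrow> real) \<Rightarrow> real set \<Rightarrow> real set" where
  "orbit_set f W = (\<Union>i. (f ^^ i) ` W)"

text \<open>Limit points are those of the sequence of iterates (limits of subsequences); in
  particular the omega-limit set of a periodic point is its orbit.\<close>

definition omega_point :: "(real \<Rightarrow> real) \<Rightarrow> real \<Rightarrow> real set" where
  "omega_point f x =
     {y. \<exists>r :: nat \<Rightarrow> nat. strict_mono r \<and> (\<lambda>n. (f ^^ r n) x) \<longlonglongrightarrow> y}"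

definition omega_map :: "(real \<Rightarrow> real) \<Rightarrow> real set" where
  "omega_map f = (\<Union>x\<in>{0..1}. omega_point f x)"

definition nbhd_in :: "real set \<Rightarrow> real \<Rightarrow> real set \<Rightarrow> bool" where
  "nbhd_in S x W \<longleftrightarrow> W \<subseteq> S \<and> (\<exists>T. openin (top_of_set S) T \<and> x \<in> T \<and> T \<subseteq> W)"

definition nonwandering :: "(real \<Rightarrow> real) \<Rightarrow> real set" where
  "nonwandering f =
     {x \<in> {0..1}. \<forall>V. nbhd_in {0..1} x V \<longrightarrow> (\<exists>n\<ge>1. (f ^^ n) ` V \<inter> V \<noteq> {})}"

definition periodic_interval :: "(real \<Rightarrow> real) \<Rightarrow> real set \<Rightarrow> nat \<Rightarrow> bool" where
  "periodic_interval f I k \<longleftrightarrow>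
     k \<ge> 1 \<and> (\<exists>c d. c < d \<and> I = {c..d}) \<and> I \<subseteq> {0..1} \<and>
     disjoint_family_on (\<lambda>i. (f ^^ i) ` I) {..<k} \<and> (f ^^ k) ` I = I"

text \<open>For a periodic interval, \<^const>\<open>orbit_set\<close> is the finite union over one period.\<close>

lemma orbit_set_periodic_interval:
  assumes "periodic_interval f I k"
  shows "orbit_set f I = (\<Union>i<k. (f ^^ i) ` I)"
proof -
  have k: "k > 0" and inv: "(f ^^ k) ` I = I"
    using assms by (auto simp: periodic_interval_def)
  have mult: "(f ^^ (k * q)) ` I = I" for q
  proof (induction q)
    case (Suc q)
    have "(f ^^ (k * Suc q)) ` I = (f ^^ k) ` ((f ^^ (k * q)) ` I)"
      by (simp add: funpow_add image_comp)
    then show ?case using Suc inv by simp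
  qed simp
  have "(f ^^ n) ` I = (f ^^ (n mod k)) ` I" for n
  proof -
    have "(f ^^ n) ` I = (f ^^ (n mod k + k * (n div k))) ` I"
      by simp
    also have "\<dots> = (f ^^ (n mod k)) ` ((f ^^ (k * (n div k))) ` I)"
      by (simp only: funpow_add image_comp)
    finally show ?thesis by (simp add: mult)
  qed
  moreover have "n mod k < k" for n using k by simp
  ultimately show ?thesis unfolding orbit_set_def by blast
qed

definition generating :: "(real \<Rightarrow> real) \<Rightarrow> (nat \<Rightarrow> real set) \<Rightarrow> bool" where
  "generating f I \<longleftrightarrow>
     (\<exists>k. (\<forall>j. periodic_interval f (I j) (k j)) \<and> (\<forall>j. I (Suc j) \<subseteq> I j) \<and>
          filterlim k at_top sequentially)"

definition solenoidal_for :: "(real \<Rightarrow> real) \<Rightarrow> (nat \<Rightarrow> real set) \<Rightarrow> real set \<Rightarrow> bool" where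
  "solenoidal_for f I S \<longleftrightarrow>
     generating f I \<and> closed S \<and> f ` S \<subseteq> S \<and> S \<subseteq> (\<Inter>j. orbit_set f (I j))"

definition solenoidal :: "(real \<Rightarrow> real) \<Rightarrow> real set \<Rightarrow> bool" where
  "solenoidal f S \<longleftrightarrow> (\<exists>I. solenoidal_for f I S)"

definition basic_set :: "(real \<Rightarrow> real) \<Rightarrow> real set \<Rightarrow> real set" where
  "basic_set f M = {x \<in> M. \<forall>W. nbhd_in M x W \<longrightarrow> closure (orbit_set f W) = M}"

definition basic_set_exists :: "(real \<Rightarrow> real) \<Rightarrow> real set \<Rightarrow> bool" where
  "basic_set_exists f I \<longleftrightarrow>
     (\<exists>k. periodic_interval f I k) \<and> infinite (basic_set f (orbit_set f I))"

definition Omega_basic_extra :: "(real \<Rightarrow> real) \<Rightarrow> real set \<Rightarrow> real set" where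
  "Omega_basic_extra f I =
     {x. (\<exists>i c d. (f ^^ i) ` I = {c..d} \<and> (x = c \<or> x = d)) \<and>
         x \<in> nonwandering f \<and>
         (\<exists>n. (f ^^ n) x \<in> basic_set f (orbit_set f I)) \<and>
         (\<forall>j < (LEAST n. (f ^^ n) x \<in> basic_set f (orbit_set f I)).
            (f ^^ j) x \<notin> (top_of_set {0..1}) interior_of (orbit_set f I))}"

definition Omega_basic_set :: "(real \<Rightarrow> real) \<Rightarrow> real set \<Rightarrow> real set" where
  "Omega_basic_set f I = basic_set f (orbit_set f I) \<union> Omega_basic_extra f I"

text \<open>Membership in an Omega-basic set, including the requirement that \<open>I\<close> is a periodic
  interval for which the basic set exists.\<close>

definition in_Omega_basic :: "(real \<Rightarrow> real) \<Rightarrow> real set \<Rightarrow> real \<Rightarrow> bool" where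
  "in_Omega_basic f I x \<longleftrightarrow> basic_set_exists f I \<and> x \<in> Omega_basic_set f I"

definition reflect :: "(real \<Rightarrow> real) \<Rightarrow> real \<Rightarrow> real" where
  "reflect f t = 1 - f (1 - t)"

text \<open>The four possible structures of the non-wandering set in \<open>U = {a<..<b}\<close>.
  The intervals are \<open>J i = {x i..y i}\<close>.\<close>

definition possibility1 :: "(real \<Rightarrow> real) \<Rightarrow> real \<Rightarrow> real \<Rightarrow> bool" where
  "possibility1 f a b \<longleftrightarrow> nonwandering f \<inter> {a<..<b} = {}"

text \<open>Indices run from \<open>1\<close> to \<open>n\<close>; the value \<open>y n\<close> is used only in the second
  alternative for \<open>x n\<close>.\<close>

definition possibility2 :: "(real \<Rightarrow> real) \<Rightarrow> real \<Rightarrow> real \<Rightarrow> bool" where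
  "possibility2 f a b \<longleftrightarrow>
     (\<exists>(n :: nat) (x :: nat \<Rightarrow> real) (y :: nat \<Rightarrow> real).
        n \<ge> 1 \<and> strict_mono_on {1..n} x \<and> nonwandering f \<inter> {a<..<b} = x ` {1..n} \<and>
        (\<forall>i\<in>{1..<n}. finite (orbit f (x i))) \<and>
        x ` {1..<n} \<inter> omega_map f = {} \<and>
        (\<forall>i\<in>{1..<n}. (\<exists>k. periodic_interval f {x i..y i} k) \<and>
                      in_Omega_basic f {x i..y i} (x i)) \<and>
        (\<forall>i. 1 \<le> i \<and> i + 2 \<le> n \<longrightarrow> {x (i + 1)..y (i + 1)} \<subseteq> {x i..y i}) \<and>
        ((\<exists>S. solenoidal f S \<and> x n \<in> S) \<or>
         ((\<exists>k. periodic_interval f {x n..y n} k) \<and> in_Omega_basic f {x n..y n} (x n) \<and>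
          (n \<ge> 2 \<longrightarrow> {x n..y n} \<subseteq> {x (n - 1)..y (n - 1)}))))"

text \<open>From here on the sequences are indexed from \<open>0\<close>.\<close>

definition possibility3 :: "(real \<Rightarrow> real) \<Rightarrow> real \<Rightarrow> real \<Rightarrow> bool" where
  "possibility3 f a b \<longleftrightarrow>
     (\<exists>(x :: nat \<Rightarrow> real) (l :: real) (y :: nat \<Rightarrow> real).
        strict_mono x \<and> x \<longlonglongrightarrow> l \<and> nonwandering f \<inter> {a<..<b} = range x \<union> {l} \<and>
        generating f (\<lambda>i. {x i..y i}) \<and>
        (\<forall>i. in_Omega_basic f {x i..y i} (x i) \<and> finite (orbit f (x i))) \<and>
        range x \<inter> omega_map f = {} \<and>
        l \<in> omega_map f \<inter> (\<Inter>i. orbit_set f {x i..y i}))"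

definition possibility4 :: "(real \<Rightarrow> real) \<Rightarrow> real \<Rightarrow> real \<Rightarrow> bool" where
  "possibility4 f a b \<longleftrightarrow>
     (\<exists>(x :: nat \<Rightarrow> real) (y :: nat \<Rightarrow> real) (k :: nat \<Rightarrow> nat).
        strict_mono x \<and> x \<longlonglongrightarrow> b \<and> nonwandering f \<inter> {a<..<b} = range x \<and>
        (\<forall>i. finite (orbit f (x i))) \<and>
        range x \<inter> omega_map f = {} \<and>
        (\<forall>i. periodic_interval f {x i..y i} (k i) \<and> in_Omega_basic f {x i..y i} (x i)) \<and>
        (\<forall>i. {x (Suc i)..y (Suc i)} \<subseteq> {x i..y i}) \<and>
        (\<Inter>i. {x i..y i}) = {b} \<and>
        ((filterlim k at_top sequentially \<and> generating f (\<lambda>i. {x i..y i}) \<and>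
          (\<exists>S. solenoidal_for f (\<lambda>i. {x i..y i}) S \<and> b \<in> S)) \<or>
         (\<not> filterlim k at_top sequentially \<and> b \<in> Per f)))"

end

theory Submission
  imports Defs
begin

text \<open>
  Since \<open>U = {a<..<b}\<close> contains no periodic points, all returns of orbits to \<open>U\<close> go in one direction, say to
  the right. The closure of the orbit of a small neighbourhood of a nonwandering point \<open>x\<close> of \<open>U\<close> consists of
  cyclically permuted intervals and has no points of \<open>U\<close> left of the neighbourhood. When the neighbourhoods
  shrink, either the periods are unbounded, and then \<open>x\<close> lies in a solenoidal set and \<open>{x<..<b}\<close> is wandering,
  or a periodic interval \<open>{x..y}\<close> containing \<open>b\<close> remains, whose basic set is reached by the orbit of \<open>x\<close>.
  If a periodic interval \<open>{z..w}\<close> of period \<open>q\<close> with \<open>x < z < b\<close> is nested in \<open>{x..y}\<close>, then the interval \<open>{x..s}\<close>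
  swept out by \<open>{x..w}\<close> under \<open>f ^^ q\<close> never covers \<open>x\<close> again, so \<open>f ^^ q\<close> has to map \<open>x\<close> to the fixed point
  \<open>s\<close>: otherwise neighbourhoods of \<open>x\<close> would be absorbed. This yields the finite orbit, keeps \<open>x\<close> out of all omega-limit
  sets and isolates \<open>x\<close> from the right. Applied along a monotone sequence of nonwandering points whose periodic
  intervals have a constant period, it forces the left and right ends to have a common limit, a periodic point;
  therefore the nonwandering points of \<open>U\<close> have order type at most \<open>\<omega> + 1\<close>.
\<close>

text \<open>Closures of orbits yield intervals that are merely mapped into themselves, whereas a
  periodic interval must be mapped onto itself. Equality is recovered by intersecting the images
  under all returns or, in the limit of shrinking neighbourhoods, from the fact that
  \<open>near_lim f x\<close> is mapped onto itself. A second obstacle is that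
  \<open>basic_set\<close> has to be infinite. An infinite orbit settles this, because all but
  finitely many of its points are interior to the union of the intervals. A finite orbit ends in a
  periodic point \<open>c\<close>, and dense orbits are then only known near \<open>c\<close>.
  Two-sided density cannot be pulled back along preimages, since an image may reach just one side of
  \<open>c\<close>; hence the one-sided notion \<open>good\<close>, and a counting argument against
  all good points being periodic. Finally, nonwandering points can be listed from the left only
  after decreasing sequences are excluded; there the periods decrease and so become constant,
  whereas along increasing sequences they may grow. That the limit in possibility 3 lies in
  \<open>omega_map f\<close> comes from left neighbourhoods of successive points covering one
  another.\<close>

definition cint :: "real set \<Rightarrow> bool" where
  "cint K \<longleftrightarrow> (\<exists>c d. c \<le> d \<and> K = {c..d})"

lemma cintI: "compact K \<Longrightarrow> connected K \<Longrightarrow> K \<noteq> {} \<Longrightarrow> cint K"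
  unfolding cint_def by (metis connected_compact_interval_1 atLeastatMost_empty_iff2)

lemma cintD: "cint K \<Longrightarrow> compact K \<and> connected K \<and> K \<noteq> {} \<and> closed K"
  unfolding cint_def by auto

lemma cint_image:
  assumes "cint K" "continuous_on K g"
  shows "cint (g ` K)"
  using assms cintD[OF assms(1)]
  by (intro cintI compact_continuous_image connected_continuous_image) auto

lemma orbit_set_mono: "A \<subseteq> B \<Longrightarrow> orbit_set f A \<subseteq> orbit_set f B"
  unfolding orbit_set_def by blast

lemma orbit_set_superset: "A \<subseteq> orbit_set f A"
  unfolding orbit_set_def by (auto intro!: exI[of _ "0::nat"])

lemma funpow_image_add: "(f ^^ (i + j)) ` A = (f ^^ i) ` ((f ^^ j) ` A)"
  by (simp add: funpow_add image_comp)

lemma orbit_set_image: "orbit_set f ((f ^^ n) ` A) \<subseteq> orbit_set f A"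
  unfolding orbit_set_def by (auto simp: image_comp funpow_add[symmetric])

lemma orbit_set_split: "orbit_set f A = A \<union> f ` orbit_set f A"
proof -
  have "orbit_set f A = (\<Union>i\<in>{0} \<union> range Suc. (f ^^ i) ` A)"
    unfolding orbit_set_def by (metis UNIV_nat_eq insert_is_Un)
  also have "\<dots> = A \<union> (\<Union>i. (f ^^ Suc i) ` A)" by auto
  also have "(\<Union>i. (f ^^ Suc i) ` A) = f ` orbit_set f A"
    unfolding orbit_set_def by (auto simp: image_comp)
  finally show ?thesis .
qed

lemma orbit_set_Un: "orbit_set f (A \<union> B) = orbit_set f A \<union> orbit_set f B"
  unfolding orbit_set_def by blast

lemma orbit_set_fwd: "f ` orbit_set f A \<subseteq> orbit_set f A"
  using orbit_set_split[of f A] by blast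

lemma funpow_image_subset: "f ` A \<subseteq> A \<Longrightarrow> (f ^^ n) ` A \<subseteq> A"
proof (induction n)
  case (Suc n) then show ?case by (auto simp: image_subset_iff)
qed simp

lemma orbit_set_least: "f ` B \<subseteq> B \<Longrightarrow> A \<subseteq> B \<Longrightarrow> orbit_set f A \<subseteq> B"
  using funpow_image_subset[of f B] unfolding orbit_set_def by blast

text \<open>For \<open>y\<close> in every image, the fibres over \<open>y\<close> in the sets
  \<open>K n\<close> are nonempty, compact and nested, so they have a common point.\<close>

lemma image_INT_compact:
  fixes K :: "nat \<Rightarrow> real set" and g :: "real \<Rightarrow> real"
  assumes K: "\<And>n. compact (K n)" and dec: "\<And>n. K (Suc n) \<subseteq> K n"
    and g: "continuous_on (K 0) g"
  shows "g ` (\<Inter>n. K n) = (\<Inter>n. g ` K n)"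
proof
  show "g ` (\<Inter>n. K n) \<subseteq> (\<Inter>n. g ` K n)" by auto
  show "(\<Inter>n. g ` K n) \<subseteq> g ` (\<Inter>n. K n)"
  proof
    fix y assume y: "y \<in> (\<Inter>n. g ` K n)"
    have sub: "K n \<subseteq> K 0" for n by (induction n) (use dec in auto)
    define C where "C n = K n \<inter> g -` {y}" for n
    have "C n = K n \<inter> (K 0 \<inter> g -` {y})" for n
      unfolding C_def using sub by blast
    moreover have "closed (K 0 \<inter> g -` {y})"
      using continuous_closed_preimage[OF g compact_imp_closed[OF K[of 0]] closed_singleton] .
    ultimately have "compact (C n)" for n using K by (simp add: compact_Int_closed)
    moreover have "C n \<noteq> {}" for n using y unfolding C_def by force
    moreover have "C n \<subseteq> C m" if "m \<le> n" for m n
      using lift_Suc_antimono_le[of K, OF dec that] unfolding C_def by auto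
    ultimately have "(\<Inter>n. C n) \<noteq> {}"
      using compact_nest[of C] by auto
    then show "y \<in> g ` (\<Inter>n. K n)" unfolding C_def by auto
  qed
qed

section \<open>Cyclically permuted intervals\<close>

locale interval_map =
  fixes f :: "real \<Rightarrow> real"
  assumes cont: "continuous_on {0..1} f"
    and self_map: "f ` {0..1} \<subseteq> {0..1}"
begin

lemma funpow_self: "(f ^^ n) ` {0..1} \<subseteq> {0..1}"
  by (rule funpow_image_subset[OF self_map])

lemma funpow_mem: "x \<in> {0..1} \<Longrightarrow> (f ^^ n) x \<in> {0..1}"
  using funpow_self[of n] by blast

lemma funpow_cont: "continuous_on {0..1} (f ^^ n)"
proof (induction n)
  case (Suc n)
  have "continuous_on {0..1} (f \<circ> (f ^^ n))"
    by (rule continuous_on_compose[OF Suc continuous_on_subset[OF cont funpow_self]])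
  then show ?case by simp
qed (simp add: id_def)

lemma funpow_cont_sub: "A \<subseteq> {0..1} \<Longrightarrow> continuous_on A (f ^^ n)"
  using continuous_on_subset funpow_cont by blast

lemma funpow_sub: "A \<subseteq> {0..1} \<Longrightarrow> (f ^^ n) ` A \<subseteq> {0..1}"
  using funpow_self by blast

lemma orbit_set_sub: "A \<subseteq> {0..1} \<Longrightarrow> orbit_set f A \<subseteq> {0..1}"
  using orbit_set_least[OF self_map] .

lemma cint_funpow: "cint K \<Longrightarrow> K \<subseteq> {0..1} \<Longrightarrow> cint ((f ^^ n) ` K)"
  by (intro cint_image funpow_cont_sub)

lemma funpow_ivt:
  assumes "connected A" "A \<subseteq> {0..1}" "x \<in> A" "y \<in> A" "(f ^^ n) x \<le> z" "z \<le> (f ^^ n) y"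
  shows "z \<in> (f ^^ n) ` A"
proof -
  have "connected ((f ^^ n) ` A)"
    using assms by (intro connected_continuous_image funpow_cont_sub)
  then show ?thesis using assms connectedD_interval by blast
qed

lemma closure_orbit_sub: "A \<subseteq> {0..1} \<Longrightarrow> closure (orbit_set f A) \<subseteq> {0..1}"
  by (intro closure_minimal orbit_set_sub) auto

lemma image_closure:
  assumes "A \<subseteq> {0..1}"
  shows "closure ((f ^^ n) ` A) = (f ^^ n) ` closure A"
proof
  have cl: "closure A \<subseteq> {0..1}" using assms by (intro closure_minimal) auto
  then have "compact (closure A)"
    by (meson bounded_subset closed_closure compact_eq_bounded_closed bounded_closed_interval)
  then have "closed ((f ^^ n) ` closure A)"
    using cl compact_continuous_image funpow_cont_sub compact_imp_closed by blast
  then show "closure ((f ^^ n) ` A) \<subseteq> (f ^^ n) ` closure A"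
    by (intro closure_minimal image_mono closure_subset) auto
  show "(f ^^ n) ` closure A \<subseteq> closure ((f ^^ n) ` A)"
    by (rule image_closure_subset[OF funpow_cont_sub[OF cl] closed_closure closure_subset])
qed

lemma closure_orbit_fwd:
  assumes "A \<subseteq> {0..1}"
  shows "(f ^^ n) ` closure (orbit_set f A) \<subseteq> closure (orbit_set f A)"
proof -
  have "(f ^^ n) ` closure (orbit_set f A) = closure ((f ^^ n) ` orbit_set f A)"
    using image_closure orbit_set_sub[OF assms] by blast
  also have "\<dots> \<subseteq> closure (orbit_set f A)"
    by (intro closure_mono funpow_image_subset orbit_set_fwd)
  finally show ?thesis .
qed

lemma closure_orbit_split:
  assumes "A \<subseteq> {0..1}" "closed A"
  shows "closure (orbit_set f A) = A \<union> f ` closure (orbit_set f A)"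
proof -
  have "closure (orbit_set f A) = A \<union> closure (f ` orbit_set f A)"
    using arg_cong[OF orbit_set_split[of f A], of closure] assms
    by (simp only: closure_Un closure_closed)
  then show ?thesis using image_closure[OF orbit_set_sub[OF assms(1)], of 1] by simp
qed

text \<open>A weak form of \<open>periodic_interval\<close>: the return is only an inclusion and
  \<open>K\<close> may be a single point, which is all that a component of the closure of an orbit
  offers. \<open>core_periodic\<close> and \<open>cyc_limit\<close> supply the equality
  later.\<close>

definition cyc :: "real set \<Rightarrow> nat \<Rightarrow> bool" where
  "cyc K m \<longleftrightarrow> m \<ge> 1 \<and> cint K \<and> K \<subseteq> {0..1} \<and> (f ^^ m) ` K \<subseteq> K \<and>
     (\<forall>i<m. \<forall>j<m. i \<noteq> j \<longrightarrow> (f ^^ i) ` K \<inter> (f ^^ j) ` K = {})"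

lemma cyc_mult: "cyc K m \<Longrightarrow> (f ^^ (m * q)) ` K \<subseteq> K"
  using funpow_image_subset[of "f ^^ m" K q] unfolding cyc_def by (simp add: funpow_mult)

lemma cyc_mod:
  assumes "cyc K m" shows "(f ^^ n) ` K \<subseteq> (f ^^ (n mod m)) ` K"
proof -
  have "(f ^^ n) ` K = (f ^^ (n mod m)) ` ((f ^^ (m * (n div m))) ` K)"
    by (metis funpow_image_add mod_mult_div_eq)
  then show ?thesis using cyc_mult[OF assms] by blast
qed

lemma cyc_orbit:
  assumes "cyc K m" shows "orbit_set f K = (\<Union>i<m. (f ^^ i) ` K)"
proof -
  have "n mod m < m" for n using assms by (auto simp: cyc_def)
  then show ?thesis unfolding orbit_set_def using cyc_mod[OF assms] by blast
qed

lemma cyc_dvd: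
  assumes "cyc K m" "(f ^^ n) ` K \<inter> K \<noteq> {}"
  shows "m dvd n"
proof -
  have "(f ^^ (n mod m)) ` K \<inter> (f ^^ 0) ` K \<noteq> {}"
    using cyc_mod[OF assms(1), of n] assms(2) by auto
  moreover have "n mod m < m" "0 < m" using assms(1) by (auto simp: cyc_def)
  ultimately have "n mod m = 0" using assms(1) unfolding cyc_def by blast
  then show ?thesis by auto
qed

lemma cyc_orbit_closed:
  assumes "cyc K m" shows "closed (orbit_set f K)" "orbit_set f K \<subseteq> {0..1}"
proof -
  have K: "cint K" "K \<subseteq> {0..1}" using assms by (auto simp: cyc_def)
  show "closed (orbit_set f K)"
    unfolding cyc_orbit[OF assms] using cintD[OF cint_funpow[OF K]] by (intro closed_UN) auto
  show "orbit_set f K \<subseteq> {0..1}" using orbit_set_sub K by blast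
qed

text \<open>The images of \<open>K\<close> over one period are finitely many disjoint closed sets,
  and a connected set cannot be split between one of them and the union of the others.\<close>

lemma cyc_connected:
  assumes "cyc K m" "connected C" "C \<subseteq> orbit_set f K" "C \<inter> (f ^^ i) ` K \<noteq> {}" "i < m"
  shows "C \<subseteq> (f ^^ i) ` K"
proof -
  define R where "R = (\<Union>j\<in>{..<m} - {i}. (f ^^ j) ` K)"
  have K: "cint K" "K \<subseteq> {0..1}" using assms by (auto simp: cyc_def)
  have cl: "closed ((f ^^ j) ` K)" for j using cintD[OF cint_funpow[OF K]] by auto
  have "closed R" unfolding R_def using cl by (intro closed_UN) auto
  moreover have "(f ^^ i) ` K \<inter> R = {}" using assms(1,5) unfolding R_def cyc_def by blast
  moreover have "C \<subseteq> (f ^^ i) ` K \<union> R"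
    using assms(3) unfolding cyc_orbit[OF assms(1)] R_def by auto
  ultimately have "C \<inter> R = {}"
    using connected_closed[of C] assms(2,4) cl[of i] by blast
  then show ?thesis using \<open>C \<subseteq> (f ^^ i) ` K \<union> R\<close> by blast
qed

lemma cyc_connected0:
  assumes "cyc K m" "connected C" "C \<subseteq> orbit_set f K" "C \<inter> K \<noteq> {}"
  shows "C \<subseteq> K"
  using cyc_connected[of K m C 0] assms by (auto simp: cyc_def)

text \<open>Only the first return of the component of \<open>closure (orbit_set f A)\<close> around \<open>A\<close> matters:
  by maximality of components, two of its earlier images in a common component would return sooner.\<close>

lemma cyc_exists:
  assumes A: "cint A" "A \<subseteq> {0..1}" and ret: "n \<ge> 1" "(f ^^ n) ` A \<inter> A \<noteq> {}"
  shows "\<exists>K m. cyc K m \<and> A \<subseteq> K \<and> closure (orbit_set f A) = orbit_set f K"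
proof -
  define Z where "Z = closure (orbit_set f A)"
  have Z01: "Z \<subseteq> {0..1}" unfolding Z_def using closure_orbit_sub A by blast
  have inv: "(f ^^ i) ` Z \<subseteq> Z" for i unfolding Z_def using closure_orbit_fwd A by blast
  have AZ: "A \<subseteq> Z" unfolding Z_def using orbit_set_superset closure_subset by blast
  obtain z where z: "z \<in> A" using A(1) cintD by blast
  define K where "K = connected_component_set Z z"
  have cK: "connected K" unfolding K_def by simp
  have KZ: "K \<subseteq> Z" unfolding K_def by (rule connected_component_subset)
  have AK: "A \<subseteq> K" unfolding K_def
    using connected_component_maximal[OF z _ AZ] cintD[OF A(1)] by auto
  have max: "C \<subseteq> K" if "connected C" "C \<subseteq> Z" "C \<inter> K \<noteq> {}" for C
  proof -
    from that(3) obtain y where y: "y \<in> C" "y \<in> K" by blast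
    then have "connected_component_set Z y = K"
      unfolding K_def using connected_component_eq by metis
    then show ?thesis using connected_component_maximal[OF y(1) that(1,2)] by simp
  qed
  have clK: "closed K" unfolding K_def Z_def by (intro closed_connected_component) auto
  have "compact K" using clK KZ Z01
    by (meson bounded_subset bounded_closed_interval compact_eq_bounded_closed subset_trans)
  then have cint: "cint K" using cK AK z by (intro cintI) auto
  have conn: "connected ((f ^^ i) ` K)" "(f ^^ i) ` K \<subseteq> Z" for i
    using connected_continuous_image[OF funpow_cont_sub cK] KZ Z01 inv by blast+
  define m where "m = (LEAST m. m \<ge> 1 \<and> (f ^^ m) ` K \<inter> K \<noteq> {})"
  have ex: "n \<ge> 1 \<and> (f ^^ n) ` K \<inter> K \<noteq> {}" using ret AK by blast
  have m: "m \<ge> 1 \<and> (f ^^ m) ` K \<inter> K \<noteq> {}"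
    unfolding m_def by (rule LeastI[of _ n]) (rule ex)
  have least: "(f ^^ i) ` K \<inter> K = {}" if "0 < i" "i < m" for i
    using not_less_Least[of i "\<lambda>m. m \<ge> 1 \<and> (f ^^ m) ` K \<inter> K \<noteq> {}"] that
    unfolding m_def[symmetric] by auto
  have mK: "(f ^^ m) ` K \<subseteq> K" using max conn m by blast
  have disj: "(f ^^ i) ` K \<inter> (f ^^ j) ` K = {}" if "i < j" "j < m" for i j
  proof (rule ccontr)
    assume "(f ^^ i) ` K \<inter> (f ^^ j) ` K \<noteq> {}"
    then obtain u v where uv: "u \<in> K" "v \<in> K" "(f ^^ i) u = (f ^^ j) v" by auto
    then have "(f ^^ (m - j + i)) u = (f ^^ (m - j + j)) v" by (simp only: funpow_add comp_def)
    then have "(f ^^ (m - j + i)) u = (f ^^ m) v" using that by simp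
    then have "(f ^^ (m - j + i)) ` K \<inter> K \<noteq> {}" using uv mK by force
    moreover have "0 < m - j + i" "m - j + i < m" using that by auto
    ultimately show False using least[of "m - j + i"] by simp
  qed
  have "cyc K m" unfolding cyc_def using m cint mK KZ Z01 disj
    by (metis Int_commute nat_neq_iff subset_trans)
  moreover have "Z = orbit_set f K"
  proof
    show "Z \<subseteq> orbit_set f K" unfolding Z_def
      using cyc_orbit_closed(1)[OF \<open>cyc K m\<close>] orbit_set_mono[OF AK] by (rule closure_minimal[rotated])
    show "orbit_set f K \<subseteq> Z" unfolding orbit_set_def using conn by blast
  qed
  ultimately show ?thesis using AK unfolding Z_def by blast
qed

lemma periodic_imp_cyc: "periodic_interval f I k \<Longrightarrow> cyc I k"
  unfolding periodic_interval_def cyc_def cint_def disjoint_family_on_def by auto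

lemma cyc_imp_periodic:
  assumes "cyc K m" "(f ^^ m) ` K = K" "u \<in> K" "v \<in> K" "u \<noteq> v"
  shows "periodic_interval f K m"
proof -
  obtain c d where "c \<le> d" "K = {c..d}" using assms(1) unfolding cyc_def cint_def by blast
  moreover have "c < d" using calculation assms(3-5) by auto
  moreover have "m \<ge> 1" "K \<subseteq> {0..1}" "disjoint_family_on (\<lambda>i. (f ^^ i) ` K) {..<m}"
    using assms(1) by (simp_all add: cyc_def disjoint_family_on_def)
  ultimately show ?thesis using assms(2) unfolding periodic_interval_def by metis
qed

text \<open>\<open>(f ^^ m) t - t\<close> changes sign between the ends of \<open>K\<close>. As
  \<open>{a<..<b}\<close> contains no periodic points, such a point will show that an interval is
  not degenerate and that it extends to \<open>b\<close>.\<close>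

lemma cyc_has_Per:
  assumes "cyc K m"
  shows "\<exists>r\<in>K. (f ^^ m) r = r \<and> r \<in> Per f"
proof -
  obtain c d where cd: "c \<le> d" "K = {c..d}" using assms unfolding cyc_def cint_def by blast
  have K: "K \<subseteq> {0..1}" "(f ^^ m) ` K \<subseteq> K" "m \<ge> 1" using assms by (auto simp: cyc_def)
  have "continuous_on {c..d} (\<lambda>t. (f ^^ m) t - t)"
    using funpow_cont_sub[OF K(1), of m] cd by (intro continuous_intros) auto
  moreover have "(f ^^ m) c \<in> {c..d}" "(f ^^ m) d \<in> {c..d}"
    using K(2) cd(1) unfolding cd(2) image_subset_iff by (simp_all only: atLeastAtMost_iff order_refl)
  then have "(f ^^ m) c - c \<ge> 0" "(f ^^ m) d - d \<le> 0" by auto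
  ultimately obtain r where "c \<le> r" "r \<le> d" "(f ^^ m) r - r = 0"
    using IVT2'[of "\<lambda>t. (f ^^ m) t - t" d 0 c] cd by auto
  then show ?thesis using K cd unfolding Per_def by (intro bexI[of _ r]) auto
qed

lemma periodic_mult:
  assumes "periodic_interval f I k" "k dvd n" shows "(f ^^ n) ` I = I"
proof -
  have "(f ^^ (k * q)) ` I = I" for q
  proof (induction q)
    case (Suc q)
    have "(f ^^ (k * Suc q)) ` I = (f ^^ k) ` ((f ^^ (k * q)) ` I)"
      by (simp only: mult_Suc_right funpow_image_add)
    then show ?case using Suc assms(1) by (simp add: periodic_interval_def)
  qed simp
  then show ?thesis using assms(2) unfolding dvd_def by blast
qed

lemma periodic_funpow_image:
  assumes "periodic_interval f I k" shows "periodic_interval f ((f ^^ i) ` I) k"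
proof -
  have cyc: "cyc I k" using periodic_imp_cyc assms .
  have I: "I \<subseteq> {0..1}" "cint I" "k \<ge> 1" using cyc by (auto simp: cyc_def)
  have inv: "(f ^^ k) ` (f ^^ i) ` I = (f ^^ i) ` I"
  proof -
    have "(f ^^ (k + i)) ` I = (f ^^ (i + k)) ` I" by (simp only: add.commute)
    moreover have "(f ^^ k) ` I = I" using assms by (simp add: periodic_interval_def)
    ultimately show ?thesis by (simp only: funpow_image_add)
  qed
  \<comment> \<open>Since \<open>k * i - i + i\<close> is a multiple of \<open>k\<close>, this power
    undoes \<open>f ^^ i\<close> at the level of sets; overlapping or collapsing images would give
    the same for the original images of \<open>I\<close>.\<close>
  have unwind: "(f ^^ (k * i - i)) ` (f ^^ j) ` (f ^^ i) ` I = (f ^^ j) ` I" for j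
  proof -
    have "k * i - i + (j + i) = j + k * i" using I by simp
    then have "(f ^^ (k * i - i + (j + i))) ` I = (f ^^ (j + k * i)) ` I" by (simp only:)
    then show ?thesis using periodic_mult[OF assms, of "k * i"] by (simp only: funpow_image_add dvd_triv_left)
  qed
  have disj: "(f ^^ j) ` (f ^^ i) ` I \<inter> (f ^^ l) ` (f ^^ i) ` I = {}" if "j < k" "l < k" "j \<noteq> l" for j l
  proof -
    have "(f ^^ j) ` I \<inter> (f ^^ l) ` I = {}" using that cyc unfolding cyc_def by blast
    then show ?thesis using unwind[of j] unwind[of l] by blast
  qed
  have "cyc ((f ^^ i) ` I) k" unfolding cyc_def
    using I inv disj funpow_sub cint_funpow by auto
  moreover obtain u v where "u \<in> (f ^^ i) ` I" "v \<in> (f ^^ i) ` I" "u \<noteq> v"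
  proof -
    obtain c d where cd: "I = {c..d}" "c < d" using assms unfolding periodic_interval_def by blast
    have unwind: "(f ^^ (k * i - i)) ` (f ^^ i) ` I = I" using unwind[of 0] by simp
    have "\<exists>u v. u \<in> (f ^^ i) ` I \<and> v \<in> (f ^^ i) ` I \<and> u \<noteq> v"
    proof (rule ccontr)
      assume neg: "\<not> ?thesis"
      have "c \<in> (f ^^ (k * i - i)) ` (f ^^ i) ` I" unfolding unwind using cd by auto
      then obtain u where u: "c = (f ^^ (k * i - i)) u" "u \<in> (f ^^ i) ` I" by (rule imageE)
      have "d \<in> (f ^^ (k * i - i)) ` (f ^^ i) ` I" unfolding unwind using cd by auto
      then obtain v where v: "d = (f ^^ (k * i - i)) v" "v \<in> (f ^^ i) ` I" by (rule imageE)
      have "u = v" using neg u v by blast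
      then show False using u(1) v(1) cd(2) by simp
    qed
    then show ?thesis using that by blast
  qed
  ultimately show ?thesis using cyc_imp_periodic inv by blast
qed

end

section \<open>Shrinking intervals and limits of orbits\<close>

lemma mono_nat_dichotomy:
  fixes m :: "nat \<Rightarrow> nat"
  assumes "\<And>n. m n \<le> m (Suc n)"
  shows "filterlim m at_top sequentially \<or> (\<exists>N. \<forall>n\<ge>N. m n = m N)"
proof (cases "\<forall>B. \<exists>n. B \<le> m n")
  case True
  have "eventually (\<lambda>n. B \<le> m n) sequentially" for B
  proof -
    obtain N where "B \<le> m N" using True by blast
    then have "B \<le> m n" if "n \<ge> N" for n
      using lift_Suc_mono_le[of m, OF assms that] by simp
    then show ?thesis unfolding eventually_sequentially by blast
  qed
  then show ?thesis unfolding filterlim_at_top by blast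
next
  case False
  then obtain B where "\<And>n. m n < B" by (meson not_le)
  then have fin: "finite (range m)" by (meson finite_lessThan finite_subset image_subsetI lessThan_iff)
  then have "Max (range m) \<in> range m" by (intro Max_in) auto
  then obtain N where N: "m N = Max (range m)" by auto
  have "m n = m N" if "n \<ge> N" for n
    using lift_Suc_mono_le[of m, OF assms that] Max_ge[OF fin, of "m n"] N by auto
  then show ?thesis by blast
qed

lemma UN_nat_split: "(\<Union>i. F i) = (\<Union>i<n. F i) \<union> (\<Union>i. F (i + n :: nat))"
proof -
  have "i \<in> {..<n} \<union> range (\<lambda>i. i + n)" for i
    by (cases "i < n") (auto intro: range_eqI[of _ _ "i - n"])
  then have "UNIV = {..<n} \<union> range (\<lambda>i. i + n)" by blast
  then have "(\<Union>i. F i) = \<Union> (F ` ({..<n} \<union> range (\<lambda>i. i + n)))" by simp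
  also have "\<dots> = (\<Union>i<n. F i) \<union> (\<Union>i. F (i + n))" by (simp add: image_image image_Un)
  finally show ?thesis .
qed

text \<open>The point \<open>a\<close> may be an end of the intervals \<open>A n\<close>, so that
  two-sided and one-sided neighbourhoods are treated alike.\<close>

definition shrinks :: "(nat \<Rightarrow> real set) \<Rightarrow> real \<Rightarrow> bool" where
  "shrinks A a \<longleftrightarrow> (\<forall>n. a \<in> A n \<and> cint (A n) \<and> A n \<subseteq> {0..1} \<and> A (Suc n) \<subseteq> A n) \<and>
     (\<forall>e>0. \<exists>n. A n \<subseteq> {a - e..a + e})"

lemma shrinks_antimono: "shrinks A a \<Longrightarrow> i \<le> j \<Longrightarrow> A j \<subseteq> A i"
  unfolding shrinks_def using lift_Suc_antimono_le[of A i j] by blast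

lemma shrinks_avoid:
  assumes "shrinks A a" "y \<noteq> a" obtains n where "y \<notin> A n"
proof -
  have "\<bar>y - a\<bar> / 2 > 0" using assms by auto
  then obtain n where n: "A n \<subseteq> {a - \<bar>y - a\<bar> / 2..a + \<bar>y - a\<bar> / 2}"
    using assms(1) unfolding shrinks_def by blast
  have "y \<notin> A n"
  proof
    assume "y \<in> A n"
    then have "y \<in> {a - \<bar>y - a\<bar> / 2..a + \<bar>y - a\<bar> / 2}" using n by blast
    then have "\<bar>y - a\<bar> \<le> \<bar>y - a\<bar> / 2"
      by (auto simp: abs_le_iff simp del: le_divide_eq_numeral1)
    then show False using assms(2) by simp
  qed
  then show ?thesis using that by blast
qed

text \<open>For neighbourhoods \<open>A n\<close> of a point this is its first prolongation: what is
  reached from arbitrarily close by. One-sided neighbourhoods give a one-sided version.\<close>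

definition lim_orbit :: "(real \<Rightarrow> real) \<Rightarrow> (nat \<Rightarrow> real set) \<Rightarrow> real set" where
  "lim_orbit f A = (\<Inter>n. closure (orbit_set f (A n)))"

definition perfect :: "real set \<Rightarrow> bool" where
  "perfect M \<longleftrightarrow> (\<forall>E. finite E \<longrightarrow> M \<subseteq> closure (M - E))"

text \<open>The sign \<open>s\<close> selects the side of \<open>v\<close>, \<open>1\<close> the
  right and \<open>- 1\<close> the left one, so that one argument serves for both.\<close>

definition side :: "real \<Rightarrow> real \<Rightarrow> real \<Rightarrow> real set" where
  "side s e v = {z. 0 \<le> s * (z - v) \<and> s * (z - v) \<le> e}"

lemma side_eq:
  "s = 1 \<or> s = - 1 \<Longrightarrow> side s e v = (if s = 1 then {v..v + e} else {v - e..v})"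
  unfolding side_def by auto

lemma side_connected: "s = 1 \<or> s = - 1 \<Longrightarrow> connected (side s e v)"
  by (auto simp: side_eq)

lemma side_mono: "e \<le> e' \<Longrightarrow> side s e v \<subseteq> side s e' v"
  unfolding side_def by auto

context interval_map
begin

lemma shrinks_funpow:
  assumes "shrinks A a" "e > 0"
  shows "\<exists>N. \<forall>n\<ge>N. (f ^^ i) ` A n \<subseteq> {(f ^^ i) a - e<..<(f ^^ i) a + e}"
proof -
  have a: "a \<in> {0..1}" using assms unfolding shrinks_def by blast
  obtain d where d: "d > 0" "\<And>z. z \<in> {0..1} \<Longrightarrow> dist z a < d \<Longrightarrow> dist ((f ^^ i) z) ((f ^^ i) a) < e"
    using funpow_cont[of i] a assms(2) unfolding continuous_on_iff by meson
  obtain N where N: "A N \<subseteq> {a - d/2..a + d/2}"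
    using assms d(1) unfolding shrinks_def by (meson half_gt_zero)
  have "(f ^^ i) z \<in> {(f ^^ i) a - e<..<(f ^^ i) a + e}" if "z \<in> A n" "n \<ge> N" for z n
  proof -
    have "z \<in> A N" using shrinks_antimono[OF assms(1) that(2)] that by auto
    moreover have "z \<in> {0..1}" using assms(1) that unfolding shrinks_def by blast
    ultimately have "dist ((f ^^ i) z) ((f ^^ i) a) < e"
      using N d by (intro d(2)) (auto simp: dist_real_def abs_if)
    then show ?thesis by (auto simp: dist_real_def abs_if split: if_splits)
  qed
  then show ?thesis by blast
qed

lemma shrinks_funpow_avoid:
  assumes "shrinks A a" "z \<noteq> (f ^^ i) a"
  shows "\<exists>N. \<forall>n\<ge>N. z \<notin> (f ^^ i) ` A n"
proof -
  have "\<bar>z - (f ^^ i) a\<bar> > 0" using assms(2) by simp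
  then obtain N where N: "\<And>n. n \<ge> N \<Longrightarrow> (f ^^ i) ` A n \<subseteq>
    {(f ^^ i) a - \<bar>z - (f ^^ i) a\<bar><..<(f ^^ i) a + \<bar>z - (f ^^ i) a\<bar>}"
    using shrinks_funpow[OF assms(1)] by meson
  have "z \<notin> (f ^^ i) ` A n" if "n \<ge> N" for n
    using N[OF that] by (auto simp: abs_if split: if_splits dest!: subsetD[of _ _ z])
  then show ?thesis by blast
qed

lemma lim_orbit_compact:
  assumes "shrinks A a"
  shows "compact (closure (orbit_set f (A n)))" "closure (orbit_set f (A n)) \<subseteq> {0..1}"
    "closure (orbit_set f (A (Suc n))) \<subseteq> closure (orbit_set f (A n))"
proof -
  show *: "closure (orbit_set f (A n)) \<subseteq> {0..1}"
    using closure_orbit_sub assms unfolding shrinks_def by blast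
  then show "compact (closure (orbit_set f (A n)))"
    by (meson bounded_subset bounded_closed_interval compact_eq_bounded_closed closed_closure)
  show "closure (orbit_set f (A (Suc n))) \<subseteq> closure (orbit_set f (A n))"
    using assms unfolding shrinks_def by (intro closure_mono orbit_set_mono) auto
qed

text \<open>A point other than \<open>a\<close> leaves the sets \<open>A n\<close>, so by
  \<open>closure_orbit_split\<close> it comes from \<open>f\<close> of every closure; the second
  hypothesis secures this for \<open>a\<close> itself. Compactness then moves \<open>f\<close>
  outside the intersection.\<close>

lemma lim_orbit_image:
  assumes A: "shrinks A a" and a: "\<And>n. a \<in> f ` closure (orbit_set f (A n))"
  shows "f ` lim_orbit f A = lim_orbit f A"
proof -
  define Z where "Z n = closure (orbit_set f (A n))" for n
  have Z: "compact (Z n)" "Z n \<subseteq> {0..1}" "Z (Suc n) \<subseteq> Z n" for n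
    unfolding Z_def using lim_orbit_compact[OF A] by auto
  have dec: "Z j \<subseteq> Z i" if "i \<le> j" for i j using lift_Suc_antimono_le[of Z, OF Z(3) that] .
  have im: "f ` (\<Inter>n. Z n) = (\<Inter>n. f ` Z n)"
    by (rule image_INT_compact[where K = Z, OF Z(1,3) continuous_on_subset[OF cont Z(2)]])
  have split: "Z n = A n \<union> f ` Z n" for n
    unfolding Z_def using A by (intro closure_orbit_split) (auto simp: shrinks_def dest: cintD)
  have "(\<Inter>n. Z n) \<subseteq> (\<Inter>n. f ` Z n)"
  proof
    fix y assume y: "y \<in> (\<Inter>n. Z n)"
    show "y \<in> (\<Inter>n. f ` Z n)"
    proof (cases "y = a")
      case True then show ?thesis using a unfolding Z_def by auto
    next
      case False
      then obtain N where N: "y \<notin> A N" using shrinks_avoid[OF A] by blast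
      have "y \<in> f ` Z n" for n
      proof -
        have "y \<notin> A (max n N)" using N shrinks_antimono[OF A, of N "max n N"] by auto
        then have "y \<in> f ` Z (max n N)" using y split by blast
        then show ?thesis using dec[of n "max n N"] by auto
      qed
      then show ?thesis by blast
    qed
  qed
  moreover have "f ` Z n \<subseteq> Z n" for n using split[of n] by blast
  then have "(\<Inter>n. f ` Z n) \<subseteq> (\<Inter>n. Z n)" by (intro INF_mono) blast
  ultimately have "f ` (\<Inter>n. Z n) = (\<Inter>n. Z n)" using im by simp
  then show ?thesis unfolding lim_orbit_def Z_def .
qed

lemma cyc_nested:
  assumes "cyc K m" "cyc K' m'" "A' \<subseteq> K" "A' \<subseteq> K'" "A' \<noteq> {}" "orbit_set f K' \<subseteq> orbit_set f K"
  shows "K' \<subseteq> K \<and> m dvd m'"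
proof -
  have "connected K'" using assms(2) cintD unfolding cyc_def by blast
  moreover have "K' \<subseteq> orbit_set f K" using assms(6) orbit_set_superset[of K' f] by blast
  ultimately have "K' \<subseteq> K" using cyc_connected0[OF assms(1)] assms by blast
  moreover have "(f ^^ m') ` K' \<subseteq> K'" "K' \<noteq> {}" using assms by (auto simp: cyc_def)
  ultimately have "(f ^^ m') ` K \<inter> K \<noteq> {}" by blast
  then show ?thesis using cyc_dvd[OF assms(1)] \<open>K' \<subseteq> K\<close> by blast
qed

lemma cyc_sequence:
  assumes A: "shrinks A a" and ret: "\<And>n. \<exists>p\<ge>1. (f ^^ p) ` A n \<inter> A n \<noteq> {}"
  obtains K m where "\<And>n. cyc (K n) (m n)" "\<And>n. A n \<subseteq> K n"
    "\<And>n. closure (orbit_set f (A n)) = orbit_set f (K n)" "\<And>n. K (Suc n) \<subseteq> K n"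
    "\<And>n. m n dvd m (Suc n)"
proof -
  have "\<exists>K m. cyc K m \<and> A n \<subseteq> K \<and> closure (orbit_set f (A n)) = orbit_set f K" for n
    using ret[of n] cyc_exists[of "A n"] A unfolding shrinks_def by blast
  then obtain K m where *: "\<And>n. cyc (K n) (m n)" "\<And>n. A n \<subseteq> K n"
    "\<And>n. closure (orbit_set f (A n)) = orbit_set f (K n)" by metis
  have "K (Suc n) \<subseteq> K n \<and> m n dvd m (Suc n)" for n
  proof (rule cyc_nested[OF *(1) *(1), of "A (Suc n)"])
    show "A (Suc n) \<subseteq> K n" "A (Suc n) \<noteq> {}"
      using A *(2)[of n] unfolding shrinks_def by blast+
    show "A (Suc n) \<subseteq> K (Suc n)" using *(2) .
    show "orbit_set f (K (Suc n)) \<subseteq> orbit_set f (K n)"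
      using lim_orbit_compact(3)[OF A, of n] *(3) by simp
  qed
  then show ?thesis using that * by blast
qed

text \<open>The limit is the intersection of the \<open>K n\<close>. A point of
  \<open>lim_orbit f A\<close> lies in the image with the same index at all stages because the
  images of \<open>K 0\<close> are disjoint. That the return is onto comes from
  \<open>lim_orbit_image\<close>, as the \<open>K n\<close> are only mapped into themselves.\<close>

lemma cyc_limit:
  assumes A: "shrinks A a" and a: "\<And>n. a \<in> f ` closure (orbit_set f (A n))"
    and K: "\<And>n. cyc (K n) m" "\<And>n. A n \<subseteq> K n"
    "\<And>n. closure (orbit_set f (A n)) = orbit_set f (K n)" "\<And>n. K (Suc n) \<subseteq> K n"
  shows "\<exists>K. cyc K m \<and> (f ^^ m) ` K = K \<and> a \<in> K \<and> lim_orbit f A = orbit_set f K"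
proof -
  define L where "L = (\<Inter>n. K n)"
  have Kc: "compact (K n)" "connected (K n)" "K n \<subseteq> {0..1}" "m \<ge> 1" "(f ^^ m) ` K n \<subseteq> K n" for n
    using K(1)[of n] cintD unfolding cyc_def by auto
  have dec: "K j \<subseteq> K i" if "i \<le> j" for i j using lift_Suc_antimono_le[of K, OF K(4) that] .
  have im: "(f ^^ i) ` L = (\<Inter>n. (f ^^ i) ` K n)" for i
    unfolding L_def by (rule image_INT_compact[where K = K, OF Kc(1) K(4) funpow_cont_sub[OF Kc(3)]])
  have aL: "a \<in> L" unfolding L_def using K(2) A unfolding shrinks_def by blast
  have "connected L" unfolding L_def using connected_nest[of K] Kc dec by auto
  moreover have "compact L" unfolding L_def using Kc(1) by (intro compact_Inter) auto
  ultimately have cL: "cint L" using aL by (intro cintI) auto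
  have LK: "L \<subseteq> K n" for n unfolding L_def by blast
  have disj: "(f ^^ i) ` L \<inter> (f ^^ j) ` L = {}" if "i < m" "j < m" "i \<noteq> j" for i j
  proof -
    have "(f ^^ i) ` K 0 \<inter> (f ^^ j) ` K 0 = {}" using K(1)[of 0] that unfolding cyc_def by blast
    then show ?thesis using LK[of 0] by blast
  qed
  have "(\<Inter>n. (f ^^ m) ` K n) \<subseteq> (\<Inter>n. K n)" using Kc(5) by (intro INF_mono) blast
  then have "(f ^^ m) ` L \<subseteq> L" using im[of m] unfolding L_def by simp
  then have cyc: "cyc L m" unfolding cyc_def using cL LK[of 0] Kc(3)[of 0] Kc(4) disj by blast
  have lim: "lim_orbit f A = orbit_set f L"
  proof
    show "orbit_set f L \<subseteq> lim_orbit f A"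
      unfolding lim_orbit_def K(3) using orbit_set_mono[OF LK] by blast
    show "lim_orbit f A \<subseteq> orbit_set f L"
    proof
      fix z assume z: "z \<in> lim_orbit f A"
      have "\<exists>i<m. z \<in> (f ^^ i) ` K n" for n
      proof -
        have "z \<in> orbit_set f (K n)" using z unfolding lim_orbit_def K(3) by blast
        then have "z \<in> (\<Union>i<m. (f ^^ i) ` K n)" using cyc_orbit[OF K(1)[of n]] by simp
        then show ?thesis by (simp add: Bex_def)
      qed
      then obtain i where i: "\<And>n. i n < m" "\<And>n. z \<in> (f ^^ i n) ` K n" by metis
      have "i n = i 0" for n
      proof -
        have "z \<in> (f ^^ i n) ` K 0" using i(2)[of n] dec[of 0 n] by blast
        then show ?thesis using i(1)[of n] i(1)[of 0] i(2)[of 0] K(1)[of 0] unfolding cyc_def by blast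
      qed
      then have "z \<in> (f ^^ i 0) ` L" using i(2) im by (metis INT_I)
      then show "z \<in> orbit_set f L" unfolding orbit_set_def by blast
    qed
  qed
  have "L \<subseteq> (f ^^ m) ` L"
  proof
    fix z assume z: "z \<in> L"
    then have "z \<in> f ` lim_orbit f A"
      using lim orbit_set_superset lim_orbit_image[OF A a] by auto
    then obtain u where "u \<in> orbit_set f L" "z = f u" using lim by auto
    then obtain i w where iw: "i < m" "w \<in> L" "z = (f ^^ Suc i) w"
      unfolding cyc_orbit[OF cyc] by auto
    then have "(f ^^ Suc i) ` L \<inter> L \<noteq> {}" using z by blast
    then have "m dvd Suc i" using cyc_dvd[OF cyc] by blast
    then have "Suc i = m" using iw(1) by (auto dest: dvd_imp_le)
    then show "z \<in> (f ^^ m) ` L" using iw by blast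
  qed
  then have "(f ^^ m) ` L = L" using \<open>(f ^^ m) ` L \<subseteq> L\<close> by blast
  then show ?thesis using cyc aL lim by blast
qed

lemma shrinks_shift: "shrinks A a \<Longrightarrow> shrinks (\<lambda>n. A (n + N)) a"
  unfolding shrinks_def
proof (intro conjI allI impI; elim conjE)
  fix e :: real
  assume e: "e > 0" and A: "\<forall>e>0. \<exists>n. A n \<subseteq> {a - e..a + e}"
    "\<forall>n. a \<in> A n \<and> cint (A n) \<and> A n \<subseteq> {0..1} \<and> A (Suc n) \<subseteq> A n"
  obtain n where "A n \<subseteq> {a - e..a + e}" using A(1) e by blast
  moreover have "A (n + N) \<subseteq> A n" using lift_Suc_antimono_le[of A n "n + N"] A(2) by auto
  ultimately show "\<exists>n. A (n + N) \<subseteq> {a - e..a + e}" by blast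
qed auto

lemma lim_orbit_shift:
  assumes "shrinks A a" shows "lim_orbit f (\<lambda>n. A (n + N)) = lim_orbit f A"
proof -
  have "closure (orbit_set f (A (n + N))) \<subseteq> closure (orbit_set f (A n))" for n
    using shrinks_antimono[OF assms, of n "n + N"] by (intro closure_mono orbit_set_mono) auto
  then show ?thesis unfolding lim_orbit_def by auto
qed

lemma cyc_limit_eventually:
  assumes A: "shrinks A a" and a: "\<And>n. a \<in> f ` closure (orbit_set f (A n))"
    and K: "\<And>n. cyc (K n) (m n)" "\<And>n. A n \<subseteq> K n"
    "\<And>n. closure (orbit_set f (A n)) = orbit_set f (K n)" "\<And>n. K (Suc n) \<subseteq> K n"
    and N: "\<And>n. n \<ge> N \<Longrightarrow> m n = M"
  shows "\<exists>K. cyc K M \<and> (f ^^ M) ` K = K \<and> a \<in> K \<and> lim_orbit f A = orbit_set f K"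
proof -
  have "\<exists>K. cyc K M \<and> (f ^^ M) ` K = K \<and> a \<in> K \<and> lim_orbit f (\<lambda>n. A (n + N)) = orbit_set f K"
    using K N a by (intro cyc_limit[OF shrinks_shift[OF A], of N "\<lambda>n. K (n + N)"])
      (auto, metis le_add2)
  then show ?thesis using lim_orbit_shift[OF A] by simp
qed

text \<open>The images of \<open>K\<close> under the returns decrease, and by compactness their
  intersection is mapped onto itself. It keeps \<open>x\<close>, since by disjointness a preimage of
  \<open>x\<close> of order \<open>m * j\<close> in the orbit of \<open>K\<close> must lie in
  \<open>K\<close>; it also has a periodic point, different from \<open>x\<close>, so it is not
  degenerate.\<close>

lemma core_periodic:
  assumes K: "cyc K m" and x: "x \<in> K" "x \<notin> Per f" "\<And>j. x \<in> (f ^^ j) ` orbit_set f K"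
  shows "periodic_interval f (\<Inter>j. (f ^^ (m * j)) ` K) m \<and> x \<in> (\<Inter>j. (f ^^ (m * j)) ` K)"
proof -
  define E where "E j = (f ^^ (m * j)) ` K" for j
  define I where "I = (\<Inter>j. E j)"
  have Kc: "cint K" "K \<subseteq> {0..1}" "m \<ge> 1" using K by (auto simp: cyc_def)
  have E: "compact (E j)" "connected (E j)" for j
    unfolding E_def using cintD[OF cint_funpow[OF Kc(1,2)]] by auto
  have E_Suc: "E (Suc j) = (f ^^ m) ` E j" for j
    unfolding E_def by (simp add: funpow_add image_comp)
  have dec: "E (Suc j) \<subseteq> E j" for j
  proof (induction j)
    case 0 then show ?case using K unfolding E_def cyc_def by simp
  next
    case (Suc j) then show ?case using E_Suc by (metis image_mono)
  qed
  have dec': "E j \<subseteq> E i" if "i \<le> j" for i j using lift_Suc_antimono_le[of E, OF dec that] .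
  have E0: "E 0 = K" unfolding E_def by simp
  have IK: "I \<subseteq> K" unfolding I_def using E0 by blast
  have xI: "x \<in> I"
  proof -
    have "x \<in> E j" for j
    proof -
      obtain i u where iu: "i < m" "u \<in> K" "x = (f ^^ (m * j)) ((f ^^ i) u)"
        using x(3)[of "m * j"] unfolding cyc_orbit[OF K] by auto
      then have "x = (f ^^ (m * j + i)) u" by (simp add: funpow_add)
      then have "m dvd m * j + i" using cyc_dvd[OF K, of "m * j + i"] iu x(1) by blast
      then have "i = 0" using iu(1) by (metis dvd_add_right_iff dvd_triv_left nat_dvd_not_less neq0_conv)
      then show ?thesis unfolding E_def using iu by auto
    qed
    then show ?thesis unfolding I_def by blast
  qed
  have "connected I" unfolding I_def using connected_nest[of E] E dec' by auto
  moreover have "compact I" unfolding I_def using E(1) by (intro compact_Inter) auto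
  ultimately have cI: "cint I" using xI by (intro cintI) auto
  have "(f ^^ m) ` I = (\<Inter>j. (f ^^ m) ` E j)"
    unfolding I_def using E0 Kc(2) by (intro image_INT_compact E(1) dec funpow_cont_sub) auto
  also have "\<dots> = (\<Inter>j. E (Suc j))" using E_Suc by simp
  also have "\<dots> = I" unfolding I_def using dec by blast
  finally have inv: "(f ^^ m) ` I = I" .
  have disj: "(f ^^ i) ` I \<inter> (f ^^ j) ` I = {}" if "i < m" "j < m" "i \<noteq> j" for i j
  proof -
    have "(f ^^ i) ` K \<inter> (f ^^ j) ` K = {}" using K that unfolding cyc_def by blast
    then show ?thesis using IK by blast
  qed
  have cyc: "cyc I m" unfolding cyc_def using cI IK Kc inv disj by auto
  then have "periodic_interval f I m"
    using cyc_has_Per[OF cyc] x(2) xI by (metis cyc_imp_periodic inv)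
  then show ?thesis using xI unfolding I_def E_def by blast
qed

lemma core_mono:
  assumes "cyc K m" "cyc K' m'" "K' \<subseteq> K" "m dvd m'"
  shows "(\<Inter>j. (f ^^ (m' * j)) ` K') \<subseteq> (\<Inter>j. (f ^^ (m * j)) ` K)"
proof -
  obtain q where q: "m' = m * q" using assms(4) by blast
  have "q \<ge> 1" using assms(2) q by (cases q) (auto simp: cyc_def)
  have "(f ^^ (m' * j)) ` K' \<subseteq> (f ^^ (m * j)) ` K" for j
  proof -
    have "m' * j = m * j + m * ((q - 1) * j)"
      using q \<open>q \<ge> 1\<close> by (cases q) (auto simp: algebra_simps)
    then have "(f ^^ (m' * j)) ` K = (f ^^ (m * j)) ` (f ^^ (m * ((q - 1) * j))) ` K"
      by (simp only: funpow_image_add)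
    then show ?thesis using cyc_mult[OF assms(1)] assms(3) by blast
  qed
  then show ?thesis by blast
qed

lemma perfect_orbit:
  assumes "periodic_interval f J m" shows "perfect (orbit_set f J)"
  unfolding perfect_def
proof (intro allI impI subsetI)
  fix E :: "real set" and y assume E: "finite E" and y: "y \<in> orbit_set f J"
  obtain i where i: "y \<in> (f ^^ i) ` J" using y unfolding orbit_set_def by blast
  obtain c d where "c < d" "(f ^^ i) ` J = {c..d}"
    using periodic_funpow_image[OF assms, of i] unfolding periodic_interval_def by metis
  moreover have "{c..d} \<noteq> {a}" if "c < d" for a :: real
    using that by (metis atLeastAtMost_singleton_iff less_irrefl)
  ultimately have "y islimpt (f ^^ i) ` J"
    using i by (intro connected_imp_perfect) auto
  then have "y islimpt orbit_set f J" by (rule islimpt_subset) (auto simp: orbit_set_def)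
  then have "y islimpt E \<union> (orbit_set f J - E)" by (rule islimpt_subset) auto
  then have "y islimpt (orbit_set f J - E)" using islimpt_Un_finite[OF E] by blast
  then show "y \<in> closure (orbit_set f J - E)" by (simp add: closure_def)
qed

lemma orbit_split_n: "orbit_set f A = (\<Union>i<n. (f ^^ i) ` A) \<union> orbit_set f ((f ^^ n) ` A)"
proof -
  have "orbit_set f ((f ^^ n) ` A) = (\<Union>i. (f ^^ (i + n)) ` A)"
    unfolding orbit_set_def by (simp add: funpow_image_add)
  moreover have "(\<Union>i. (f ^^ i) ` A) = (\<Union>i<n. (f ^^ i) ` A) \<union> (\<Union>i. (f ^^ (i + n)) ` A)"
    by (rule UN_nat_split)
  ultimately show ?thesis unfolding orbit_set_def by simp
qed

text \<open>The orbit of \<open>A k\<close> consists of its first \<open>n\<close> images, which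
  shrink to \<open>n\<close> single points, and of the orbit of its image under
  \<open>f ^^ n\<close>. Any other point of \<open>M\<close> must be approximated by the latter
  part, and perfectness recovers the exceptional points.\<close>

lemma dense_transfer:
  assumes A: "shrinks A a" and M: "M \<subseteq> lim_orbit f A" "perfect M" and W: "(f ^^ n) ` A N \<subseteq> W"
  shows "M \<subseteq> closure (orbit_set f W)"
proof -
  have "z \<in> closure (orbit_set f W)" if z: "z \<in> M - (\<lambda>i. (f ^^ i) a) ` {..<n}" for z
  proof -
    have "\<exists>N. \<forall>k\<ge>N. z \<notin> (f ^^ i) ` A k" if "i < n" for i
      using shrinks_funpow_avoid[OF A] z that by blast
    then obtain P where P: "\<And>i k. i < n \<Longrightarrow> k \<ge> P i \<Longrightarrow> z \<notin> (f ^^ i) ` A k" by metis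
    define k where "k = Max (insert N (P ` {..<n}))"
    have k: "k \<ge> N" "\<And>i. i < n \<Longrightarrow> k \<ge> P i" unfolding k_def by auto
    have "z \<in> closure (orbit_set f (A k))" using z M(1) unfolding lim_orbit_def by blast
    also have "closure (orbit_set f (A k)) = (\<Union>i<n. (f ^^ i) ` A k) \<union> closure (orbit_set f ((f ^^ n) ` A k))"
    proof -
      have "closed ((f ^^ i) ` A k)" for i
      proof -
        have "cint (A k)" "A k \<subseteq> {0..1}" using A unfolding shrinks_def by auto
        then show ?thesis using cintD[OF cint_funpow[of "A k" i]] by simp
      qed
      then have "closed (\<Union>i<n. (f ^^ i) ` A k)" by (intro closed_UN) auto
      then show ?thesis using orbit_split_n[of "A k" n] by (metis closure_Un closure_closed)
    qed
    finally have "z \<in> closure (orbit_set f ((f ^^ n) ` A k))" using P k(2) by blast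
    moreover have "(f ^^ n) ` A k \<subseteq> W" using W shrinks_antimono[OF A k(1)] by blast
    ultimately show ?thesis using closure_mono[OF orbit_set_mono] by blast
  qed
  then have "closure (M - (\<lambda>i. (f ^^ i) a) ` {..<n}) \<subseteq> closure (orbit_set f W)"
    by (intro closure_minimal) auto
  moreover have "M \<subseteq> closure (M - (\<lambda>i. (f ^^ i) a) ` {..<n})"
    using M(2) unfolding perfect_def by auto
  ultimately show ?thesis by blast
qed

end

section \<open>One-sided dense orbits and infinite basic sets\<close>

text \<open>A one-sided form of the condition that defines basic sets. In this form it can be pulled
  back through iterates, because near a crossing point an interval covers a whole side.\<close>

definition good :: "(real \<Rightarrow> real) \<Rightarrow> real set \<Rightarrow> real \<Rightarrow> real \<Rightarrow> bool" where
  "good f M v s \<longleftrightarrow> (s = 1 \<or> s = - 1) \<and> (\<exists>e>0. side s e v \<subseteq> M) \<and>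
     (\<forall>e>0. M \<subseteq> closure (orbit_set f (side s e v \<inter> M)))"

lemma side_Int_mono: "e \<le> e' \<Longrightarrow> side s e v \<inter> M \<subseteq> side s e' v \<inter> M"
  using side_mono[of e e' s v] by blast

lemma base_in_side: "e \<ge> 0 \<Longrightarrow> v \<in> side s e v"
  unfolding side_def by simp

lemma good_mem: "good f M v s \<Longrightarrow> v \<in> M"
  unfolding good_def using base_in_side[of _ v s] by (meson less_imp_le subsetD)

lemma good_basic:
  assumes M: "closed M" "f ` M \<subseteq> M" and g: "good f M v s"
  shows "v \<in> basic_set f M"
  unfolding basic_set_def
proof (intro CollectI conjI allI impI)
  show "v \<in> M" using good_mem[OF g] .
  fix W assume W: "nbhd_in M v W"
  then obtain T where T: "openin (top_of_set M) T" "v \<in> T" "T \<subseteq> W"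
    unfolding nbhd_in_def by blast
  have WM: "W \<subseteq> M" using W unfolding nbhd_in_def by blast
  obtain e where e: "e > 0" "ball v e \<inter> M \<subseteq> T"
    using T(1,2) by (meson openin_contains_ball)
  have s: "s = 1 \<or> s = - 1" using g unfolding good_def by blast
  have "side s (e/2) v \<subseteq> ball v e" using s e(1) by (auto simp: side_eq dist_real_def)
  then have "side s (e/2) v \<inter> M \<subseteq> W" using e(2) T(3) by blast
  then have "M \<subseteq> closure (orbit_set f W)"
    using g e(1) closure_mono[OF orbit_set_mono] unfolding good_def by (meson half_gt_zero subset_trans)
  moreover have "closure (orbit_set f W) \<subseteq> M"
    using orbit_set_least[OF M(2) WM] M(1) by (rule closure_minimal)
  ultimately show "closure (orbit_set f W) = M" by blast
qed

context interval_map
begin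

text \<open>If the \<open>k\<close>-th iterate crosses the good side of \<open>c\<close> along an interval, the crossing point
  nearest to the good end maps a one-sided neighbourhood onto the good side, so it is good too.\<close>

lemma good_lift:
  assumes D: "connected D" "D \<subseteq> M" and M: "M \<subseteq> {0..1}" "f ` M \<subseteq> M" and g: "good f M c s"
    and z: "z \<in> D" "s * ((f ^^ k) z - c) > 0" and w: "w \<in> D" "s * ((f ^^ k) w - c) \<le> 0"
  obtains v t where "v \<in> closed_segment z w" "v \<noteq> z" "(f ^^ k) v = c" "good f M v t"
proof -
  define S where "S = closed_segment z w"
  have SD: "S \<subseteq> D" unfolding S_def
    using D(1) z(1) w(1) by (intro closed_segment_subset) (auto simp: is_interval_connected_1 is_interval_convex_1[symmetric])
  have S01: "S \<subseteq> {0..1}" using SD D(2) M(1) by blast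
  have s: "s = 1 \<or> s = - 1" using g unfolding good_def by blast
  define C where "C = S \<inter> (\<lambda>t. s * ((f ^^ k) t - c)) -` {..0}"
  have "closed S" unfolding S_def by simp
  moreover have "continuous_on S (\<lambda>t. s * ((f ^^ k) t - c))"
    using funpow_cont_sub[OF S01, of k] by (intro continuous_intros)
  ultimately have "closed C" unfolding C_def by (intro continuous_closed_preimage) auto
  moreover have "w \<in> C" unfolding C_def S_def using w by auto
  ultimately obtain v where v: "v \<in> C" "\<And>y. y \<in> C \<Longrightarrow> dist z v \<le> dist z y"
    using distance_attains_inf[of C z] by blast
  have vS: "v \<in> S" "s * ((f ^^ k) v - c) \<le> 0" using v(1) unfolding C_def by auto
  have vz: "v \<noteq> z" using vS z by auto
  have segS: "closed_segment v z \<subseteq> S" unfolding S_def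
    using vS(1) unfolding S_def by (simp add: subset_closed_segment)
  have pos: "s * ((f ^^ k) t - c) > 0" if "t \<in> closed_segment v z" "t \<noteq> v" for t
  proof (rule ccontr)
    assume "\<not> ?thesis"
    then have "t \<in> C" using that segS unfolding C_def by auto
    then have "dist z v \<le> dist z t" using v(2) by blast
    then show False using that by (auto simp: closed_segment_eq_real_ivl dist_real_def split: if_splits)
  qed
  have seg01: "closed_segment v z \<subseteq> {0..1}" using segS S01 by blast
  have hit: "y \<in> (f ^^ k) ` A" if "connected A" "A \<subseteq> {0..1}" "t \<in> A" "v \<in> A"
    "s * ((f ^^ k) v - c) \<le> s * (y - c)" "s * (y - c) \<le> s * ((f ^^ k) t - c)" for t y A
    using s
  proof
    assume "s = 1" then show ?thesis using that by (intro funpow_ivt[of A v t]) auto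
  next
    assume "s = - 1" then show ?thesis using that by (intro funpow_ivt[of A t v]) auto
  qed
  have "c \<in> (f ^^ k) ` closed_segment v z"
    using z vS(2) seg01 by (intro hit[of _ z]) auto
  then obtain u where u: "u \<in> closed_segment v z" "(f ^^ k) u = c" by blast
  then have "u = v" using pos[of u] by auto
  then have vc: "(f ^^ k) v = c" using u by simp
  \<comment> \<open>The direction from \<open>v\<close> towards \<open>z\<close>: on this side of
    \<open>v\<close> all points up to \<open>z\<close> are mapped strictly to the good side of
    \<open>c\<close>.\<close>
  define t where "t = sgn (z - v)"
  have t: "t = 1 \<or> t = - 1" using vz unfolding t_def by (auto simp: sgn_if)
  define d where "d = \<bar>z - v\<bar>"
  have d: "d > 0" using vz unfolding d_def by simp
  have sub: "side t e v \<subseteq> closed_segment v z" if "e \<le> d" for e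
    using that vz unfolding t_def d_def side_def
    by (auto simp: closed_segment_eq_real_ivl sgn_if split: if_splits)
  have sideM: "side t e v \<subseteq> M" if "e \<le> d" for e using sub[OF that] segS SD D(2) by blast
  have "M \<subseteq> closure (orbit_set f (side t e v \<inter> M))" if e: "e > 0" for e
  proof -
    define e1 where "e1 = min e d"
    have e1: "e1 > 0" "e1 \<le> d" "e1 \<le> e" using e d unfolding e1_def by auto
    have e1s: "v + t * e1 \<in> side t e1 v" using t e1 unfolding side_def by auto
    define e2 where "e2 = s * ((f ^^ k) (v + t * e1) - c)"
    have "v + t * e1 \<noteq> v" using t e1 by auto
    then have e2: "e2 > 0" unfolding e2_def using pos e1s sub[OF e1(2)] by blast
    have "side s e2 c \<subseteq> (f ^^ k) ` side t e1 v"
    proof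
      fix y assume "y \<in> side s e2 c"
      then have y: "0 \<le> s * (y - c)" "s * (y - c) \<le> e2" unfolding side_def by auto
      show "y \<in> (f ^^ k) ` side t e1 v"
        using y e1 vc sub[OF e1(2)] seg01
        by (intro hit[OF side_connected[OF t] _ e1s base_in_side]) (auto simp: e2_def)
    qed
    also have "(f ^^ k) ` side t e1 v \<subseteq> (f ^^ k) ` (side t e v \<inter> M)"
      using side_mono[OF e1(3)] sideM[OF e1(2)] by (intro image_mono) blast
    finally have "orbit_set f (side s e2 c \<inter> M) \<subseteq> orbit_set f (side t e v \<inter> M)"
      using orbit_set_image[of f k] orbit_set_mono by (meson inf_le1 order_trans)
    then show ?thesis using g e2 closure_mono unfolding good_def by (meson order_trans)
  qed
  then have "good f M v t" unfolding good_def using t d sideM[of d] by blast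
  moreover have "v \<in> closed_segment z w" using vS(1) unfolding S_def .
  ultimately show ?thesis using that vz vc by blast
qed

lemma orbit_periodic_closed:
  assumes "periodic_interval f J m"
  shows "closed (orbit_set f J)" "orbit_set f J \<subseteq> {0..1}" "f ` orbit_set f J \<subseteq> orbit_set f J"
  using cyc_orbit_closed[OF periodic_imp_cyc[OF assms]] orbit_set_fwd by auto

text \<open>Good preimages of \<open>v\<close> exist under every iterate by
  \<open>good_lift\<close>, and preimages of different orders are different because \<open>v\<close>
  is not periodic.\<close>

lemma good_infinite:
  assumes J: "periodic_interval f J m" and g: "good f (orbit_set f J) v s" and np: "v \<notin> Per f"
  shows "infinite (basic_set f (orbit_set f J))"
proof -
  define M where "M = orbit_set f J"
  have M: "closed M" "M \<subseteq> {0..1}" "f ` M \<subseteq> M"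
    unfolding M_def using orbit_periodic_closed[OF J] by auto
  have cyc: "cyc J m" using periodic_imp_cyc J .
  have m: "m \<ge> 1" using cyc unfolding cyc_def by blast
  obtain e where e: "e > 0" "side s e v \<subseteq> M" and s: "s = 1 \<or> s = - 1"
    using g unfolding good_def M_def by blast
  have "v \<in> M" using good_mem g unfolding M_def by blast
  then obtain i where i: "i < m" "v \<in> (f ^^ i) ` J" unfolding M_def cyc_orbit[OF cyc] by auto
  have side: "side s e v \<subseteq> (f ^^ i) ` J"
    using cyc_connected[OF cyc side_connected[OF s]] e i base_in_side[of e v s] unfolding M_def by fastforce
  have "\<exists>u t. (f ^^ n) u = v \<and> good f M u t" for n
  proof -
    \<comment> \<open>The index is chosen so that \<open>n\<close> further steps give
      \<open>i + m * n\<close>, which is \<open>i\<close> modulo the period; hence \<open>D\<close>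
      is mapped onto the component containing \<open>v\<close>.\<close>
    define D where "D = (f ^^ (i + (m - 1) * n)) ` J"
    have "n + (i + (m - 1) * n) = i + m * n" using m by (cases m) auto
    then have "(f ^^ n) ` D = (f ^^ (i + m * n)) ` J"
      unfolding D_def by (simp only: funpow_image_add[symmetric])
    also have "\<dots> = (f ^^ i) ` J"
      using periodic_mult[OF J] by (simp only: funpow_image_add dvd_triv_left)
    finally have Dim: "(f ^^ n) ` D = (f ^^ i) ` J" .
    have D: "connected D" "D \<subseteq> M"
    proof -
      show "connected D" unfolding D_def
        using cintD[OF cint_funpow] cyc unfolding cyc_def by blast
      show "D \<subseteq> M" unfolding D_def M_def orbit_set_def by blast
    qed
    have "v + s * e \<in> (f ^^ i) ` J" using side e(1) s unfolding side_def by auto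
    then obtain z where z: "z \<in> D" "(f ^^ n) z = v + s * e" using Dim by (metis imageE)
    obtain w where w: "w \<in> D" "(f ^^ n) w = v" using Dim i(2) by (metis imageE)
    have "s * ((f ^^ n) z - v) > 0" using z s e(1) by auto
    moreover have "s * ((f ^^ n) w - v) \<le> 0" using w by simp
    ultimately obtain u t where "(f ^^ n) u = v" "good f M u t"
      using good_lift[OF D M(2,3) g[folded M_def] z(1) _ w(1), of n] by metis
    then show ?thesis by blast
  qed
  then obtain u t where u: "\<And>n. (f ^^ n) (u n) = v" "\<And>n. good f M (u n) (t n)" by metis
  have "inj u"
  proof (rule linorder_injI)
    fix n n' :: nat assume "n < n'"
    show "u n \<noteq> u n'"
    proof
      assume eq: "u n = u n'"
      have "(f ^^ (n' - n)) v = (f ^^ (n' - n)) ((f ^^ n) (u n))" using u by simp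
      also have "\<dots> = (f ^^ n') (u n')"
        using \<open>n < n'\<close> eq by (metis comp_apply funpow_add le_add_diff_inverse2 less_imp_le)
      also have "\<dots> = v" using u by simp
      finally have "(f ^^ (n' - n)) v = v" .
      moreover have "n' - n \<ge> 1" using \<open>n < n'\<close> by simp
      ultimately have "v \<in> Per f" using \<open>v \<in> M\<close> M(2) unfolding Per_def by blast
      then show False using np by simp
    qed
  qed
  then have "infinite (range u)" using finite_imageD by blast
  moreover have "range u \<subseteq> basic_set f M" using good_basic[OF M(1,3) u(2)] by blast
  ultimately show ?thesis unfolding M_def using finite_subset by blast
qed

text \<open>If every good point were periodic, each set \<open>H j\<close> below would contain all or nothing of a right
  neighbourhood of \<open>x\<close>. As the good side of \<open>c\<close> visits that neighbourhood, a shift of indices would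
  then map \<open>insert 0 D\<close> injectively into \<open>D\<close>, although \<open>0 \<notin> D\<close>.\<close>

lemma basic_set_infinite:
  assumes J: "periodic_interval f {x..y} m" and np: "{x..<b} \<inter> Per f = {}" "x < b"
    and c: "c \<in> {x..y}" "(f ^^ p) x = c" "(f ^^ p) c = c" "p \<ge> 1" "m dvd p"
    and g: "good f (orbit_set f {x..y}) c s"
  shows "infinite (basic_set f (orbit_set f {x..y}))"
proof (rule ccontr)
  assume neg: "\<not> ?thesis"
  define M where "M = orbit_set f {x..y}"
  have M: "closed M" "M \<subseteq> {0..1}" "f ` M \<subseteq> M"
    unfolding M_def using orbit_periodic_closed[OF J] by auto
  have g: "good f M c s" using g unfolding M_def .
  have all_per: "v \<in> Per f" if "good f M v t" for v t
    using good_infinite[OF J] that neg unfolding M_def by blast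
  have cyc: "cyc {x..y} m" using periodic_imp_cyc J .
  have m: "m \<ge> 1" "x < y" "{x..y} \<subseteq> {0..1}" using J unfolding periodic_interval_def by auto
  have JM: "{x..y} \<subseteq> M" unfolding M_def by (rule orbit_set_superset)
  have s: "s = 1 \<or> s = - 1" using g unfolding good_def by blast
  have cp: "(f ^^ (p * k)) c = c" for k by (induction k) (auto simp: funpow_add c(3))
  have xp: "(f ^^ (p * k)) x = c" if "k \<ge> 1" for k
  proof -
    have "p * k = p * (k - 1) + p" using that by (cases k) auto
    then have "(f ^^ (p * k)) x = (f ^^ (p * (k - 1))) ((f ^^ p) x)" by (simp only: funpow_add comp_def)
    then show ?thesis using c(2) cp by simp
  qed
  have cper: "c \<in> Per f" using c m(3) unfolding Per_def by auto
  then have xc: "x < c" "b \<le> c" using c(1) np by fastforce+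
  have Jinv: "(f ^^ (m * k)) ` {x..y} = {x..y}" for k using periodic_mult[OF J] by simp
  have Jp: "(f ^^ (p * k)) ` {x..y} = {x..y}" for k using periodic_mult[OF J] c(5) by simp
  \<comment> \<open>The point \<open>v\<close> is periodic, and completing its cycle from
    \<open>c\<close> onwards takes a multiple of \<open>p\<close> steps, which fix
    \<open>c\<close>.\<close>
  have uniq: "v = c" if gv: "good f M v t" "(f ^^ (p * k)) v = c" for v t k
  proof -
    obtain r where r: "r \<ge> 1" "(f ^^ r) v = v" using all_per[OF gv(1)] unfolding Per_def by blast
    have rk: "(f ^^ (r * j)) v = v" for j by (induction j) (auto simp: funpow_add r(2))
    have "v = (f ^^ (r * (p * k))) v" using rk by simp
    also have "r * (p * k) = p * (k * (r - 1)) + p * k" using r(1) by (cases r) (auto simp: algebra_simps)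
    also have "(f ^^ \<dots>) v = (f ^^ (p * (k * (r - 1)))) c" using gv(2) by (simp add: funpow_add)
    also have "\<dots> = c" using cp .
    finally show ?thesis .
  qed
  \<comment> \<open>A point of \<open>{x..c}\<close> sent to the good side would, together with
    \<open>x\<close>, enclose a good preimage of \<open>c\<close> other than \<open>c\<close>,
    against \<open>uniq\<close>. The same idea gives \<open>right\<close>.\<close>
  have left: "s * ((f ^^ (p * k)) z - c) \<le> 0" if zk: "k \<ge> 1" "x \<le> z" "z \<le> c" for z k
  proof (rule ccontr)
    assume "\<not> ?thesis"
    then have z: "s * ((f ^^ (p * k)) z - c) > 0" by simp
    have "z \<noteq> c" using z cp by auto
    obtain v t where v: "v \<in> closed_segment z x" "(f ^^ (p * k)) v = c" "good f M v t"
    proof (rule good_lift[OF _ JM M(2,3) g _ z, of x])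
      show "s * ((f ^^ (p * k)) x - c) \<le> 0" using xp[OF zk(1)] by simp
    qed (use zk c(1) in auto)
    then show False using uniq[OF v(3,2)] zk \<open>z \<noteq> c\<close>
      by (auto simp: closed_segment_eq_real_ivl split: if_splits)
  qed
  obtain e where e: "e > 0" "side s e c \<subseteq> M" using g unfolding good_def by blast
  have "side s e c \<subseteq> {x..y}"
    using cyc_connected0[OF cyc side_connected[OF s]] e c(1) base_in_side[of e c s] unfolding M_def by fastforce
  moreover have "c + s * e \<in> side s e c" using e(1) s unfolding side_def by auto
  ultimately have ce: "c + s * e \<in> {x..y}" by blast
  have reach: "\<exists>u\<in>{x..y}. s * ((f ^^ (p * k)) u - c) > 0" for k
  proof -
    obtain u where "u \<in> {x..y}" "(f ^^ (p * k)) u = c + s * e" using ce Jp by (metis imageE)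
    then show ?thesis using s e(1) by (intro bexI[of _ u]) auto
  qed
  have right: "s * ((f ^^ (p * k)) z - c) > 0" if k: "k \<ge> 1" and z: "c < z" "z \<le> y" for z k
  proof (rule ccontr)
    assume zneg: "\<not> ?thesis"
    obtain u where u: "u \<in> {x..y}" and upos: "s * ((f ^^ (p * k)) u - c) > 0"
      using reach by blast
    then have "c < u" using left[OF k, of u] u by force
    obtain v t where v: "v \<in> closed_segment u z" "v \<noteq> u" "(f ^^ (p * k)) v = c" "good f M v t"
      using good_lift[OF _ JM M(2,3) g _ upos, of z] u z zneg c(1) by auto
    then have "v = c" using uniq by blast
    then show False using v(1) \<open>c < u\<close> z(1) by (auto simp: closed_segment_eq_real_ivl split: if_splits)
  qed
  have cy: "c < y"
  proof (rule ccontr)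
    assume "\<not> c < y"
    then have "c = y" using c(1) by auto
    obtain u where u: "u \<in> {x..y}" "s * ((f ^^ (p * 1)) u - c) > 0" using reach by blast
    then show False using left[of 1 u] \<open>c = y\<close> by auto
  qed
  \<comment> \<open>For \<open>s = - 1\<close> the map \<open>f ^^ p\<close> would take
    \<open>y\<close> to the left of \<open>c\<close> and then back, against \<open>right\<close>
    with \<open>k = 2\<close>.\<close>
  have "s = 1"
  proof (rule ccontr)
    assume "s \<noteq> 1"
    then have s: "s = - 1" using s by blast
    have y: "y \<in> {x..y}" using m by simp
    then have py: "(f ^^ p) y \<in> {x..y}" using Jp[of 1] by (metis imageI mult.right_neutral)
    have "(f ^^ p) y < c" using right[of 1 y] cy s by simp
    then have "(f ^^ p) ((f ^^ p) y) \<ge> c" using left[of 1 "(f ^^ p) y"] py s by simp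
    moreover have "(f ^^ (p * 2)) y = (f ^^ p) ((f ^^ p) y)" by (simp add: mult_2_right funpow_add)
    ultimately show False using right[of 2 y] cy s by simp
  qed
  define q where "q = p div m"
  have q: "p = m * q" "q \<ge> 1" using c(4,5) unfolding q_def by (auto simp: dvd_div_eq_0_iff Suc_le_eq)
  \<comment> \<open>This records which points are to the right of \<open>c\<close> after
    \<open>j\<close> returns. By \<open>left\<close> and \<open>right\<close>, one application of
    \<open>f ^^ p\<close>, that is \<open>q\<close> returns, does not change the answer, so
    \<open>j\<close> matters only modulo \<open>q\<close>.\<close>
  define H where "H j = {z \<in> {x..y}. c < (f ^^ (m * j)) z}" for j
  have step: "(f ^^ (m * i)) z \<in> H j" if "z \<in> H (j + i)" for i j z
  proof -
    have "(f ^^ (m * (j + i))) z = (f ^^ (m * j)) ((f ^^ (m * i)) z)"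
      by (simp add: distrib_left funpow_add)
    moreover have "(f ^^ (m * i)) z \<in> {x..y}" using that Jinv[of i] unfolding H_def by blast
    ultimately show ?thesis using that unfolding H_def by simp
  qed
  have period: "H (j + q * k) = H j" for j k
  proof (induction k)
    case (Suc k)
    have "H (i + q) = H i" for i
    proof -
      have "c < (f ^^ (m * (i + q))) z \<longleftrightarrow> c < (f ^^ (m * i)) z" if z: "z \<in> {x..y}" for z
      proof -
        define u where "u = (f ^^ (m * i)) z"
        have u: "u \<in> {x..y}" using z Jinv[of i] unfolding u_def by blast
        have "m * (i + q) = p + m * i" using q by (simp add: algebra_simps)
        then have "(f ^^ (m * (i + q))) z = (f ^^ p) u" unfolding u_def by (simp only: funpow_add comp_def)
        then show ?thesis using left[of 1 u] right[of 1 u] u \<open>s = 1\<close> unfolding u_def[symmetric] by force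
      qed
      then show ?thesis unfolding H_def by blast
    qed
    from this[of "j + q * k"] show ?case using Suc by (simp add: algebra_simps)
  qed simp
  have mod_q: "H j = H (j mod q)" for j using period[of "j mod q" "j div q"] by simp
  define D where "D = {j. j < q \<and> x \<in> H j}"
  have finD: "finite D" unfolding D_def by simp
  have cH: "c \<in> H j" if "j \<in> D" for j
  proof -
    have "x \<in> H (j + q)" using that period[of j 1] unfolding D_def by simp
    then have "(f ^^ (m * q)) x \<in> H j" using step by blast
    then show ?thesis using q c(2) by simp
  qed
  have "\<exists>e>0. \<forall>z\<in>side 1 e c. z \<noteq> c \<longrightarrow> z \<in> H j" if "j \<in> insert 0 D" for j
  proof (cases "j = 0")
    case True
    have "\<forall>z\<in>side 1 (y - c) c. z \<noteq> c \<longrightarrow> z \<in> H 0"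
      using xc unfolding H_def side_def by auto
    then show ?thesis using cy True by (intro exI[of _ "y - c"]) auto
  next
    case False
    then have "c \<in> H j" using that cH by blast
    then have pos: "c < (f ^^ (m * j)) c" unfolding H_def by simp
    have "continuous_on {x..y} (f ^^ (m * j))" using funpow_cont_sub m(3) by blast
    then obtain d where d: "d > 0"
      "\<And>z. z \<in> {x..y} \<Longrightarrow> dist z c < d \<Longrightarrow> dist ((f ^^ (m * j)) z) ((f ^^ (m * j)) c) < (f ^^ (m * j)) c - c"
      using c(1) pos unfolding continuous_on_iff by (metis diff_gt_0_iff_gt)
    define e where "e = min (d / 2) (y - c)"
    have "z \<in> H j" if "z \<in> side 1 e c" for z
    proof -
      have z: "z \<in> {x..y}" "dist z c < d"
        using that xc d(1) unfolding side_def e_def by (auto simp: dist_real_def)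
      then show ?thesis using d(2)[OF z] unfolding H_def by (auto simp: dist_real_def)
    qed
    moreover have "e > 0" using d(1) cy unfolding e_def by simp
    ultimately show ?thesis by blast
  qed
  then obtain E where E: "\<And>j. j \<in> insert 0 D \<Longrightarrow> E j > 0"
    "\<And>j z. j \<in> insert 0 D \<Longrightarrow> z \<in> side 1 (E j) c \<Longrightarrow> z \<noteq> c \<Longrightarrow> z \<in> H j" by metis
  \<comment> \<open>So small that every point other than \<open>c\<close> within \<open>e\<close> to
    the right of \<open>c\<close> belongs to \<open>H j\<close> for all finitely many relevant
    \<open>j\<close> at once.\<close>
  define e where "e = Min (E ` insert 0 D)"
  have e: "e > 0" "\<And>j. j \<in> insert 0 D \<Longrightarrow> e \<le> E j"
    unfolding e_def using finD E(1) by auto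
  have "M \<subseteq> closure (orbit_set f (side 1 e c \<inter> M))"
    using g e(1) \<open>s = 1\<close> unfolding good_def by simp
  moreover have "(x + min b y) / 2 \<in> M" using JM np(2) m(2) by (auto simp: field_simps min_def)
  ultimately have "(x + min b y) / 2 \<in> closure (orbit_set f (side 1 e c \<inter> M))" by blast
  moreover have "open {x<..<min b y}" "(x + min b y) / 2 \<in> {x<..<min b y}"
    using np(2) m(2) by (auto simp: field_simps min_def)
  ultimately obtain o' where o': "o' \<in> {x<..<min b y}" "o' \<in> orbit_set f (side 1 e c \<inter> M)"
    by (meson closure_iff_nhds_not_empty disjoint_iff subset_refl)
  then obtain n u where u: "u \<in> side 1 e c" "u \<in> M" "o' = (f ^^ n) u" unfolding orbit_set_def by auto
  have "u \<noteq> c"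
  proof
    assume "u = c"
    then have "(f ^^ p) o' = o'" using u(3) c(3) by (metis funpow_swap1 add.commute comp_apply funpow_add)
    then have "o' \<in> Per f" using c(4) o'(1) m(3) unfolding Per_def by auto
    moreover have "o' \<in> {x..<b}" using o'(1) by simp
    ultimately show False using np(1) by blast
  qed
  have uH: "u \<in> H j" if "j \<in> insert 0 D" for j
    using E(2)[OF that subsetD[OF side_mono[OF e(2)[OF that]] u(1)] \<open>u \<noteq> c\<close>] .
  then have "u \<in> {x..y}" unfolding H_def by blast
  moreover have "(f ^^ n) u \<in> {x..y}" using u(3) o'(1) by auto
  ultimately have "(f ^^ n) ` {x..y} \<inter> {x..y} \<noteq> {}" by blast
  then have "m dvd n" using cyc_dvd[OF cyc] by blast
  then obtain i where i: "n = m * i" by blast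
  \<comment> \<open>Otherwise \<open>good_lift\<close> yields a good point between \<open>x\<close>
    and \<open>o'\<close>. By \<open>all_per\<close> it is periodic, but \<open>{x..<b}\<close>
    contains no periodic point.\<close>
  have xH: "x \<in> H j" if "o' \<in> H j" for j
  proof (rule ccontr)
    assume "x \<notin> H j"
    then have "1 * ((f ^^ (m * j)) x - c) \<le> 0" using m(2) unfolding H_def by auto
    moreover have "1 * ((f ^^ (m * j)) o' - c) > 0" "o' \<in> {x..y}" using that unfolding H_def by auto
    moreover have "x \<in> {x..y}" using m(2) by simp
    ultimately obtain v t where v: "v \<in> closed_segment o' x" "good f M v t"
      using good_lift[OF connected_Icc JM M(2,3) g[unfolded \<open>s = 1\<close>], of o' "m * j" x] by metis
    then have "v \<in> {x..<b}" using o'(1) by (auto simp: closed_segment_eq_real_ivl)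
    then show False using all_per[OF v(2)] np by blast
  qed
  \<comment> \<open>Subtraction of \<open>i\<close> modulo \<open>q\<close>, written without
    truncated subtraction: adding \<open>i * (q - 1)\<close> has the same effect.\<close>
  define sh where "sh j = (j + i * (q - 1)) mod q" for j
  have "sh j \<in> D" if j: "j \<in> insert 0 D" for j
  proof -
    have "j + i * (q - 1) + i = j + q * i" using q(2) by (cases q) auto
    then have "H (sh j + i) = H j"
      by (metis mod_q mod_add_left_eq mod_mult_self2 sh_def)
    then have "o' \<in> H (sh j)" using step[of u "sh j" i] uH[OF j] u(3) i by simp
    then have "x \<in> H (sh j)" by (rule xH)
    then show ?thesis unfolding D_def sh_def using q(2) by simp
  qed
  moreover have "inj_on sh (insert 0 D)"
  proof (rule inj_onI)
    fix j k assume jk: "j \<in> insert 0 D" "k \<in> insert 0 D" "sh j = sh k"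
    have lt: "j < q" "k < q" using jk q(2) unfolding D_def by auto
    have "(sh l + i) mod q = l mod q" for l
    proof -
      have "l + i * (q - 1) + i = l + q * i" using q(2) by (cases q) auto
      then show ?thesis unfolding sh_def by (metis mod_add_left_eq mod_mult_self2)
    qed
    then have "j mod q = k mod q" using jk(3) by metis
    then show "j = k" using lt by simp
  qed
  ultimately have "card (insert 0 D) \<le> card D" using finD by (intro card_inj_on_le[of sh]) auto
  moreover have "0 \<notin> D" using xc(1) unfolding D_def H_def by simp
  ultimately show False using finD by simp
qed

end

section \<open>Periodic intervals at nonwandering points\<close>

definition nbhd_seq :: "real \<Rightarrow> nat \<Rightarrow> real set" where
  "nbhd_seq x n = {x - 1 / real (Suc n)..x + 1 / real (Suc n)} \<inter> {0..1}"

abbreviation near_lim :: "(real \<Rightarrow> real) \<Rightarrow> real \<Rightarrow> real set" where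
  "near_lim f x \<equiv> lim_orbit f (nbhd_seq x)"

lemma inverse_Suc_small: "e > 0 \<Longrightarrow> \<exists>n. 1 / real (Suc n) < e"
  using reals_Archimedean[of e] by (simp add: inverse_eq_divide)

lemma inverse_Suc_antimono: "1 / real (Suc (Suc n)) \<le> 1 / real (Suc n)"
  by (intro divide_left_mono) auto

lemma shrinksI:
  assumes "x \<in> {0..1}" "\<And>n. x \<in> A n" "\<And>n. compact (A n)" "\<And>n. connected (A n)" "\<And>n. A n \<subseteq> {0..1}"
    "\<And>n. A (Suc n) \<subseteq> A n" "\<And>n. A n \<subseteq> {x - 1 / real (Suc n)..x + 1 / real (Suc n)}"
  shows "shrinks A x"
  unfolding shrinks_def
proof (intro conjI allI impI)
  fix e :: real assume "e > 0"
  then obtain n where "1 / real (Suc n) < e" using inverse_Suc_small by blast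
  then have "{x - 1 / real (Suc n)..x + 1 / real (Suc n)} \<subseteq> {x - e..x + e}" by auto
  then show "\<exists>n. A n \<subseteq> {x - e..x + e}" using assms(7)[of n] by blast
next
  fix n show "cint (A n)" using assms(2)[of n] assms(3,4) by (intro cintI) auto
qed (use assms in auto)

lemma nbhd_seq_shrinks:
  assumes "x \<in> {0..1}" shows "shrinks (nbhd_seq x) x"
proof (rule shrinksI[OF assms])
  fix n
  show "nbhd_seq x (Suc n) \<subseteq> nbhd_seq x n"
    unfolding nbhd_seq_def using inverse_Suc_antimono[of n] by (intro Int_mono) auto
  show "connected (nbhd_seq x n)" unfolding nbhd_seq_def by simp
qed (use assms in \<open>auto simp: nbhd_seq_def compact_Int\<close>)

lemma nbhd_seq_small:
  assumes "e > 0" shows "\<exists>N. \<forall>n\<ge>N. nbhd_seq x n \<subseteq> {x - e<..<x + e}"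
proof -
  obtain N where N: "1 / real (Suc N) < e" using inverse_Suc_small assms by blast
  have "nbhd_seq x n \<subseteq> {x - e<..<x + e}" if "n \<ge> N" for n
  proof -
    have "1 / real (Suc n) \<le> 1 / real (Suc N)" using that by (intro divide_left_mono) auto
    then show ?thesis using N unfolding nbhd_seq_def by auto
  qed
  then show ?thesis by blast
qed

lemma nonwandering_return:
  assumes "x \<in> nonwandering f" "open T" "x \<in> T"
  obtains n w where "n \<ge> 1" "w \<in> T" "w \<in> {0..1}" "(f ^^ n) w \<in> T" "(f ^^ n) w \<in> {0..1}"
proof -
  have "nbhd_in {0..1} x (T \<inter> {0..1})"
  proof -
    have "openin (top_of_set {0..1}) (T \<inter> {0..1})"
      using openin_open_Int[OF assms(2), of "{0..1}"] by (simp only: Int_commute)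
    moreover have "x \<in> T \<inter> {0..1}" using assms(1,3) unfolding nonwandering_def by blast
    ultimately show ?thesis unfolding nbhd_in_def by blast
  qed
  then obtain n where "n \<ge> 1" "(f ^^ n) ` (T \<inter> {0..1}) \<inter> (T \<inter> {0..1}) \<noteq> {}"
    using assms(1) unfolding nonwandering_def by blast
  then show ?thesis using that by blast
qed

context interval_map
begin

text \<open>Returns into ever smaller neighbourhoods of \<open>x\<close> end at proper images of
  points of \<open>nbhd_seq x n\<close>. This is the hypothesis on the base point in
  \<open>lim_orbit_image\<close>.\<close>

lemma nonwandering_near:
  assumes x: "x \<in> nonwandering f"
  shows "x \<in> f ` closure (orbit_set f (nbhd_seq x n))"
proof -
  have x01: "x \<in> {0..1}" using x unfolding nonwandering_def by blast
  have B: "nbhd_seq x n \<subseteq> {0..1}" unfolding nbhd_seq_def by blast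
  have "x \<in> closure (f ` orbit_set f (nbhd_seq x n))"
    unfolding closure_iff_nhds_not_empty
  proof (intro allI impI)
    fix A V assume V: "x \<in> V" "V \<subseteq> A" "open V"
    define T where "T = V \<inter> {x - 1 / real (Suc n)<..<x + 1 / real (Suc n)}"
    have "open T" "x \<in> T" using V unfolding T_def by auto
    then obtain k w where kw: "k \<ge> 1" "w \<in> T" "w \<in> {0..1}" "(f ^^ k) w \<in> T"
      using nonwandering_return[OF x] by metis
    have "w \<in> nbhd_seq x n" using kw unfolding T_def nbhd_seq_def by auto
    moreover have "(f ^^ k) w = f ((f ^^ (k - 1)) w)" using kw(1) by (cases k) auto
    ultimately have "(f ^^ k) w \<in> f ` orbit_set f (nbhd_seq x n)" unfolding orbit_set_def by auto
    then show "f ` orbit_set f (nbhd_seq x n) \<inter> A \<noteq> {}" using kw(4) V(2) unfolding T_def by blast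
  qed
  then show ?thesis using image_closure[OF orbit_set_sub[OF B], of 1] by simp
qed

lemma near_lim_image:
  assumes "x \<in> nonwandering f" shows "f ` near_lim f x = near_lim f x"
proof (rule lim_orbit_image[OF nbhd_seq_shrinks])
  show "x \<in> {0..1}" using assms unfolding nonwandering_def by blast
qed (rule nonwandering_near[OF assms])

lemma near_lim_funpow:
  assumes "x \<in> nonwandering f" shows "(f ^^ j) ` near_lim f x = near_lim f x"
proof (induction j)
  case (Suc j)
  have "(f ^^ Suc j) ` near_lim f x = f ` (f ^^ j) ` near_lim f x" by (simp add: image_comp)
  then show ?case using Suc near_lim_image[OF assms] by simp
qed simp

lemma in_near_lim: "x \<in> {0..1} \<Longrightarrow> x \<in> near_lim f x"
  unfolding lim_orbit_def using nbhd_seq_shrinks[of x] orbit_set_superset closure_subset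
  unfolding shrinks_def by blast

lemma nonwandering_return_nbhd_seq:
  assumes x: "x \<in> nonwandering f" shows "\<exists>p\<ge>1. (f ^^ p) ` nbhd_seq x n \<inter> nbhd_seq x n \<noteq> {}"
proof -
  have "open {x - 1 / real (Suc n)<..<x + 1 / real (Suc n)}" "x \<in> {x - 1 / real (Suc n)<..<x + 1 / real (Suc n)}" by auto
  then obtain k w where kw: "k \<ge> 1" "w \<in> {x - 1 / real (Suc n)<..<x + 1 / real (Suc n)}" "w \<in> {0..1}"
    "(f ^^ k) w \<in> {x - 1 / real (Suc n)<..<x + 1 / real (Suc n)}" "(f ^^ k) w \<in> {0..1}"
    using nonwandering_return[OF x] by metis
  then have "w \<in> nbhd_seq x n" "(f ^^ k) w \<in> nbhd_seq x n" unfolding nbhd_seq_def by auto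
  then show ?thesis using kw(1) by blast
qed

text \<open>The intervals \<open>I n\<close> are the cores of the cyclic intervals around
  \<open>nbhd_seq x n\<close>. The periods divide one another, so they either tend to infinity or
  are finally constant; in the latter case the intervals converge to one whose orbit is all of
  \<open>near_lim f x\<close>.\<close>

lemma nonwandering_intervals:
  assumes x: "x \<in> nonwandering f" "x \<notin> Per f"
  obtains I k where "\<And>n. periodic_interval f (I n) (k n)" "\<And>n. x \<in> I n"
    "\<And>n. I n \<subseteq> closure (orbit_set f (nbhd_seq x n))" "\<And>n. I (Suc n) \<subseteq> I n"
    "filterlim k at_top sequentially \<or> (\<exists>K m. periodic_interval f K m \<and> x \<in> K \<and> near_lim f x = orbit_set f K)"
proof -
  have x01: "x \<in> {0..1}" using x unfolding nonwandering_def by blast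
  note sh = nbhd_seq_shrinks[OF x01]
  obtain K m where K: "\<And>n. cyc (K n) (m n)" "\<And>n. nbhd_seq x n \<subseteq> K n"
    "\<And>n. closure (orbit_set f (nbhd_seq x n)) = orbit_set f (K n)" "\<And>n. K (Suc n) \<subseteq> K n"
    "\<And>n. m n dvd m (Suc n)"
    using cyc_sequence[OF sh nonwandering_return_nbhd_seq[OF x(1)]] by blast
  define I where "I n = (\<Inter>j. (f ^^ (m n * j)) ` K n)" for n
  have xK: "x \<in> K n" for n using K(2) sh unfolding shrinks_def by blast
  have xj: "x \<in> (f ^^ j) ` orbit_set f (K n)" for j n
  proof -
    have "x \<in> (f ^^ j) ` near_lim f x" using near_lim_funpow[OF x(1)] in_near_lim[OF x01] by simp
    moreover have "near_lim f x \<subseteq> orbit_set f (K n)" unfolding lim_orbit_def using K(3) by blast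
    ultimately show ?thesis by blast
  qed
  have I: "periodic_interval f (I n) (m n) \<and> x \<in> I n" for n
    unfolding I_def by (rule core_periodic[OF K(1) xK x(2) xj])
  have IK: "I n \<subseteq> K n" for n unfolding I_def by (rule INF_lower2[of 0]) auto
  have sub: "I n \<subseteq> closure (orbit_set f (nbhd_seq x n))" for n
    using IK[of n] orbit_set_superset[of "K n" f] K(3) by auto
  have dec: "I (Suc n) \<subseteq> I n" for n unfolding I_def by (rule core_mono[OF K(1) K(1) K(4,5)])
  have "m n \<le> m (Suc n)" for n
    using K(1)[of "Suc n"] by (intro dvd_imp_le[OF K(5)]) (auto simp: cyc_def)
  then consider "filterlim m at_top sequentially" | N where "\<And>n. n \<ge> N \<Longrightarrow> m n = m N"
    using mono_nat_dichotomy by blast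
  then have "filterlim m at_top sequentially \<or> (\<exists>K m. periodic_interval f K m \<and> x \<in> K \<and> near_lim f x = orbit_set f K)"
  proof cases
    case (2 N)
    obtain L where L: "cyc L (m N)" "(f ^^ m N) ` L = L" "x \<in> L" "near_lim f x = orbit_set f L"
      using cyc_limit_eventually[OF sh nonwandering_near[OF x(1)] K(1-4) 2] by blast
    obtain r where "r \<in> L" "r \<noteq> x" using cyc_has_Per[OF L(1)] x(2) by blast
    then show ?thesis using cyc_imp_periodic[OF L(1,2) _ L(3)] L by blast
  qed simp
  then show ?thesis using that I sub dec by blast
qed

text \<open>An interior iterate of \<open>x\<close> has neighbourhoods inside \<open>W\<close> that
  contain the image of a whole small neighbourhood of \<open>x\<close>, so
  \<open>dense_transfer\<close> applies.\<close>

lemma interior_basic: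
  assumes A: "shrinks A x" and J: "periodic_interval f J k"
    and sub: "orbit_set f J \<subseteq> lim_orbit f A"
    and int: "(f ^^ j) x \<in> (top_of_set {0..1}) interior_of (orbit_set f J)"
  shows "(f ^^ j) x \<in> basic_set f (orbit_set f J)"
  unfolding basic_set_def
proof (intro CollectI conjI allI impI)
  define M where "M = orbit_set f J"
  have M: "closed M" "M \<subseteq> {0..1}" "f ` M \<subseteq> M"
    unfolding M_def using orbit_periodic_closed[OF J] by auto
  show "(f ^^ j) x \<in> orbit_set f J" using int interior_of_subset by (rule subsetD[rotated])
  fix W assume W: "nbhd_in (orbit_set f J) ((f ^^ j) x) W"
  obtain O1 where O1: "open O1" "(f ^^ j) x \<in> O1" "{0..1} \<inter> O1 \<subseteq> M"
    using int unfolding M_def interior_of_def openin_open by blast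
  obtain O2 where O2: "open O2" "(f ^^ j) x \<in> O2" "M \<inter> O2 \<subseteq> W"
    using W unfolding M_def nbhd_in_def openin_open by blast
  have "open (O1 \<inter> O2)" "(f ^^ j) x \<in> O1 \<inter> O2" using O1 O2 by auto
  then obtain e where e: "e > 0" "ball ((f ^^ j) x) e \<subseteq> O1 \<inter> O2" by (meson openE)
  obtain N where "(f ^^ j) ` A N \<subseteq> {(f ^^ j) x - e<..<(f ^^ j) x + e}"
    using shrinks_funpow[OF A e(1), of j] by blast
  moreover have "{(f ^^ j) x - e<..<(f ^^ j) x + e} = ball ((f ^^ j) x) e"
    by (simp add: ball_eq_greaterThanLessThan)
  moreover have "(f ^^ j) ` A N \<subseteq> {0..1}" using A funpow_sub unfolding shrinks_def by blast
  ultimately have "(f ^^ j) ` A N \<subseteq> W" using e(2) O1(3) O2(3) by blast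
  then have "M \<subseteq> closure (orbit_set f W)"
    using dense_transfer[OF A sub perfect_orbit[OF J]] unfolding M_def by blast
  moreover have "W \<subseteq> M" using W unfolding M_def nbhd_in_def by blast
  then have "closure (orbit_set f W) \<subseteq> M"
    using orbit_set_least[OF M(3)] M(1) by (intro closure_minimal) auto
  ultimately show "closure (orbit_set f W) = orbit_set f J" unfolding M_def by blast
qed

text \<open>The continuous function \<open>(f ^^ k) t - t\<close> has no zero on
  \<open>{a<..<b}\<close>, hence constant sign there.\<close>

lemma same_direction:
  assumes U: "{a<..<b} \<subseteq> {0..1}" "{a<..<b} \<inter> Per f = {}"
    and uv: "u \<in> {a<..<b}" "v \<in> {a<..<b}" "k \<ge> 1"
  shows "u < (f ^^ k) u \<longleftrightarrow> v < (f ^^ k) v"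
proof -
  have "continuous_on {a<..<b} (\<lambda>t. (f ^^ k) t - t)"
    using funpow_cont_sub[OF U(1), of k] by (intro continuous_intros)
  then have conn: "connected ((\<lambda>t. (f ^^ k) t - t) ` {a<..<b})"
    by (intro connected_continuous_image) auto
  have cross: "0 \<in> (\<lambda>t. (f ^^ k) t - t) ` {a<..<b}"
    if "t \<in> {a<..<b}" "t' \<in> {a<..<b}" "(f ^^ k) t \<le> t" "t' \<le> (f ^^ k) t'" for t t'
    using connectedD_interval[OF conn, of "(f ^^ k) t - t" "(f ^^ k) t' - t'" 0] that by auto
  have "(f ^^ k) t \<noteq> t" if "t \<in> {a<..<b}" for t using that U uv(3) unfolding Per_def by blast
  then have "0 \<notin> (\<lambda>t. (f ^^ k) t - t) ` {a<..<b}" by force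
  then show ?thesis using cross[OF uv(1,2)] cross[OF uv(2,1)] by (meson less_imp_le not_less)
qed

text \<open>The condition on the iterates before the first entry into the basic set is automatic: by
  \<open>interior_basic\<close> an interior iterate would already belong to it.\<close>

lemma in_Omega_basicI:
  assumes x: "x \<in> nonwandering f" and J: "periodic_interval f {x..y} k"
    and sub: "orbit_set f {x..y} \<subseteq> near_lim f x"
    and n: "(f ^^ n) x \<in> basic_set f (orbit_set f {x..y})"
    and inf: "infinite (basic_set f (orbit_set f {x..y}))"
  shows "in_Omega_basic f {x..y} x"
proof -
  have x01: "x \<in> {0..1}" using x unfolding nonwandering_def by blast
  have "\<exists>i c d. (f ^^ i) ` {x..y} = {c..d} \<and> (x = c \<or> x = d)"
    by (intro exI[of _ 0] exI[of _ x] exI[of _ y]) auto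
  moreover have "(f ^^ j) x \<notin> (top_of_set {0..1}) interior_of (orbit_set f {x..y})"
    if "j < (LEAST n. (f ^^ n) x \<in> basic_set f (orbit_set f {x..y}))" for j
    using not_less_Least[OF that] interior_basic[OF nbhd_seq_shrinks[OF x01] J sub] by blast
  ultimately have "x \<in> Omega_basic_extra f {x..y}" using x n unfolding Omega_basic_extra_def by blast
  then show ?thesis using inf J unfolding in_Omega_basic_def basic_set_exists_def Omega_basic_set_def by blast
qed

lemma finite_boundary:
  assumes J: "periodic_interval f J k"
  shows "finite (orbit_set f J - (top_of_set {0..1}) interior_of (orbit_set f J))"
proof -
  have "\<exists>c d. (f ^^ i) ` J = {c..d}" for i
    using periodic_funpow_image[OF J, of i] unfolding periodic_interval_def by metis
  then obtain c d where cd: "\<And>i. (f ^^ i) ` J = {c i..d i}" by metis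
  have "orbit_set f J - (top_of_set {0..1}) interior_of (orbit_set f J) \<subseteq> c ` {..<k} \<union> d ` {..<k}"
  proof
    fix z assume z: "z \<in> orbit_set f J - (top_of_set {0..1}) interior_of (orbit_set f J)"
    then obtain i where i: "i < k" "z \<in> {c i..d i}"
      using orbit_set_periodic_interval[OF J] cd by auto
    have "\<not> (c i < z \<and> z < d i)"
    proof
      assume "c i < z \<and> z < d i"
      moreover have "{c i<..<d i} \<subseteq> (f ^^ i) ` J" unfolding cd by auto
      then have "{c i<..<d i} \<subseteq> orbit_set f J" unfolding orbit_set_def by blast
      moreover have "orbit_set f J \<subseteq> {0..1}" using orbit_periodic_closed[OF J] by blast
      ultimately have *: "{c i<..<d i} \<subseteq> orbit_set f J" "{0..1} \<inter> {c i<..<d i} = {c i<..<d i}"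
        "z \<in> {c i<..<d i}" by auto
      moreover have "openin (top_of_set {0..1}) {c i<..<d i}"
        using openin_open_Int[of "{c i<..<d i}" "{0..1}"] *(2) by simp
      ultimately have "z \<in> (top_of_set {0..1}) interior_of (orbit_set f J)"
        unfolding interior_of_def by blast
      then show False using z by blast
    qed
    then have "z = c i \<or> z = d i" using i by auto
    then show "z \<in> c ` {..<k} \<union> d ` {..<k}" using i by blast
  qed
  then show ?thesis by (rule finite_subset) auto
qed

end

section \<open>Intervals without periodic points whose returns all go to the right\<close>

locale right_moving = interval_map +
  fixes a b :: real
  assumes ab: "a < b" and U01: "{a<..<b} \<subseteq> {0..1}" and no_Per: "{a<..<b} \<inter> Per f = {}"
    and right: "\<And>x n. x \<in> {a<..<b} \<Longrightarrow> n \<ge> 1 \<Longrightarrow> (f ^^ n) x \<in> {a<..<b} \<Longrightarrow> x < (f ^^ n) x"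
begin

abbreviation "NW \<equiv> nonwandering f \<inter> {a<..<b}"

lemma U_bounds: "0 \<le> a" "b \<le> 1"
proof -
  have "closure {a<..<b} \<subseteq> {0..1}" using U01 by (intro closure_minimal) auto
  then show "0 \<le> a" "b \<le> 1" using ab by auto
qed

lemma all_right:
  assumes w: "w \<in> {a<..<b}" "n \<ge> 1" "(f ^^ n) w \<in> {a<..<b}" and v: "v \<in> {a<..<b}"
  shows "v < (f ^^ n) v"
  using same_direction[OF U01 no_Per w(1) v w(2)] right[OF w] by blast

text \<open>An orbit point in \<open>{a<..<x - e}\<close> would be a return to
  \<open>{a<..<b}\<close> that moves to the left.\<close>

lemma left_blocked:
  assumes V: "{x - e..x + e} \<subseteq> {a<..<b}" and A: "A \<subseteq> {x - e..x + e}"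
  shows "closure (orbit_set f A) \<inter> {a<..<x - e} = {}"
proof -
  have "orbit_set f A \<inter> {a<..<x - e} = {}"
  proof (rule ccontr)
    assume "\<not> ?thesis"
    then obtain z where "z \<in> orbit_set f A" "z \<in> {a<..<x - e}" by blast
    then obtain n w where nw: "w \<in> A" "(f ^^ n) w \<in> {a<..<x - e}" unfolding orbit_set_def by blast
    have w: "w \<in> {x - e..x + e}" "w \<in> {a<..<b}" using nw(1) A V by auto
    then have "n \<ge> 1" using nw(2) by (cases n) auto
    moreover have "(f ^^ n) w \<in> {a<..<b}" using nw(2) w by auto
    ultimately show False using right[OF w(2)] nw(2) w(1) by force
  qed
  then show ?thesis using open_Int_closure_eq_empty[of "{a<..<x - e}" "orbit_set f A"] by (simp add: Int_commute)
qed

lemma near_lim_left: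
  assumes x: "x \<in> {a<..<b}" shows "near_lim f x \<inter> {a<..<x} = {}"
proof (rule ccontr)
  assume "\<not> ?thesis"
  then obtain t where t: "t \<in> near_lim f x" "a < t" "t < x" by auto
  define e where "e = min (x - t) (b - x) / 2"
  have "e \<le> (x - t) / 2" "e \<le> (b - x) / 2" "e > 0" using t x unfolding e_def by auto
  then have e: "e > 0" "t < x - e" "{x - e..x + e} \<subseteq> {a<..<b}" using t x by auto
  obtain N where "nbhd_seq x N \<subseteq> {x - e<..<x + e}" using nbhd_seq_small[OF e(1)] by blast
  then have "nbhd_seq x N \<subseteq> {x - e..x + e}"
    using greaterThanLessThan_subseteq_atLeastAtMost_iff[of "x - e" "x + e"] by auto
  moreover have "t \<in> {a<..<x - e}" using t(2) e(2) by simp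
  ultimately have "t \<notin> closure (orbit_set f (nbhd_seq x N))" using left_blocked[OF e(3)] by blast
  then show False using t(1) unfolding lim_orbit_def by blast
qed

text \<open>The interval contains a periodic point, and the first one to the right of
  \<open>z\<close> can occur no earlier than at \<open>b\<close>.\<close>

lemma periodic_reaches_b:
  assumes I: "periodic_interval f {z..y} k" and z: "a < z" "z < b" shows "b \<le> y"
proof -
  obtain r where r: "r \<in> {z..y}" "r \<in> Per f" using cyc_has_Per[OF periodic_imp_cyc[OF I]] by blast
  then have "r \<notin> {a<..<b}" using no_Per by blast
  then show ?thesis using r(1) z by auto
qed

text \<open>By \<open>near_lim_left\<close> the interval cannot extend to the left of
  \<open>x\<close>, so \<open>x\<close> is its left end.\<close>

lemma periodic_in_near_lim:
  assumes x: "x \<in> {a<..<b}" and J: "periodic_interval f J k" "x \<in> J" "J \<subseteq> near_lim f x"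
  obtains y where "J = {x..y}" "b \<le> y"
proof -
  obtain c d where cd: "c < d" "J = {c..d}" using J unfolding periodic_interval_def by blast
  have "c = x"
  proof (rule ccontr)
    assume "c \<noteq> x"
    then have "c < x" using cd J(2) by auto
    obtain t where "a < t" "t < x" using x dense[of a x] by auto
    then have "max c t \<in> J \<inter> {a<..<x}"
      using \<open>c < x\<close> cd J(2) by (auto simp: less_max_iff_disj)
    then show False using near_lim_left[OF x] J(3) by blast
  qed
  moreover have "b \<le> d" using periodic_reaches_b J(1) cd \<open>c = x\<close> x by auto
  ultimately show ?thesis using that cd by blast
qed

lemma periodic_in_nbhd_seq:
  assumes x: "x \<in> {a<..<b}" and e: "{x - e..x + e} \<subseteq> {a<..<b}" "A \<subseteq> {x - e..x + e}" "e > 0"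
    and J: "periodic_interval f J k" "x \<in> J" "J \<subseteq> closure (orbit_set f A)"
  obtains z y where "J = {z..y}" "x - e \<le> z" "z \<le> x" "b \<le> y"
proof -
  obtain c d where cd: "c < d" "J = {c..d}" using J unfolding periodic_interval_def by blast
  have "x - e \<in> {x - e..x + e}" using e(3) by simp
  then have "x - e \<in> {a<..<b}" using e(1) by blast
  then have ax: "a < x - e" by simp
  have "x - e \<le> c"
  proof (rule ccontr)
    assume "\<not> ?thesis"
    then have "c < x - e" by simp
    obtain t where "a < t" "t < x - e" using ax dense[of a "x - e"] by auto
    then have "max c t \<in> J \<inter> {a<..<x - e}"
      using \<open>c < x - e\<close> cd J(2) e(3) by (auto simp: less_max_iff_disj)
    then show False using left_blocked[OF e(1,2)] J(3) by blast
  qed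
  moreover have "c \<le> x" using cd J(2) by auto
  moreover have "b \<le> d" using periodic_reaches_b[of c d k] J(1) cd ax x calculation by auto
  ultimately show ?thesis using that cd by blast
qed

text \<open>A return of the common subinterval to itself after \<open>n\<close> steps forces every
  period \<open>k j\<close> to divide \<open>n\<close>, although the periods are unbounded.\<close>

lemma wandering_interval:
  assumes I: "\<And>n. periodic_interval f (I n) (k n)" "filterlim k at_top sequentially"
    and c: "\<And>n. {c<..<d} \<subseteq> I n"
  shows "nonwandering f \<inter> {c<..<d} = {}"
proof (rule ccontr)
  assume "\<not> ?thesis"
  then obtain x where x: "x \<in> nonwandering f" "x \<in> {c<..<d}" by blast
  obtain n w where nw: "n \<ge> 1" "w \<in> {c<..<d}" "(f ^^ n) w \<in> {c<..<d}"
    using nonwandering_return[OF x(1) open_greaterThanLessThan x(2)] by metis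
  have "k j \<le> n" for j
  proof -
    have "(f ^^ n) ` I j \<inter> I j \<noteq> {}" using nw c[of j] by blast
    then have "k j dvd n" using cyc_dvd[OF periodic_imp_cyc[OF I(1)]] by blast
    then show ?thesis using nw(1) by (intro dvd_imp_le) auto
  qed
  moreover obtain j where "k j \<ge> Suc n"
    using I(2) unfolding filterlim_at_top eventually_sequentially by blast
  ultimately show False by (metis not_less_eq_eq)
qed

lemma small_nbhd:
  assumes "x \<in> {a<..<b}" "d > 0"
  obtains e where "e > 0" "e < d" "{x - e..x + e} \<subseteq> {a<..<b}"
proof
  define e where "e = min d (min (x - a) (b - x)) / 2"
  have "e \<le> d / 2" "e \<le> (x - a) / 2" "e \<le> (b - x) / 2" and e: "e > 0"
    using assms unfolding e_def by auto
  then show "e > 0" "e < d" "{x - e..x + e} \<subseteq> {a<..<b}" using assms by auto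
qed

text \<open>This holds for both outcomes of \<open>nonwandering_intervals\<close>, at the price that
  the left end is only close to \<open>x\<close>. It supplies a smaller interval before anything is
  known about the type of the next nonwandering point.\<close>

lemma periodic_near:
  assumes x: "x \<in> NW" and d: "d > 0"
  obtains z y k A where "periodic_interval f {z..y} k" "x - d < z" "z \<le> x" "b \<le> y"
    "A \<subseteq> {x - d<..<x + d}" "x \<in> A" "{z..y} \<subseteq> closure (orbit_set f A)"
proof -
  have x': "x \<in> nonwandering f" "x \<in> {a<..<b}" "x \<notin> Per f" "x \<in> {0..1}"
    using x no_Per U01 by auto
  obtain I k where I: "\<And>n. periodic_interval f (I n) (k n)" "\<And>n. x \<in> I n"
    "\<And>n. I n \<subseteq> closure (orbit_set f (nbhd_seq x n))"
    using nonwandering_intervals[OF x'(1,3)] by metis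
  obtain e where e: "e > 0" "e < d" "{x - e..x + e} \<subseteq> {a<..<b}" using small_nbhd[OF x'(2) d] .
  obtain N where N: "nbhd_seq x N \<subseteq> {x - e<..<x + e}" using nbhd_seq_small[OF e(1)] by blast
  then have N': "nbhd_seq x N \<subseteq> {x - e..x + e}"
    by (meson greaterThanLessThan_subseteq_atLeastAtMost_iff order_refl subset_trans)
  obtain z y where zy: "I N = {z..y}" "x - e \<le> z" "z \<le> x" "b \<le> y"
    using periodic_in_nbhd_seq[OF x'(2) e(3) N' e(1) I(1,2,3)] .
  have "nbhd_seq x N \<subseteq> {x - d<..<x + d}" using N e(2) by auto
  moreover have "x \<in> nbhd_seq x N" using nbhd_seq_shrinks[OF x'(4)] unfolding shrinks_def by blast
  ultimately show ?thesis using that[of z y "k N" "nbhd_seq x N"] I(1)[of N] I(3)[of N] zy e(2) by auto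
qed

text \<open>Only finitely many points of the orbit can be boundary points of \<open>M\<close>; the
  infinitely many others are interior and therefore in the basic set by
  \<open>interior_basic\<close>.\<close>

lemma infinite_orbit_basic:
  assumes x: "x \<in> NW" and K: "periodic_interval f K m" "x \<in> K" "near_lim f x = orbit_set f K"
    and inf: "infinite (orbit f x)"
  shows "\<exists>y. K = {x..y} \<and> in_Omega_basic f {x..y} x"
proof -
  have x': "x \<in> nonwandering f" "x \<in> {a<..<b}" "x \<in> {0..1}" using x U01 by auto
  define M where "M = orbit_set f K"
  obtain y where y: "K = {x..y}" using periodic_in_near_lim[OF x'(2) K(1,2)] K(3) orbit_set_superset by metis
  define F where "F = M - (top_of_set {0..1}) interior_of M"
  have "finite F" unfolding F_def M_def by (rule finite_boundary[OF K(1)])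
  moreover have "orbit f x \<subseteq> M" unfolding M_def orbit_def orbit_set_def using K(2) by blast
  ultimately have "infinite (orbit f x - F)" "orbit f x - F \<subseteq> (top_of_set {0..1}) interior_of M"
    using inf unfolding F_def by auto
  moreover have "orbit f x \<inter> (top_of_set {0..1}) interior_of M \<subseteq> basic_set f M"
    using interior_basic[OF nbhd_seq_shrinks[OF x'(3)] K(1)] K(3) unfolding M_def orbit_def by auto
  ultimately have sub: "orbit f x - F \<subseteq> basic_set f M" "infinite (orbit f x - F)" by blast+
  then have "orbit f x - F \<noteq> {}" by (metis finite.emptyI)
  then obtain z where "z \<in> orbit f x - F" by blast
  then obtain n where "(f ^^ n) x \<in> basic_set f M" using sub(1) unfolding orbit_def by blast
  moreover have "infinite (basic_set f M)" using sub finite_subset by blast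
  ultimately show ?thesis using in_Omega_basicI[OF x'(1) K(1)[unfolded y]] K(3) y unfolding M_def by blast
qed

end

section \<open>One-sided neighbourhoods and points with finite orbit\<close>

definition side_seq :: "real \<Rightarrow> real \<Rightarrow> nat \<Rightarrow> real set" where
  "side_seq s c n = side s (1 / real (Suc n)) c \<inter> {0..1}"

lemma side_seq_shrinks:
  assumes "s = 1 \<or> s = - 1" "c \<in> {0..1}" shows "shrinks (side_seq s c) c"
proof (rule shrinksI[OF assms(2)])
  fix n
  show "side_seq s c (Suc n) \<subseteq> side_seq s c n"
    unfolding side_seq_def using side_Int_mono[OF inverse_Suc_antimono] .
  show "c \<in> side_seq s c n" using assms(2) unfolding side_seq_def by (auto intro: base_in_side)
  show "compact (side_seq s c n)" unfolding side_seq_def using assms(1) by (auto simp: side_eq)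
  show "connected (side_seq s c n)" unfolding side_seq_def using assms(1) by (auto simp: side_eq)
  show "side_seq s c n \<subseteq> {0..1}" unfolding side_seq_def by blast
  show "side_seq s c n \<subseteq> {c - 1 / real (Suc n)..c + 1 / real (Suc n)}"
    unfolding side_seq_def using assms(1) by (auto simp: side_eq split: if_splits intro: order_trans[of _ c])
qed

lemma finite_orbit_eventual:
  assumes "finite (orbit f x)"
  obtains p where "p \<ge> 1" "(f ^^ p) ((f ^^ p) x) = (f ^^ p) x"
proof -
  have "\<not> inj (\<lambda>n. (f ^^ n) x)"
  proof
    assume "inj (\<lambda>n. (f ^^ n) x)"
    then have "infinite (range (\<lambda>n. (f ^^ n) x))" using finite_imageD by blast
    moreover have "range (\<lambda>n. (f ^^ n) x) = orbit f x" unfolding orbit_def by auto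
    ultimately show False using assms by simp
  qed
  then obtain i j where "i \<noteq> j" "(f ^^ i) x = (f ^^ j) x" unfolding inj_def by blast
  then obtain i d where id: "d \<ge> 1" "(f ^^ (i + d)) x = (f ^^ i) x"
  proof (cases "i < j")
    case True
    then show ?thesis using that[of "j - i" i] \<open>(f ^^ i) x = (f ^^ j) x\<close> by simp
  next
    case False
    then have "j < i" using \<open>i \<noteq> j\<close> by simp
    then show ?thesis using that[of "i - j" j] \<open>(f ^^ i) x = (f ^^ j) x\<close> by simp
  qed
  have "(f ^^ (i + n + d * k)) x = (f ^^ (i + n)) x" for n k
  proof (induction k)
    case (Suc k)
    have "i + n + d * Suc k = (n + d * k) + (i + d)" by simp
    then have "(f ^^ (i + n + d * Suc k)) x = (f ^^ (n + d * k)) ((f ^^ i) x)"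
      using id(2) by (simp only: funpow_add comp_def)
    also have "\<dots> = (f ^^ (i + n + d * k)) x"
      by (metis add.assoc add.commute comp_apply funpow_add)
    finally show ?case using Suc by simp
  qed simp
  note per = this
  \<comment> \<open>A multiple of the period \<open>d\<close> that is also at least the preperiod
    \<open>i\<close>, so that \<open>f ^^ p\<close> takes \<open>x\<close> into its cycle and fixes
    every point of it.\<close>
  define p where "p = d * (i + 1)"
  have p: "p \<ge> 1" "p \<ge> i" using id(1) unfolding p_def by (cases d; simp)+
  have "(f ^^ (i + (p - i) + d * (i + 1))) x = (f ^^ (i + (p - i))) x" by (rule per)
  then have "(f ^^ (p + p)) x = (f ^^ p) x" using p(2) unfolding p_def[symmetric] by simp
  then have "(f ^^ p) ((f ^^ p) x) = (f ^^ p) x" by (simp add: funpow_add)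
  then show ?thesis using that p by blast
qed

context interval_map
begin

lemma orbit_set_periodic_image:
  assumes "periodic_interval f K m" shows "orbit_set f ((f ^^ i) ` K) = orbit_set f K"
proof
  show "orbit_set f ((f ^^ i) ` K) \<subseteq> orbit_set f K" by (rule orbit_set_image)
  have m: "m \<ge> 1" using assms unfolding periodic_interval_def by blast
  have "m * i - i + i = m * i" using m by simp
  then have "(f ^^ (m * i - i)) ` (f ^^ i) ` K = K"
    using periodic_mult[OF assms, of "m * i"] by (metis dvd_triv_left funpow_image_add)
  then show "orbit_set f K \<subseteq> orbit_set f ((f ^^ i) ` K)"
    using orbit_set_image[of f "m * i - i" "(f ^^ i) ` K"] by simp
qed

text \<open>Since \<open>c\<close> returns to itself after \<open>p\<close> steps, all periods
  divide \<open>p\<close> and are finally constant. The limit interval contains \<open>c\<close> and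
  a preimage of the nonperiodic point \<open>x\<close>, so it is not degenerate; \<open>J\<close> is
  its image that contains \<open>x\<close>.\<close>

lemma periodic_limit:
  assumes A: "shrinks A c" and p: "p \<ge> 1" "(f ^^ p) c = c" and x: "x \<in> lim_orbit f A" "x \<notin> Per f"
  obtains J m where "periodic_interval f J m" "x \<in> J" "lim_orbit f A = orbit_set f J" "m dvd p"
proof -
  have c01: "c \<in> {0..1}" and cA: "c \<in> A n" for n using A unfolding shrinks_def by blast+
  have ret: "\<exists>p\<ge>1. (f ^^ p) ` A n \<inter> A n \<noteq> {}" for n
  proof -
    have "(f ^^ p) c \<in> (f ^^ p) ` A n" using cA by blast
    then have "c \<in> (f ^^ p) ` A n" using p(2) by simp
    then show ?thesis using p(1) cA by blast
  qed
  have cn: "c \<in> f ` closure (orbit_set f (A n))" for n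
  proof -
    have "c = f ((f ^^ (p - 1)) c)" using p by (cases p) auto
    moreover have "(f ^^ (p - 1)) c \<in> orbit_set f (A n)" unfolding orbit_set_def using cA by blast
    ultimately show ?thesis using closure_subset by blast
  qed
  obtain K m where K: "\<And>n. cyc (K n) (m n)" "\<And>n. A n \<subseteq> K n"
    "\<And>n. closure (orbit_set f (A n)) = orbit_set f (K n)" "\<And>n. K (Suc n) \<subseteq> K n"
    "\<And>n. m n dvd m (Suc n)" using cyc_sequence[OF A ret] by blast
  have dvd: "m n dvd p" for n
  proof -
    have "(f ^^ p) c \<in> (f ^^ p) ` K n" "c \<in> K n" using cA K(2) by blast+
    then have "(f ^^ p) ` K n \<inter> K n \<noteq> {}" using p(2) by auto
    then show ?thesis using cyc_dvd[OF K(1)] by blast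
  qed
  have le: "m n \<le> p" for n using dvd p(1) by (intro dvd_imp_le) auto
  have "m n \<le> m (Suc n)" for n
    using K(1)[of "Suc n"] by (intro dvd_imp_le[OF K(5)]) (auto simp: cyc_def)
  moreover have "\<not> filterlim m at_top sequentially"
  proof
    assume "filterlim m at_top sequentially"
    then obtain j where "m j \<ge> Suc p" unfolding filterlim_at_top eventually_sequentially by blast
    then show False using le[of j] by simp
  qed
  ultimately obtain N where N: "\<And>n. n \<ge> N \<Longrightarrow> m n = m N"
    using mono_nat_dichotomy by blast
  obtain L where L: "cyc L (m N)" "(f ^^ m N) ` L = L" "c \<in> L" "lim_orbit f A = orbit_set f L"
    using cyc_limit_eventually[OF A cn K(1-4) N] by blast
  obtain i where i: "i < m N" "x \<in> (f ^^ i) ` L" using x(1) L(4) cyc_orbit[OF L(1)] by auto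
  then obtain u where u: "u \<in> L" "x = (f ^^ i) u" by blast
  have "u \<noteq> c"
  proof
    assume "u = c"
    then have "(f ^^ p) x = x" using u(2) p(2) by (metis add.commute comp_apply funpow_add)
    moreover have "x \<in> {0..1}" using u(2) \<open>u = c\<close> c01 funpow_mem by blast
    ultimately show False using x(2) p(1) unfolding Per_def by blast
  qed
  then have per: "periodic_interval f L (m N)" using cyc_imp_periodic[OF L(1,2) u(1) L(3)] by blast
  show ?thesis
    using that[OF periodic_funpow_image[OF per] i(2)] orbit_set_periodic_image[OF per] L(4) dvd by simp
qed

text \<open>When the good side of \<open>c\<close> lies outside \<open>M\<close>, orbits near it shrink to \<open>M\<close>, so they can enter \<open>M\<close>
  only close to \<open>c\<close>; hence the inner side of \<open>c\<close> has a dense orbit as well.\<close>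

lemma inner_side_good:
  assumes J: "periodic_interval f {x..c} m" and M: "lim_orbit f (side_seq 1 c) = orbit_set f {x..c}"
    and p: "p \<ge> 1" "(f ^^ p) c = c"
    and out: "\<And>e. e > 0 \<Longrightarrow> \<not> {c..c + e} \<subseteq> orbit_set f {x..c}"
  shows "good f (orbit_set f {x..c}) c (- 1)"
proof -
  define M where "M = orbit_set f {x..c}"
  have Mc: "closed M" "M \<subseteq> {0..1}" "f ` M \<subseteq> M"
    unfolding M_def using orbit_periodic_closed[OF J] by auto
  have xc: "x < c" "{x..c} \<subseteq> {0..1}" using J unfolding periodic_interval_def by auto
  have c01: "c \<in> {0..1}" using xc by auto
  have JM: "{x..c} \<subseteq> M" unfolding M_def by (rule orbit_set_superset)
  note sh = side_seq_shrinks[of 1, OF _ c01, simplified]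
  have cpk: "(f ^^ (p * k)) c = c" for k by (induction k) (auto simp: funpow_add p(2))
  have main: "z \<in> closure (orbit_set f L)"
    if eta: "0 < \<eta>" "\<eta> \<le> c - x" "L = side (- 1) \<eta> c \<inter> M" and z: "z \<in> M - (\<lambda>j. (f ^^ j) c) ` {..<p}" for z \<eta> L
  proof -
    have "\<exists>N. \<forall>n\<ge>N. z \<notin> (f ^^ j) ` side_seq 1 c n" if "j < p" for j
      using shrinks_funpow_avoid[OF sh] z that by blast
    then obtain P where P: "\<And>j n. j < p \<Longrightarrow> n \<ge> P j \<Longrightarrow> z \<notin> (f ^^ j) ` side_seq 1 c n" by metis
    obtain Q where Q: "\<And>n. n \<ge> Q \<Longrightarrow> (f ^^ p) ` side_seq 1 c n \<subseteq> {c - \<eta><..<c + \<eta>}"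
      using shrinks_funpow[OF sh eta(1), of p] p(2) by auto
    define N where "N = Max (insert Q (P ` {..<p}))"
    have N: "N \<ge> Q" "\<And>j. j < p \<Longrightarrow> N \<ge> P j" unfolding N_def by auto
    define \<delta> where "\<delta> = 1 / real (Suc N)"
    have \<delta>: "\<delta> > 0" unfolding \<delta>_def by simp
    \<comment> \<open>Otherwise images of every one-sided neighbourhood, which contain the fixed
      point \<open>c\<close> of \<open>f ^^ p\<close>, would cover \<open>{c..c + \<delta>}\<close>
      and put it into \<open>M\<close>, against \<open>out\<close>.\<close>
    have "\<exists>n. \<forall>k. \<forall>w\<in>side_seq 1 c n. (f ^^ (p * k)) w < c + \<delta>"
    proof (rule ccontr)
      assume neg: "\<not> ?thesis"
      have "{c..c + \<delta>} \<subseteq> orbit_set f (side_seq 1 c n)" for n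
      proof -
        obtain k w where kw: "w \<in> side_seq 1 c n" "(f ^^ (p * k)) w \<ge> c + \<delta>"
          using neg by (meson not_less)
        have "connected (side_seq 1 c n)" "side_seq 1 c n \<subseteq> {0..1}" "c \<in> side_seq 1 c n"
          using sh cintD unfolding shrinks_def by blast+
        then have "{c..c + \<delta>} \<subseteq> (f ^^ (p * k)) ` side_seq 1 c n"
          using funpow_ivt[of "side_seq 1 c n" c w "p * k"] kw cpk by auto
        then show ?thesis unfolding orbit_set_def by blast
      qed
      then have "{c..c + \<delta>} \<subseteq> lim_orbit f (side_seq 1 c)"
        unfolding lim_orbit_def using closure_subset by blast
      then show False using out[OF \<delta>] M by simp
    qed
    then obtain n where n: "\<And>k w. w \<in> side_seq 1 c n \<Longrightarrow> (f ^^ (p * k)) w < c + \<delta>" by blast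
    \<comment> \<open>This absorbs the orbit points reached while the orbit under
      \<open>f ^^ p\<close> has not yet passed to the left of \<open>c\<close>; by the choice of
      \<open>N\<close> it does not contain \<open>z\<close>.\<close>
    define R where "R = (\<Union>j<p. (f ^^ j) ` side_seq 1 c N)"
    have "closed ((f ^^ j) ` side_seq 1 c N)" for j
    proof -
      have "cint (side_seq 1 c N)" "side_seq 1 c N \<subseteq> {0..1}" using sh unfolding shrinks_def by auto
      then show ?thesis using cintD[OF cint_funpow[of "side_seq 1 c N" j]] by simp
    qed
    then have clR: "closed R" unfolding R_def by (intro closed_UN) auto
    have "orbit_set f (side_seq 1 c n) \<subseteq> R \<union> orbit_set f L"
    proof
      fix t assume "t \<in> orbit_set f (side_seq 1 c n)"
      then obtain l w where w: "w \<in> side_seq 1 c n" "t = (f ^^ l) w" unfolding orbit_set_def by blast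
      define u where "u k = (f ^^ (p * k)) w" for k
      have u01: "u k \<in> {0..1}" for k
        unfolding u_def using w(1) funpow_mem unfolding side_seq_def by blast
      have uN: "u k \<in> side_seq 1 c N" if "c \<le> u k" for k
        using that n[OF w(1), of k] u01[of k] unfolding u_def[symmetric] side_seq_def side_def \<delta>_def by auto
      have u_Suc: "u (Suc k) = (f ^^ p) (u k)" for k
        unfolding u_def by (simp add: funpow_add)
      have t: "t = (f ^^ (l mod p)) (u (l div p))"
        using w(2) unfolding u_def by (metis comp_apply funpow_add mod_mult_div_eq)
      show "t \<in> R \<union> orbit_set f L"
      proof (cases "\<exists>k\<le>l div p. u k < c")
        case False
        then have "t \<in> (f ^^ (l mod p)) ` side_seq 1 c N" using uN[of "l div p"] t by auto
        moreover have "l mod p < p" using p(1) by simp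
        ultimately show ?thesis unfolding R_def by blast
      next
        case True
        \<comment> \<open>One step before the first crossing the point still lies in
          \<open>side_seq 1 c N\<close>, so the crossing lands within \<open>\<eta>\<close> of
          \<open>c\<close>, that is, in \<open>L\<close>.\<close>
        define k where "k = (LEAST k. u k < c)"
        have k: "u k < c" "k \<le> l div p" unfolding k_def using True
          by (metis LeastI, metis Least_le order_trans)
        have "u 0 \<ge> c" using w(1) unfolding u_def side_seq_def side_def by simp
        then have "k \<noteq> 0" using k(1) by (metis not_le)
        then obtain k' where k': "k = Suc k'" by (cases k) auto
        have "c \<le> u k'"
          using not_less_Least[of k' "\<lambda>k. u k < c"] k' unfolding k_def[symmetric] by simp
        then have "u k \<in> {c - \<eta><..<c + \<eta>}" using Q[OF N(1)] uN u_Suc k' by blast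
        then have "u k \<in> L" using k(1) eta JM unfolding side_def by auto
        moreover have "t = (f ^^ (l - p * k)) (u k)"
        proof -
          have "p * k \<le> l"
            using k(2) by (metis div_times_less_eq_dividend le_trans mult.commute mult_le_mono1)
          then have "l = (l - p * k) + p * k" by simp
          then show ?thesis using w(2) unfolding u_def by (metis comp_apply funpow_add)
        qed
        ultimately show ?thesis unfolding orbit_set_def by blast
      qed
    qed
    then have "closure (orbit_set f (side_seq 1 c n)) \<subseteq> R \<union> closure (orbit_set f L)"
      using closure_mono closure_Un closure_closed[OF clR] by metis
    moreover have "z \<in> closure (orbit_set f (side_seq 1 c n))"
      using z M unfolding M_def lim_orbit_def by blast
    moreover have "z \<notin> R" unfolding R_def using P N(2) by blast
    ultimately show ?thesis by blast
  qed
  have "M \<subseteq> closure (orbit_set f (side (- 1) e c \<inter> M))" if "e > 0" for e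
  proof -
    define \<eta> where "\<eta> = min e (c - x)"
    have \<eta>: "0 < \<eta>" "\<eta> \<le> c - x" "\<eta> \<le> e" unfolding \<eta>_def using that xc by auto
    have "closure (M - (\<lambda>j. (f ^^ j) c) ` {..<p}) \<subseteq> closure (orbit_set f (side (- 1) \<eta> c \<inter> M))"
      using main[OF \<eta>(1,2) refl] by (intro closure_minimal) auto
    moreover have "M \<subseteq> closure (M - (\<lambda>j. (f ^^ j) c) ` {..<p})"
      using perfect_orbit[OF J] unfolding M_def perfect_def by auto
    moreover have "closure (orbit_set f (side (- 1) \<eta> c \<inter> M)) \<subseteq> closure (orbit_set f (side (- 1) e c \<inter> M))"
      by (intro closure_mono orbit_set_mono side_Int_mono \<eta>(3))
    ultimately show ?thesis by blast
  qed
  moreover have "side (- 1) (c - x) c \<subseteq> M" using JM by (auto simp: side_def)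
  ultimately show ?thesis unfolding good_def M_def[symmetric] using xc(1)
    by (metis diff_gt_0_iff_gt)
qed

end

context right_moving
begin

text \<open>The image of \<open>nbhd_seq x n\<close> under \<open>f ^^ p\<close> surrounds \<open>c\<close>; since \<open>x\<close> is nonwandering, the orbit of one of
  the two sides of \<open>c\<close> that it covers accumulates at \<open>x\<close>.\<close>

lemma returning_side:
  assumes x: "x \<in> NW" and p: "p \<ge> 1" "(f ^^ p) x = c" "(f ^^ p) c = c"
  obtains s where "s = 1 \<or> s = - 1" "\<And>n. \<exists>w\<in>nbhd_seq x n. s * ((f ^^ p) w - c) > 0"
    "x \<in> lim_orbit f (side_seq s c)"
proof (rule ccontr)
  assume neg: "\<not> thesis"
  note intro = that
  have x': "x \<in> nonwandering f" "x \<in> {a<..<b}" "x \<notin> Per f" "x \<in> {0..1}"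
    using x no_Per U01 by auto
  have c01: "c \<in> {0..1}" using p(2) x'(4) funpow_mem by blast
  \<comment> \<open>If side \<open>s\<close> fails, then either small neighbourhoods have no image
    point strictly on that side, and \<open>{}\<close> serves as \<open>A\<close>, or the orbit of a
    whole one-sided neighbourhood of \<open>c\<close> stays away from \<open>x\<close>.\<close>
  have key: "\<exists>N A. x \<notin> closure (orbit_set f A) \<and>
      (\<forall>n\<ge>N. {y \<in> (f ^^ p) ` nbhd_seq x n. s * (y - c) > 0} \<subseteq> A)" if s: "s = 1 \<or> s = - 1" for s
  proof (cases "x \<in> lim_orbit f (side_seq s c)")
    case True
    then have "\<not> (\<forall>n. \<exists>w\<in>nbhd_seq x n. s * ((f ^^ p) w - c) > 0)"
      using neg intro s by blast
    then obtain n where n: "\<And>w. w \<in> nbhd_seq x n \<Longrightarrow> \<not> s * ((f ^^ p) w - c) > 0"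
      by blast
    have "{y \<in> (f ^^ p) ` nbhd_seq x k. s * (y - c) > 0} \<subseteq> {}" if "k \<ge> n" for k
      using n shrinks_antimono[OF nbhd_seq_shrinks[OF x'(4)] that] by blast
    then show ?thesis by (intro exI[of _ n] exI[of _ "{}"]) (auto simp: orbit_set_def)
  next
    case False
    then obtain M where M: "x \<notin> closure (orbit_set f (side_seq s c M))"
      unfolding lim_orbit_def by blast
    have "1 / real (Suc M) > 0" by simp
    then obtain N where N: "\<And>n. n \<ge> N \<Longrightarrow> (f ^^ p) ` nbhd_seq x n \<subseteq> {c - 1 / real (Suc M)<..<c + 1 / real (Suc M)}"
      using shrinks_funpow[OF nbhd_seq_shrinks[OF x'(4)], of _ p] p(2) by metis
    have "{y \<in> (f ^^ p) ` nbhd_seq x n. s * (y - c) > 0} \<subseteq> side_seq s c M" if "n \<ge> N" for n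
    proof
      fix y assume y: "y \<in> {y \<in> (f ^^ p) ` nbhd_seq x n. s * (y - c) > 0}"
      then have "y \<in> {c - 1 / real (Suc M)<..<c + 1 / real (Suc M)}" using N[OF that] by blast
      moreover have "y \<in> {0..1}" using y funpow_mem unfolding nbhd_seq_def by blast
      ultimately show "y \<in> side_seq s c M" using y s unfolding side_seq_def side_def by auto
    qed
    then show ?thesis using M by blast
  qed
  obtain N1 A1 where 1: "x \<notin> closure (orbit_set f A1)"
    "\<And>n. n \<ge> N1 \<Longrightarrow> {y \<in> (f ^^ p) ` nbhd_seq x n. 1 * (y - c) > 0} \<subseteq> A1"
      using key[of 1] by blast
  obtain N2 A2 where 2: "x \<notin> closure (orbit_set f A2)"
    "\<And>n. n \<ge> N2 \<Longrightarrow> {y \<in> (f ^^ p) ` nbhd_seq x n. - 1 * (y - c) > 0} \<subseteq> A2"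
      using key[of "- 1"] by blast
  define n where "n = max N1 N2"
  \<comment> \<open>If both sides fail, only \<open>c\<close> itself can lead back to
    \<open>x\<close>. Its orbit is finite, so \<open>x\<close> would be one of its points and hence
    periodic.\<close>
  have sub: "(f ^^ p) ` nbhd_seq x n \<subseteq> {c} \<union> A1 \<union> A2"
  proof
    fix y assume y: "y \<in> (f ^^ p) ` nbhd_seq x n"
    consider "y < c" | "y = c" | "c < y" by (rule linorder_cases[of y c])
    then show "y \<in> {c} \<union> A1 \<union> A2"
      using y 1(2)[of n] 2(2)[of n] unfolding n_def by cases auto
  qed
  have "x \<in> (f ^^ p) ` closure (orbit_set f (nbhd_seq x n))"
    using near_lim_funpow[OF x'(1), of p] in_near_lim[OF x'(4)] unfolding lim_orbit_def by blast
  also have "\<dots> = closure ((f ^^ p) ` orbit_set f (nbhd_seq x n))"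
    by (intro image_closure[symmetric] orbit_set_sub) (auto simp: nbhd_seq_def)
  also have "(f ^^ p) ` orbit_set f (nbhd_seq x n) = orbit_set f ((f ^^ p) ` nbhd_seq x n)"
    unfolding orbit_set_def image_UN by (simp only: funpow_image_add[symmetric] add.commute)
  finally have "x \<in> closure (orbit_set f ({c} \<union> A1 \<union> A2))"
    using closure_mono[OF orbit_set_mono[OF sub]] by blast
  then have "x \<in> closure (orbit_set f {c})"
    using 1(1) 2(1) by (simp only: orbit_set_Un closure_Un Un_iff) blast
  moreover have "orbit_set f {c} \<subseteq> (\<lambda>i. (f ^^ i) c) ` {..<p}"
  proof
    fix y assume "y \<in> orbit_set f {c}"
    then obtain i where i: "y = (f ^^ i) c" unfolding orbit_set_def by auto
    have "(f ^^ (p * k)) c = c" for k by (induction k) (auto simp: funpow_add p(3))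
    then have "y = (f ^^ (i mod p)) c" using i by (metis comp_apply funpow_add mod_mult_div_eq)
    then show "y \<in> (\<lambda>i. (f ^^ i) c) ` {..<p}" using p(1) by simp
  qed
  moreover have "closed ((\<lambda>i. (f ^^ i) c) ` {..<p})" by (intro finite_imp_closed) auto
  ultimately obtain i where "x = (f ^^ i) c" by (meson closure_minimal imageE subsetD)
  then have "(f ^^ p) x = x" using p(3) by (metis add.commute comp_apply funpow_add)
  then have "x \<in> Per f" using p(1) x'(4) unfolding Per_def by blast
  then show False using x'(3) by blast
qed

text \<open>The periodic interval left by two-sided neighbourhoods of \<open>x\<close> may have a finite basic set, for example
  when \<open>c\<close> separates two invariant halves of it; so the interval is built from one side of \<open>c\<close>.\<close>

lemma finite_orbit_basic:
  assumes x: "x \<in> NW" and fin: "finite (orbit f x)"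
  shows "\<exists>y k. periodic_interval f {x..y} k \<and> orbit_set f {x..y} \<subseteq> near_lim f x \<and> in_Omega_basic f {x..y} x"
proof -
  have x': "x \<in> nonwandering f" "x \<in> {a<..<b}" "x \<notin> Per f" "x \<in> {0..1}"
    using x no_Per U01 by auto
  obtain p where p: "p \<ge> 1" "(f ^^ p) ((f ^^ p) x) = (f ^^ p) x" using finite_orbit_eventual[OF fin] .
  define c where "c = (f ^^ p) x"
  have c: "(f ^^ p) x = c" "(f ^^ p) c = c" using p unfolding c_def by auto
  have c01: "c \<in> {0..1}" using c(1) x'(4) funpow_mem by blast
  obtain s where s: "s = 1 \<or> s = - 1" and hit: "\<And>n. \<exists>w\<in>nbhd_seq x n. s * ((f ^^ p) w - c) > 0"
    and xs: "x \<in> lim_orbit f (side_seq s c)" by (rule returning_side[OF x p(1) c]) (rule that)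
  note sh = side_seq_shrinks[OF s c01]
  obtain J m where J: "periodic_interval f J m" "x \<in> J" and Jlim: "lim_orbit f (side_seq s c) = orbit_set f J"
    and mp: "m dvd p" using periodic_limit[OF sh p(1) c(2) xs x'(3)] .
  define M where "M = orbit_set f J"
  have M: "closed M" "M \<subseteq> {0..1}" "f ` M \<subseteq> M"
    unfolding M_def using orbit_periodic_closed[OF J(1)] by auto
  have sub: "M \<subseteq> near_lim f x"
  proof -
    have "\<exists>N. side_seq s c N \<subseteq> (f ^^ p) ` nbhd_seq x n" for n
    proof -
      obtain w where w: "w \<in> nbhd_seq x n" "s * ((f ^^ p) w - c) > 0" using hit by blast
      obtain N where N: "1 / real (Suc N) < s * ((f ^^ p) w - c)" using inverse_Suc_small[OF w(2)] by blast
      have bn: "connected (nbhd_seq x n)" "nbhd_seq x n \<subseteq> {0..1}" "x \<in> nbhd_seq x n"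
        using nbhd_seq_shrinks[OF x'(4)] cintD unfolding shrinks_def by blast+
      have "side_seq s c N \<subseteq> (f ^^ p) ` nbhd_seq x n"
      proof
        fix y assume "y \<in> side_seq s c N"
        then have y: "0 \<le> s * (y - c)" "s * (y - c) \<le> s * ((f ^^ p) w - c)"
          using N unfolding side_seq_def side_def by auto
        from s show "y \<in> (f ^^ p) ` nbhd_seq x n"
        proof
          assume "s = 1" then show ?thesis using y c(1) funpow_ivt[OF bn w(1), of p y] by auto
        next
          assume "s = - 1" then show ?thesis using y c(1) funpow_ivt[OF bn(1,2) w(1) bn(3), of p y] by auto
        qed
      qed
      then show ?thesis by blast
    qed
    then have "\<exists>N. closure (orbit_set f (side_seq s c N)) \<subseteq> closure (orbit_set f (nbhd_seq x n))" for n
      by (meson closure_mono orbit_set_image orbit_set_mono subset_trans)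
    then show ?thesis unfolding M_def Jlim[symmetric] lim_orbit_def by blast
  qed
  obtain y where y: "J = {x..y}" "b \<le> y"
    using periodic_in_near_lim[OF x'(2) J] sub orbit_set_superset[of J f] unfolding M_def by blast
  have "(f ^^ p) ` J = J" using periodic_mult[OF J(1) mp] .
  then have cJ: "c \<in> {x..y}" using c(1) J(2) y(1) by blast
  have cPer: "c \<in> Per f" using c(2) c01 p(1) unfolding Per_def by blast
  have "c \<noteq> x" using cPer x'(3) by blast
  then have xc: "x < c" using cJ by auto
  have JM: "{x..y} \<subseteq> M" unfolding M_def y(1) by (rule orbit_set_superset)
  \<comment> \<open>Density is known on side \<open>s\<close>, but \<open>good\<close> also requires
    that side to lie in \<open>M\<close>. If it does not, \<open>c\<close> must be the right end
    \<open>y\<close>, and the inner side takes over.\<close>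
  have "\<exists>t. good f M c t"
  proof (cases "\<exists>e>0. side s e c \<subseteq> M")
    case True
    then obtain e0 where e0: "e0 > 0" "side s e0 c \<subseteq> M" by blast
    have "M \<subseteq> closure (orbit_set f (side s e c \<inter> M))" if e: "e > 0" for e
    proof -
      have "min e e0 > 0" using e e0(1) by simp
      then obtain N where "1 / real (Suc N) < min e e0" using inverse_Suc_small by blast
      then have "side_seq s c N \<subseteq> side s e c \<inter> M"
        using e0(2) side_mono[of "1 / real (Suc N)" e s c] side_mono[of "1 / real (Suc N)" e0 s c]
        unfolding side_seq_def by auto
      then have "closure (orbit_set f (side_seq s c N)) \<subseteq> closure (orbit_set f (side s e c \<inter> M))"
        by (intro closure_mono orbit_set_mono)
      then show ?thesis using Jlim unfolding M_def lim_orbit_def by blast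
    qed
    then have "good f M c s" unfolding good_def using s True by blast
    then show ?thesis by blast
  next
    case False
    have "s = 1"
    proof (rule ccontr)
      assume "s \<noteq> 1"
      then have "side s (c - x) c \<subseteq> M" using s JM cJ by (auto simp: side_def)
      then show False using False xc by (meson diff_gt_0_iff_gt)
    qed
    have "c = y"
    proof (rule ccontr)
      assume "c \<noteq> y"
      then have "c < y" using cJ by auto
      moreover have "side s (y - c) c \<subseteq> M" using \<open>s = 1\<close> JM cJ by (auto simp: side_def)
      ultimately show False using False by (meson diff_gt_0_iff_gt)
    qed
    have "good f (orbit_set f {x..c}) c (- 1)"
    proof (rule inner_side_good[OF _ _ p(1) c(2)])
      show "periodic_interval f {x..c} m" using J(1) y(1) \<open>c = y\<close> by simp
      show "lim_orbit f (side_seq 1 c) = orbit_set f {x..c}"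
        using Jlim \<open>s = 1\<close> y(1) \<open>c = y\<close> by simp
      fix e :: real assume "e > 0"
      then show "\<not> {c..c + e} \<subseteq> orbit_set f {x..c}"
        using False \<open>s = 1\<close> y(1) \<open>c = y\<close> unfolding M_def by (auto simp: side_eq)
    qed
    then show ?thesis unfolding M_def y(1) \<open>c = y\<close> by blast
  qed
  then obtain t where t: "good f M c t" by blast
  have "c \<in> basic_set f M" using good_basic[OF M(1,3) t] .
  then have basic: "(f ^^ p) x \<in> basic_set f (orbit_set f {x..y})" using c(1) y(1) unfolding M_def by simp
  have "{x..<b} \<subseteq> {a<..<b}" using x'(2) by auto
  then have "{x..<b} \<inter> Per f = {}" using no_Per by blast
  then have "infinite (basic_set f (orbit_set f {x..y}))"
    using basic_set_infinite[of x y m b c p t] J(1) y(1) x'(2) cJ c p(1) mp t unfolding M_def by auto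
  then have "in_Omega_basic f {x..y} x"
    using in_Omega_basicI[OF x'(1) J(1)[unfolded y(1)] _ basic] sub y(1) unfolding M_def by simp
  then show ?thesis using J(1) sub y(1) unfolding M_def by blast
qed

text \<open>In the first alternative \<open>x\<close> is the last nonwandering point of
  \<open>{a<..<b}\<close>, because all late intervals contain \<open>{x<..<b}\<close> while their
  periods tend to infinity. A point followed by another one therefore falls under the
  second.\<close>

theorem nonwandering_dichotomy:
  assumes x: "x \<in> NW"
  shows "(\<exists>I. generating f I \<and> (\<forall>n. x \<in> I n) \<and> nonwandering f \<inter> {x<..<b} = {}) \<or>
    (\<exists>y k. periodic_interval f {x..y} k \<and> orbit_set f {x..y} \<subseteq> near_lim f x \<and> in_Omega_basic f {x..y} x)"
proof -
  have x': "x \<in> nonwandering f" "x \<in> {a<..<b}" "x \<notin> Per f" "x \<in> {0..1}"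
    using x no_Per U01 by auto
  obtain I k where I: "\<And>n. periodic_interval f (I n) (k n)" "\<And>n. x \<in> I n"
    "\<And>n. I n \<subseteq> closure (orbit_set f (nbhd_seq x n))" "\<And>n. I (Suc n) \<subseteq> I n"
    and alt: "filterlim k at_top sequentially \<or> (\<exists>K m. periodic_interval f K m \<and> x \<in> K \<and> near_lim f x = orbit_set f K)"
    by (rule nonwandering_intervals[OF x'(1,3)]) (rule that)
  from alt show ?thesis
  proof
    assume k: "filterlim k at_top sequentially"
    obtain e where e: "e > 0" "{x - e..x + e} \<subseteq> {a<..<b}" using small_nbhd[OF x'(2), of 1] by auto
    obtain N where N: "\<And>n. n \<ge> N \<Longrightarrow> nbhd_seq x n \<subseteq> {x - e<..<x + e}"
      using nbhd_seq_small[OF e(1)] by blast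
    have sub: "{x<..<b} \<subseteq> I (n + N)" for n
    proof -
      have "nbhd_seq x (n + N) \<subseteq> {x - e<..<x + e}" by (rule N) simp
      also have "{x - e<..<x + e} \<subseteq> {x - e..x + e}" by auto
      finally have "nbhd_seq x (n + N) \<subseteq> {x - e..x + e}" .
      then obtain z y where zy: "I (n + N) = {z..y}" "z \<le> x" "b \<le> y"
        using periodic_in_nbhd_seq[OF x'(2) e(2) _ e(1) I(1,2,3)] by metis
      have "{x<..<b} \<subseteq> {z..y}" using zy(2,3) by auto
      then show ?thesis unfolding zy(1) .
    qed
    have "filterlim (\<lambda>n. k (n + N)) at_top sequentially"
      using filterlim_compose[OF k filterlim_add_const_nat_at_top] .
    then have "nonwandering f \<inter> {x<..<b} = {}"
      using wandering_interval[of "\<lambda>n. I (n + N)" "\<lambda>n. k (n + N)" x b] I(1) sub by blast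
    moreover have "generating f I" unfolding generating_def using I(1,4) k by blast
    ultimately show ?thesis using I(2) by blast
  next
    assume "\<exists>K m. periodic_interval f K m \<and> x \<in> K \<and> near_lim f x = orbit_set f K"
    then obtain K m where K: "periodic_interval f K m" "x \<in> K" "near_lim f x = orbit_set f K" by blast
    show ?thesis
    proof (cases "finite (orbit f x)")
      case True then show ?thesis using finite_orbit_basic[OF x] by blast
    next
      case False
      then obtain y where "K = {x..y}" "in_Omega_basic f {x..y} x" using infinite_orbit_basic[OF x K] by blast
      then show ?thesis using K by blast
    qed
  qed
qed

end

section \<open>Nested periodic intervals\<close>

lemma omega_pointD:
  assumes "y \<in> omega_point f z" "e > 0"
  obtains k where "k \<ge> n" "\<bar>(f ^^ k) z - y\<bar> < e"
proof -
  obtain r :: "nat \<Rightarrow> nat" where r: "strict_mono r" "(\<lambda>n. (f ^^ r n) z) \<longlonglongrightarrow> y"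
    using assms(1) unfolding omega_point_def by blast
  obtain N where N: "\<And>k. k \<ge> N \<Longrightarrow> dist ((f ^^ r k) z) y < e"
    using r(2) assms(2) unfolding lim_sequentially by blast
  have "r (max n N) \<ge> n" using seq_suble[OF r(1), of "max n N"] by simp
  moreover have "\<bar>(f ^^ r (max n N)) z - y\<bar> < e" using N[of "max n N"] by (simp add: dist_real_def)
  ultimately show ?thesis using that by blast
qed

lemma finite_orbitI:
  assumes "(f ^^ p) ((f ^^ p) x) = (f ^^ p) x" "p \<ge> 1" shows "finite (orbit f x)"
proof -
  have "(f ^^ n) x \<in> (\<lambda>i. (f ^^ i) x) ` {..<2 * p}" for n
  proof (induction n rule: less_induct)
    case (less n)
    show ?case
    proof (cases "n < 2 * p")
      case False
      then have "n = (n - 2 * p) + (p + p)" by simp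
      then have "(f ^^ n) x = (f ^^ (n - 2 * p)) ((f ^^ p) ((f ^^ p) x))" by (metis comp_apply funpow_add)
      also have "\<dots> = (f ^^ (n - 2 * p + p)) x" using assms(1) by (simp add: funpow_add)
      finally show ?thesis using less[of "n - 2 * p + p"] False assms(2) by simp
    qed blast
  qed
  then have "orbit f x \<subseteq> (\<lambda>i. (f ^^ i) x) ` {..<2 * p}" unfolding orbit_def by blast
  then show ?thesis using finite_subset by blast
qed

lemma infinite_three:
  fixes X :: "real set"
  assumes "infinite X"
  obtains u v w where "u \<in> X" "v \<in> X" "w \<in> X" "u < v" "v < w"
proof -
  obtain T where T: "T \<subseteq> X" "finite T" "card T = 3"
    using infinite_arbitrarily_large[OF assms, of 3] by blast
  define l where "l = sorted_list_of_set T"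
  have l: "sorted_wrt (<) l" "set l = T" "length l = 3"
    unfolding l_def using T by (auto simp: strict_sorted_list_of_set)
  then have "l ! 0 < l ! 1" "l ! 1 < l ! 2" by (auto simp: sorted_wrt_iff_nth_less)
  moreover have "l ! 0 \<in> X" "l ! 1 \<in> X" "l ! 2 \<in> X"
    using l T(1) by (auto intro!: subsetD[OF T(1)] nth_mem)
  ultimately show ?thesis using that by blast
qed

context interval_map
begin

lemma interval_map_funpow: "interval_map (f ^^ q)"
  by unfold_locales (use funpow_cont funpow_self in auto)

lemma omega_point_in:
  assumes "z \<in> {0..1}" "y \<in> omega_point f z" shows "y \<in> {0..1}"
proof -
  obtain r :: "nat \<Rightarrow> nat" where r: "(\<lambda>n. (f ^^ r n) z) \<longlonglongrightarrow> y"
    using assms(2) unfolding omega_point_def by blast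
  have "closed {0..1::real}" by simp
  moreover have "\<And>n. (f ^^ r n) z \<in> {0..1}" using funpow_mem[OF assms(1)] by blast
  ultimately show ?thesis using closed_sequentially[of "{0..1}" "\<lambda>n. (f ^^ r n) z"] r by blast
qed

text \<open>The predecessors of the iterates converging to \<open>y\<close> have a convergent
  subsequence, and its limit is mapped to \<open>y\<close>.\<close>

lemma omega_preimage:
  assumes z: "z \<in> {0..1}" and y: "y \<in> omega_point f z"
  shows "\<exists>u\<in>omega_point f z. f u = y"
proof -
  obtain r :: "nat \<Rightarrow> nat" where r: "strict_mono r" "(\<lambda>n. (f ^^ r n) z) \<longlonglongrightarrow> y"
    using y unfolding omega_point_def by blast
  define g where "g n = (f ^^ (r (Suc n) - 1)) z" for n
  have rS: "r (Suc n) \<ge> 1" for n using seq_suble[OF r(1), of "Suc n"] by simp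
  have g01: "\<And>n. g n \<in> {0..1}" unfolding g_def using funpow_mem[OF z] by blast
  have "seq_compact {0..1::real}" using compact_Icc compact_eq_seq_compact_metric by blast
  then obtain u t where u: "u \<in> {0..1}" "strict_mono t" "(g \<circ> t) \<longlonglongrightarrow> u"
    using g01 unfolding seq_compact_def by metis
  have fg: "f (g n) = (f ^^ r (Suc n)) z" for n
    unfolding g_def using rS[of n] by (cases "r (Suc n)") auto
  have "strict_mono (\<lambda>n. r (Suc (t n)) - 1)"
  proof (rule strict_monoI)
    fix i j :: nat assume "i < j"
    then have "t i < t j" using u(2) by (simp add: strict_mono_def)
    then have "r (Suc (t i)) < r (Suc (t j))" using r(1) by (simp add: strict_mono_def)
    then show "r (Suc (t i)) - 1 < r (Suc (t j)) - 1" using rS[of "t i"] by linarith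
  qed
  then have "u \<in> omega_point f z"
    using u(3) unfolding omega_point_def g_def comp_def by blast
  moreover have "f u = y"
  proof -
    have "(\<lambda>n. f ((g \<circ> t) n)) \<longlonglongrightarrow> f u"
      using continuous_on_tendsto_compose[OF cont u(3,1)] g01 by (simp add: comp_def)
    moreover have "(\<lambda>n. f ((g \<circ> t) n)) = (\<lambda>n. (f ^^ r n) z) \<circ> (\<lambda>n. Suc (t n))" using fg by auto
    moreover have "((\<lambda>n. (f ^^ r n) z) \<circ> (\<lambda>n. Suc (t n))) \<longlonglongrightarrow> y"
      using u(2) by (intro LIMSEQ_subseq_LIMSEQ[OF r(2)]) (auto simp: strict_mono_def)
    ultimately show ?thesis using LIMSEQ_unique by metis
  qed
  ultimately show ?thesis by blast
qed

lemma omega_nonwandering: "omega_map f \<subseteq> nonwandering f"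
proof
  fix y assume "y \<in> omega_map f"
  then obtain z where z: "z \<in> {0..1}" "y \<in> omega_point f z" unfolding omega_map_def by blast
  have "\<exists>n\<ge>1. (f ^^ n) ` V \<inter> V \<noteq> {}" if V: "nbhd_in {0..1} y V" for V
  proof -
    obtain T where T: "openin (top_of_set {0..1}) T" "y \<in> T" "T \<subseteq> V"
      using V unfolding nbhd_in_def by blast
    obtain e where e: "e > 0" "ball y e \<inter> {0..1} \<subseteq> T"
      using T(1,2) by (meson openin_contains_ball)
    obtain k where k: "\<bar>(f ^^ k) z - y\<bar> < e" using omega_pointD[OF z(2) e(1), of 0] by blast
    obtain l where l: "l \<ge> Suc k" "\<bar>(f ^^ l) z - y\<bar> < e"
      using omega_pointD[OF z(2) e(1), of "Suc k"] by blast
    have in_V: "(f ^^ j) z \<in> V" if "\<bar>(f ^^ j) z - y\<bar> < e" for j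
      using that e(2) T(3) funpow_mem[OF z(1), of j] by (auto simp: dist_real_def abs_minus_commute)
    have "l = (l - k) + k" using l(1) by simp
    then have "(f ^^ l) z = (f ^^ (l - k)) ((f ^^ k) z)" by (metis comp_apply funpow_add)
    then have "(f ^^ l) z \<in> (f ^^ (l - k)) ` V" using in_V[OF k] by blast
    then have "(f ^^ l) z \<in> (f ^^ (l - k)) ` V \<inter> V" using in_V[OF l(2)] by blast
    moreover have "l - k \<ge> 1" using l(1) by simp
    ultimately show ?thesis by blast
  qed
  then show "y \<in> nonwandering f" unfolding nonwandering_def using omega_point_in[OF z] by blast
qed

end

text \<open>The inner interval is only required to start strictly between \<open>x\<close> and
  \<open>b\<close>. Thus the locale applies to intervals from \<open>periodic_near\<close>, which
  may begin to the left of the next nonwandering point.\<close>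

locale nested_pair = right_moving +
  fixes x y :: real and m :: nat and z w :: real and q :: nat
  assumes x: "x \<in> NW" and J: "periodic_interval f {x..y} m"
    and xz: "x < z" "z < b" and J': "periodic_interval f {z..w} q" and sub: "{z..w} \<subseteq> {x..y}"
begin

text \<open>The closure of what \<open>{x..w}\<close> sweeps out under the return map of the inner
  interval; it will be \<open>{x..s}\<close>. Its proper images form the forward invariant set
  \<open>F\<close>, a trap that will turn out to stay away from \<open>x\<close>.\<close>

definition N :: "real set" where "N = closure (orbit_set (f ^^ q) {x..w})"
definition s :: real where "s = Sup N"
definition F :: "real set" where "F = (\<Union>j\<in>{1..q}. (f ^^ j) ` N)"

lemma x_facts: "x \<in> nonwandering f" "x \<in> {a<..<b}" "x \<notin> Per f" "x \<in> {0..1}"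
  using x no_Per U01 by auto

lemma order_facts: "a < x" "x < z" "z < b" "b \<le> w" "w \<le> y" "q \<ge> 1" "m \<ge> 1" "{x..y} \<subseteq> {0..1}"
proof -
  show "a < x" "x < z" "z < b" using x xz by auto
  show "b \<le> w" using periodic_reaches_b[OF J'] x xz by auto
  have "z < w" "q \<ge> 1" using J' unfolding periodic_interval_def by auto
  then show "w \<le> y" "q \<ge> 1" using sub by auto
  show "m \<ge> 1" "{x..y} \<subseteq> {0..1}" using J unfolding periodic_interval_def by auto
qed

lemma q_image: "(f ^^ q) ` {z..w} = {z..w}"
  using J' unfolding periodic_interval_def by blast

lemma m_dvd_q: "m dvd q"
proof (rule cyc_dvd[OF periodic_imp_cyc[OF J]])
  have "{z..w} \<subseteq> (f ^^ q) ` {x..y}" using q_image sub by blast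
  moreover have "z \<in> {z..w}" using order_facts by auto
  ultimately show "(f ^^ q) ` {x..y} \<inter> {x..y} \<noteq> {}" using sub by blast
qed

lemma q_image_J: "(f ^^ q) ` {x..y} = {x..y}"
  using periodic_mult[OF J m_dvd_q] .

lemma funpow_q_mult: "((f ^^ q) ^^ k) = f ^^ (q * k)"
  by (simp add: funpow_mult)

lemma xw_sub: "{x..w} \<subseteq> {x..y}" "{x..w} \<subseteq> {0..1}"
  using order_facts by auto

lemma N_split: "N = {x..w} \<union> (f ^^ q) ` N"
  unfolding N_def using interval_map.closure_orbit_split[OF interval_map_funpow xw_sub(2)] by simp

lemma qN: "(f ^^ q) ` N \<subseteq> N"
  using N_split by blast

lemma N_sub: "N \<subseteq> {x..y}" "{x..w} \<subseteq> N" "N \<subseteq> {0..1}"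
proof -
  have "orbit_set (f ^^ q) {x..w} \<subseteq> {x..y}"
    using q_image_J xw_sub by (intro orbit_set_least) auto
  then show 1: "N \<subseteq> {x..y}" unfolding N_def by (intro closure_minimal) auto
  show "{x..w} \<subseteq> N" using N_split by blast
  show "N \<subseteq> {0..1}" using 1 order_facts by blast
qed

text \<open>All images share the point \<open>z\<close>, because \<open>{z..w}\<close> is mapped
  onto itself.\<close>

lemma orbit_connected: "connected (orbit_set (f ^^ q) {x..w})"
  unfolding orbit_set_def
proof (rule connected_Union)
  show "connected t" if "t \<in> range (\<lambda>i. ((f ^^ q) ^^ i) ` {x..w})" for t
  proof -
    from that obtain i where "t = (f ^^ (q * i)) ` {x..w}" unfolding funpow_q_mult by blast
    then show ?thesis using connected_continuous_image[OF funpow_cont_sub[OF xw_sub(2)]] by simp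
  qed
  have "z \<in> ((f ^^ q) ^^ i) ` {x..w}" for i
  proof -
    have "((f ^^ q) ^^ i) ` {z..w} = {z..w}"
      unfolding funpow_q_mult using periodic_mult[OF J'] by simp
    moreover have "z \<in> {z..w}" "{z..w} \<subseteq> {x..w}" using order_facts by auto
    ultimately show ?thesis by blast
  qed
  then show "\<Inter> (range (\<lambda>i. ((f ^^ q) ^^ i) ` {x..w})) \<noteq> {}" by blast
qed

lemma N_eq: "N = {x..s}" and s_bounds: "w \<le> s" "s \<le> y"
proof -
  have "compact N" using N_sub(3) unfolding N_def
    by (meson bounded_subset bounded_closed_interval compact_eq_bounded_closed closed_closure)
  moreover have "connected N" unfolding N_def using orbit_connected by (rule connected_imp_connected_closure)
  moreover have xN: "x \<in> N" using N_sub(2) order_facts by auto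
  ultimately obtain c d where cd: "c \<le> d" "N = {c..d}" using cintI unfolding cint_def by blast
  have "s = d" unfolding s_def cd(2) using cd(1) by simp
  moreover have "c = x" using cd xN N_sub(1) by auto
  ultimately show N: "N = {x..s}" using cd by simp
  have "w \<in> N" "s \<in> N" using N_sub(2) order_facts cd \<open>s = d\<close> by auto
  then show "w \<le> s" "s \<le> y" using N N_sub(1) by auto
qed

text \<open>Points of \<open>{x..<z}\<close> cannot reach \<open>x\<close> without moving left, and
  those of \<open>{z..w}\<close> never leave their interval under \<open>f ^^ q\<close>. So the
  orbit does not return to \<open>x\<close>. Taking the closure adds at most \<open>s\<close>; if it
  is new, \<open>s\<close> is itself the image of some point of \<open>N\<close>, and that point
  would have to be in the orbit.\<close>

lemma x_notin_qN: "x \<notin> (f ^^ q) ` N"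
proof
  define U0 where "U0 = orbit_set (f ^^ q) {x..w}"
  have no: "(f ^^ q) t \<noteq> x" if t: "t \<in> U0" for t
  proof
    assume eq: "(f ^^ q) t = x"
    obtain k u where u: "u \<in> {x..w}" "t = (f ^^ (q * k)) u"
      using t unfolding U0_def orbit_set_def funpow_q_mult by blast
    then have fu: "(f ^^ (q * Suc k)) u = x" using eq by (simp add: funpow_add)
    show False
    proof (cases "u < z")
      case True
      then have uU: "u \<in> {a<..<b}" using u(1) order_facts by auto
      moreover have "q * Suc k \<ge> 1" using order_facts by simp
      ultimately have "u < (f ^^ (q * Suc k)) u" using right[of u "q * Suc k"] fu x_facts(2) by metis
      then show False using fu u(1) by simp
    next
      case False
      then have "u \<in> {z..w}" using u(1) by auto
      then have "(f ^^ (q * Suc k)) u \<in> {z..w}"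
        using periodic_mult[OF J' dvd_triv_left[of q "Suc k"]] by blast
      then show False using fu xz by simp
    qed
  qed
  have U0_step: "(f ^^ q) ` U0 \<subseteq> U0" unfolding U0_def by (rule orbit_set_fwd)
  have xU0: "{x..w} \<subseteq> U0" unfolding U0_def by (rule orbit_set_superset)
  have below: "t \<in> U0" if "x \<le> t" "t < s" for t
  proof (rule ccontr)
    assume "t \<notin> U0"
    then have "U0 \<subseteq> {..t}"
      using connectedD_interval[OF orbit_connected, folded U0_def, of x _ t] xU0 order_facts that
      by (metis atLeastAtMost_iff atMost_iff linorder_le_cases less_le_trans less_imp_le order_refl subset_iff)
    then have "N \<subseteq> {..t}" unfolding N_def U0_def by (intro closure_minimal) auto
    then show False using N_eq s_bounds order_facts that by auto
  qed
  assume "x \<in> (f ^^ q) ` N"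
  then obtain v where v: "v \<in> N" "(f ^^ q) v = x" by auto
  have "v \<notin> U0" using no v by blast
  then have vs: "v = s" "s \<notin> U0" using below[of v] v(1) N_eq by force+
  have "s \<in> N" using v vs by simp
  then have "s \<in> (f ^^ q) ` N" using N_split vs(2) xU0 by blast
  then obtain u where u: "u \<in> N" "s = (f ^^ q) u" by blast
  have "u \<noteq> s" using u v vs s_bounds order_facts by auto
  then have "u \<in> U0" using below[of u] u(1) N_eq by auto
  then show False using U0_step u(2) vs(2) by blast
qed

text \<open>For multiples of \<open>q\<close> this follows from invariance of \<open>N\<close>.
  Otherwise the \<open>j\<close>-th image of \<open>{z..w}\<close> contains a periodic point to the
  right of \<open>w\<close>; if \<open>x\<close> were in the same image of \<open>N\<close>, that
  image would cover \<open>{x..w}\<close> and hence \<open>N\<close>. Repeating this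
  \<open>q\<close> times contradicts the first case.\<close>

lemma x_notin_image:
  assumes j: "j \<ge> 1" shows "x \<notin> (f ^^ j) ` N"
proof -
  have mult: "x \<notin> (f ^^ (q * i)) ` N" if "i \<ge> 1" for i
  proof -
    have "q * i = q + q * (i - 1)" using that by (cases i) auto
    then have "(f ^^ (q * i)) ` N = (f ^^ q) ` (f ^^ (q * (i - 1))) ` N" by (simp only: funpow_image_add)
    moreover have "(f ^^ (q * (i - 1))) ` N \<subseteq> N"
      using funpow_image_subset[OF qN, of "i - 1"] by (simp add: funpow_mult)
    ultimately show ?thesis using x_notin_qN by blast
  qed
  show ?thesis
  proof
    assume xj: "x \<in> (f ^^ j) ` N"
    have "\<not> q dvd j"
      using mult xj j by (metis dvd_def dvd_imp_le mult_0_right not_one_le_zero not_less_eq_eq One_nat_def le_0_eq)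
    have "(f ^^ j) ` {x..y} \<inter> {x..y} \<noteq> {}" using xj N_sub(1) order_facts by fastforce
    then have "m dvd j" using cyc_dvd[OF periodic_imp_cyc[OF J]] by blast
    then have jJ: "(f ^^ j) ` {x..y} = {x..y}" using periodic_mult[OF J] by blast
    obtain r where r: "r \<in> (f ^^ j) ` {z..w}" "r \<in> Per f"
      using cyc_has_Per[OF periodic_imp_cyc[OF periodic_funpow_image[OF J']]] by blast
    have "(f ^^ j) ` {z..w} \<inter> {z..w} = {}"
      using cyc_dvd[OF periodic_imp_cyc[OF J']] \<open>\<not> q dvd j\<close> by blast
    then have "r \<notin> {z..w}" using r(1) by blast
    moreover have "r \<in> {x..y}" using r(1) jJ sub by blast
    moreover have "r \<notin> {a<..<b}" using r(2) no_Per by blast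
    ultimately have "w < r" using order_facts by auto
    have conn: "connected ((f ^^ j) ` N)"
      using connected_continuous_image[OF funpow_cont_sub[OF N_sub(3)]] N_eq by simp
    have "{z..w} \<subseteq> N" using N_sub(2) order_facts by auto
    then have "r \<in> (f ^^ j) ` N" using r(1) by blast
    then have "{x..r} \<subseteq> (f ^^ j) ` N" using xj connected_contains_Icc[OF conn] by blast
    then have "{x..w} \<subseteq> (f ^^ j) ` N" using \<open>w < r\<close> by (auto dest!: subsetD)
    moreover have "(f ^^ q) ` (f ^^ j) ` N \<subseteq> (f ^^ j) ` N"
    proof -
      have "(f ^^ q) ` (f ^^ j) ` N = (f ^^ j) ` (f ^^ q) ` N"
        by (simp only: funpow_image_add[symmetric] add.commute)
      then show ?thesis using qN by blast
    qed
    ultimately have "orbit_set (f ^^ q) {x..w} \<subseteq> (f ^^ j) ` N" by (intro orbit_set_least)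
    moreover have "closed ((f ^^ j) ` N)"
      using cintD[OF cint_funpow[OF _ N_sub(3)]] N_eq s_bounds order_facts unfolding cint_def by auto
    ultimately have NjN: "N \<subseteq> (f ^^ j) ` N"
      unfolding N_def[symmetric] by (metis N_def closure_minimal)
    have "N \<subseteq> (f ^^ (j * k)) ` N" for k
    proof (induction k)
      case (Suc k)
      have "(f ^^ j) ` N \<subseteq> (f ^^ j) ` (f ^^ (j * k)) ` N" using Suc by (rule image_mono)
      also have "\<dots> = (f ^^ (j * Suc k)) ` N" by (simp only: funpow_image_add[symmetric] mult_Suc_right)
      finally show ?case using NjN by blast
    qed simp
    then have "N \<subseteq> (f ^^ (q * j)) ` N" by (metis mult.commute)
    moreover have "x \<in> N" using N_sub(2) order_facts by auto
    ultimately show False using mult[OF j] by blast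
  qed
qed

lemma F_image: "j \<ge> 1 \<Longrightarrow> (f ^^ j) ` N \<subseteq> F"
proof (induction j rule: less_induct)
  case (less j)
  show ?case
  proof (cases "j \<le> q")
    case True then show ?thesis using less unfolding F_def by auto
  next
    case False
    then have "j = (j - q) + q" by simp
    then have "(f ^^ j) ` N = (f ^^ (j - q)) ` (f ^^ q) ` N" by (metis funpow_image_add)
    also have "\<dots> \<subseteq> (f ^^ (j - q)) ` N" using qN by (rule image_mono)
    also have "\<dots> \<subseteq> F" using less(1)[of "j - q"] False order_facts(6) by simp
    finally show ?thesis .
  qed
qed

lemma x_image_in_F: "j \<ge> 1 \<Longrightarrow> (f ^^ j) x \<in> F"
  using F_image[of j] N_sub(2) order_facts by (metis atLeastAtMost_iff image_subset_iff less_imp_le less_le_trans order_refl subset_iff)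

lemma image_closed: "closed ((f ^^ j) ` N)" "connected ((f ^^ j) ` N)"
proof -
  have "cint N" unfolding cint_def using N_eq s_bounds order_facts by auto
  then show "closed ((f ^^ j) ` N)" "connected ((f ^^ j) ` N)"
    using cintD[OF cint_funpow[OF _ N_sub(3), of j]] by auto
qed

lemma F_facts: "closed F" "f ` F \<subseteq> F" "x \<notin> F"
proof -
  show "closed F" unfolding F_def using image_closed by (intro closed_UN) auto
  show "x \<notin> F" unfolding F_def using x_notin_image by auto
  have "f ` (f ^^ j) ` N \<subseteq> F" if "j \<ge> 1" for j
    using F_image[of "Suc j"] by (simp add: image_comp)
  then show "f ` F \<subseteq> F" unfolding F_def by (simp add: image_UN UN_subset_iff)
qed

lemma gap:
  obtains d where "d > 0" "{x - d<..<x + d} \<inter> F = {}" "{x - d<..<x + d} \<subseteq> {a<..<b}" "x + d \<le> b"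
proof -
  obtain d1 where d1: "d1 > 0" "ball x d1 \<subseteq> - F"
    using F_facts(1,3) by (metis ComplI open_Compl open_contains_ball)
  obtain e where e: "e > 0" "e < d1" "{x - e..x + e} \<subseteq> {a<..<b}"
    using small_nbhd[OF x_facts(2) d1(1)] .
  have "{x - e<..<x + e} \<subseteq> ball x d1" using e(2) by (auto simp: dist_real_def abs_if)
  moreover have "{x - e<..<x + e} \<subseteq> {x - e..x + e}" by auto
  moreover have "x + e \<in> {x - e..x + e}" using e(1) by simp
  then have "x + e \<le> b" using e(3) by (meson greaterThanLessThan_iff less_imp_le subsetD)
  ultimately show ?thesis using that[of e] e d1(2) by blast
qed

text \<open>Points slightly to the right of \<open>x\<close> belong to \<open>N\<close>, so they are
  absorbed by \<open>F\<close>, which avoids a neighbourhood of \<open>x\<close>.\<close>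

lemma no_near_right:
  obtains d where "d > 0" "nonwandering f \<inter> {x<..<x + d} = {}"
proof -
  obtain d where d: "d > 0" "{x - d<..<x + d} \<inter> F = {}" "{x - d<..<x + d} \<subseteq> {a<..<b}"
    and le: "x + d \<le> b" by (rule gap)
  have "u \<notin> nonwandering f" if u: "u \<in> {x<..<x + d}" for u
  proof
    assume "u \<in> nonwandering f"
    then obtain n t where nt: "n \<ge> 1" "t \<in> {x<..<x + d}" "(f ^^ n) t \<in> {x<..<x + d}"
      using nonwandering_return[OF _ open_greaterThanLessThan u] by metis
    have "t \<in> N" using nt(2) le N_eq s_bounds order_facts by auto
    then have "(f ^^ n) t \<in> F" using F_image[OF nt(1)] by blast
    moreover have "(f ^^ n) t \<in> {x - d<..<x + d}" using nt(3) by auto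
    ultimately show False using d(2) by blast
  qed
  then show ?thesis using that[OF d(1)] by blast
qed

text \<open>Otherwise \<open>f ^^ t\<close> takes a whole neighbourhood of \<open>x\<close> into
  \<open>N\<close>, so that after time \<open>t\<close> it stays in \<open>F\<close> and never
  returns. Returns up to time \<open>t\<close> are excluded for small neighbourhoods because
  \<open>x\<close> is not periodic.\<close>

lemma image_boundary:
  assumes t: "t \<ge> 1" shows "(f ^^ t) x \<notin> {x<..<s}"
proof
  assume int: "(f ^^ t) x \<in> {x<..<s}"
  note sh = nbhd_seq_shrinks[OF x_facts(4)]
  have sep: "\<exists>M. \<forall>n\<ge>M. (f ^^ i) ` nbhd_seq x n \<inter> nbhd_seq x n = {}" if "i \<ge> 1" for i
  proof -
    have ne: "(f ^^ i) x \<noteq> x" using x_facts(3,4) that unfolding Per_def by blast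
    define e where "e = \<bar>(f ^^ i) x - x\<bar> / 2"
    have e: "e > 0" using ne unfolding e_def by simp
    obtain M1 where M1: "\<And>n. n \<ge> M1 \<Longrightarrow> (f ^^ i) ` nbhd_seq x n \<subseteq> {(f ^^ i) x - e<..<(f ^^ i) x + e}"
      using shrinks_funpow[OF sh e] by blast
    obtain M2 where M2: "\<And>n. n \<ge> M2 \<Longrightarrow> nbhd_seq x n \<subseteq> {x - e<..<x + e}"
      using nbhd_seq_small[OF e] by blast
    have "{(f ^^ i) x - e<..<(f ^^ i) x + e} \<inter> {x - e<..<x + e} = {}"
      unfolding e_def by (auto simp: abs_if field_simps split: if_splits)
    then have "(f ^^ i) ` nbhd_seq x n \<inter> nbhd_seq x n = {}" if "n \<ge> max M1 M2" for n
      using M1[of n] M2[of n] that by (meson disjoint_iff max.boundedE subset_iff)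
    then show ?thesis by blast
  qed
  then obtain P where P: "\<And>i n. i \<ge> 1 \<Longrightarrow> n \<ge> P i \<Longrightarrow> (f ^^ i) ` nbhd_seq x n \<inter> nbhd_seq x n = {}" by metis
  obtain d where d: "d > 0" "{x - d<..<x + d} \<inter> F = {}" by (rule gap)
  obtain Q where Q: "\<And>n. n \<ge> Q \<Longrightarrow> nbhd_seq x n \<subseteq> {x - d<..<x + d}"
    using nbhd_seq_small[OF d(1)] by blast
  define e where "e = min ((f ^^ t) x - x) (s - (f ^^ t) x)"
  have "e > 0" using int unfolding e_def by simp
  then obtain R where R: "\<And>n. n \<ge> R \<Longrightarrow> (f ^^ t) ` nbhd_seq x n \<subseteq> {(f ^^ t) x - e<..<(f ^^ t) x + e}"
    using shrinks_funpow[OF sh] by blast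
  define n where "n = Max ({Q, R} \<union> P ` {1..t})"
  have n: "n \<ge> Q" "n \<ge> R" "\<And>i. 1 \<le> i \<Longrightarrow> i \<le> t \<Longrightarrow> n \<ge> P i"
    unfolding n_def by (intro Max_ge; simp)+
  have "{(f ^^ t) x - e<..<(f ^^ t) x + e} \<subseteq> N" unfolding N_eq e_def by auto
  then have tN: "(f ^^ t) ` nbhd_seq x n \<subseteq> N" using R[OF n(2)] by blast
  obtain k where k: "k \<ge> 1" "(f ^^ k) ` nbhd_seq x n \<inter> nbhd_seq x n \<noteq> {}"
    using nonwandering_return_nbhd_seq[OF x_facts(1)] by blast
  show False
  proof (cases "k \<le> t")
    case True then show False using P[OF k(1)] n(3)[OF k(1)] k(2) by blast
  next
    case False
    then have "k = (k - t) + t" by simp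
    then have "(f ^^ k) ` nbhd_seq x n = (f ^^ (k - t)) ` (f ^^ t) ` nbhd_seq x n" by (metis funpow_image_add)
    also have "\<dots> \<subseteq> (f ^^ (k - t)) ` N" using tN by (rule image_mono)
    also have "\<dots> \<subseteq> F" using False by (intro F_image) simp
    finally show False using k(2) Q[OF n(1)] d(2) by blast
  qed
qed

text \<open>Both points lie in the image of \<open>N\<close>, hence in \<open>{x..s}\<close> but
  different from \<open>x\<close>, and \<open>image_boundary\<close> rules out the interior, once
  for \<open>q\<close> and once for \<open>q + q\<close>.\<close>

lemma q_x: "(f ^^ q) x = s" and q_s: "(f ^^ q) s = s"
proof -
  have xN: "x \<in> N" using N_sub(2) order_facts by auto
  have *: "u = s" if "u \<in> N" "u \<noteq> x" "u \<notin> {x<..<s}" for u using that N_eq by auto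
  have q1: "(f ^^ q) x \<in> (f ^^ q) ` N" using xN by blast
  then have "(f ^^ q) x \<noteq> x" using x_notin_qN by metis
  then show qx: "(f ^^ q) x = s"
    using * q1 qN image_boundary[of q] order_facts(6) by blast
  have q2: "(f ^^ q) s \<in> (f ^^ q) ` N" using qx q1 qN by auto
  then have "(f ^^ q) s \<noteq> x" using x_notin_qN by metis
  moreover have "(f ^^ q) s = (f ^^ (q + q)) x" using qx by (simp add: funpow_add)
  then have "(f ^^ q) s \<notin> {x<..<s}" using image_boundary[of "q + q"] order_facts(6) by simp
  ultimately show "(f ^^ q) s = s" using * q2 qN by blast
qed

lemma finite_orbit_x: "finite (orbit f x)"
  using finite_orbitI[of q f x] q_x q_s order_facts(6) by simp

text \<open>The bounds by \<open>w\<close> and \<open>y\<close> are kept so that, along a sequence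
  of pairs, both points are squeezed to the common limit of the right ends; see
  \<open>limit_fixed\<close>.\<close>

lemma return_points:
  "\<exists>s v. w \<le> s \<and> s \<le> y \<and> w \<le> v \<and> v \<le> y \<and> (f ^^ q) x = s \<and> (f ^^ q) s = s \<and> (f ^^ q) v = x"
proof -
  have "x \<in> (f ^^ q) ` {x..y}" unfolding q_image_J using order_facts by auto
  then obtain v where v: "v \<in> {x..y}" "(f ^^ q) v = x" by auto
  have "v \<notin> N" using x_notin_qN v(2) by blast
  then have "s < v" using v(1) N_eq by auto
  then have "w \<le> v" "v \<le> y" using s_bounds v(1) by auto
  then show ?thesis using v(2) s_bounds q_x q_s by blast
qed

text \<open>Each gap of the invariant set \<open>F\<close> contains at most two points of an omega-limit set through \<open>x\<close>:
  otherwise some point left of \<open>x\<close> would return to \<open>{a<..<b}\<close> without moving to the right. So only finitely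
  many of its points lie outside \<open>F\<close>, and these would have to be permuted by \<open>f\<close>, although \<open>f x \<in> F\<close>.\<close>

lemma not_omega: "x \<notin> omega_map f"
proof
  assume "x \<in> omega_map f"
  then obtain p where p: "p \<in> {0..1}" "x \<in> omega_point f p" unfolding omega_map_def by blast
  define L where "L = omega_point f p"
  obtain d where d: "d > 0" "{x - d<..<x + d} \<inter> F = {}" "{x - d<..<x + d} \<subseteq> {a<..<b}"
    by (rule gap)
  have later: "(f ^^ k) p < (f ^^ l) p" if "k < l" "(f ^^ k) p \<in> {a<..<b}" "(f ^^ l) p \<in> {a<..<b}" for k l
  proof -
    have "l = (l - k) + k" using that(1) by simp
    then have "(f ^^ l) p = (f ^^ (l - k)) ((f ^^ k) p)" by (metis comp_apply funpow_add)
    then show ?thesis using right[OF that(2), of "l - k"] that by simp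
  qed
  have nearU: "\<exists>k\<ge>n. (f ^^ k) p \<in> {a<..<b} \<and> \<bar>(f ^^ k) p - x\<bar> < e" if "e > 0" for n e
  proof -
    have "min e d > 0" using that d(1) by simp
    then obtain k where k: "k \<ge> n" "\<bar>(f ^^ k) p - x\<bar> < min e d"
      using omega_pointD[OF p(2)] by metis
    then have "(f ^^ k) p \<in> {x - d<..<x + d}" by auto
    then have "(f ^^ k) p \<in> {a<..<b}" using d(3) by blast
    then show ?thesis using k by auto
  qed
  \<comment> \<open>The visits of the orbit of \<open>p\<close> to \<open>{a<..<b}\<close> form an
    increasing sequence, so one at or beyond \<open>x\<close> would keep later visits away from
    \<open>x\<close>.\<close>
  have below: "(f ^^ t) p < x" if t: "(f ^^ t) p \<in> {a<..<b}" for t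
  proof (rule ccontr)
    assume "\<not> ?thesis"
    obtain k where k: "k \<ge> Suc t" "(f ^^ k) p \<in> {a<..<b}" using nearU[of 1 "Suc t"] by auto
    then have kx: "(f ^^ k) p > x" using later[of t k] t \<open>\<not> _\<close> by simp
    then obtain l where l: "l \<ge> Suc k" "(f ^^ l) p \<in> {a<..<b}" "\<bar>(f ^^ l) p - x\<bar> < (f ^^ k) p - x"
      using nearU[of "(f ^^ k) p - x" "Suc k"] by auto
    then show False using later[of k l] k(2) by simp
  qed
  have three: False if uvw: "u \<in> L" "v \<in> L" "t \<in> L" "u < v" "v < t" "{u..t} \<inter> F = {}" for u v t
  proof -
    have "u \<in> {u..t}" "t \<in> {u..t}" using uvw by auto
    then have "u \<notin> F" "t \<notin> F" using uvw(6) by blast+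
    then obtain e1 e2 where e12: "e1 > 0" "ball u e1 \<subseteq> - F" "e2 > 0" "ball t e2 \<subseteq> - F"
      using F_facts(1) by (metis ComplI open_Compl open_contains_ball)
    define g1 g2 where "g1 = (v - u) / 2" and "g2 = (t - v) / 2"
    have "g1 > 0" "g2 > 0" unfolding g1_def g2_def using uvw by auto
    define e where "e = Min {e1, e2, g1, g2}"
    have "e > 0" "e \<le> e1" "e \<le> e2" "e \<le> g1" "e \<le> g2"
      unfolding e_def using e12 \<open>g1 > 0\<close> \<open>g2 > 0\<close> by auto
    then have e: "e > 0" "e \<le> e1" "e \<le> e2" "e \<le> (v - u) / 2" "e \<le> (t - v) / 2"
      unfolding g1_def g2_def by auto
    obtain k1 where k1: "\<bar>(f ^^ k1) p - u\<bar> < e"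
      using omega_pointD[OF uvw(1)[unfolded L_def] e(1), of 0] by blast
    obtain k2 where k2: "\<bar>(f ^^ k2) p - t\<bar> < e"
      using omega_pointD[OF uvw(3)[unfolded L_def] e(1), of 0] by blast
    define u' t' where "u' = (f ^^ k1) p" and "t' = (f ^^ k2) p"
    have free: "{u'..t'} \<inter> F = {}"
    proof -
      have "{u'..t'} \<subseteq> ball u e1 \<union> {u..t} \<union> ball t e2"
        using k1 k2 e unfolding u'_def t'_def by (auto simp: dist_real_def abs_if split: if_splits)
      then show ?thesis using e12 uvw(6) by blast
    qed
    obtain k where k: "k \<ge> Suc (max k1 k2)" "(f ^^ k) p \<in> {a<..<b}"
      using nearU[of 1 "Suc (max k1 k2)"] by auto
    define c where "c = (f ^^ k) p"
    have c: "c \<in> {a<..<b}" "c < x" using k(2) below[OF k(2)] unfolding c_def by auto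
    obtain l where l: "l \<ge> Suc k" "\<bar>(f ^^ l) p - v\<bar> < e"
      using omega_pointD[OF uvw(2)[unfolded L_def] e(1), of "Suc k"] by blast
    define n where "n = l - k"
    have n: "n \<ge> 1" "l = n + k" using l(1) unfolding n_def by auto
    have fc: "(f ^^ l) p = (f ^^ n) c" unfolding n(2) c_def by (simp add: funpow_add)
    have cx: "connected {c..x}" "{c..x} \<subseteq> {0..1}" "c \<in> {c..x}" "x \<in> {c..x}"
      using c x_facts(2) U_bounds by auto
    have xF: "(f ^^ n) x \<in> F" using x_image_in_F[OF n(1)] .
    have mid: "u' < (f ^^ n) c" "(f ^^ n) c < t'"
      using k1 k2 l(2) e fc unfolding u'_def t'_def by (auto simp: abs_if field_simps split: if_splits)
    have "(f ^^ n) x < u' \<or> t' < (f ^^ n) x"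
      using xF free by (meson atLeastAtMost_iff disjoint_iff not_less)
    \<comment> \<open>The image joins a point near \<open>v\<close> to a point of \<open>F\<close>,
      which lies outside \<open>{u'..t'}\<close>; so it passes through an iterate of
      \<open>p\<close> earlier than \<open>c\<close>. The preimage \<open>r\<close> in
      \<open>{c..x}\<close> is then carried on to \<open>c\<close>, although returns must go to the
      right.\<close>
    then have "u' \<in> (f ^^ n) ` {c..x} \<or> t' \<in> (f ^^ n) ` {c..x}"
      using funpow_ivt[OF cx(1,2,4,3), of n u'] funpow_ivt[OF cx(1,2,3,4), of n t'] mid by auto
    then obtain k0 r where k0: "k0 < k" "r \<in> {c..x}" "(f ^^ n) r = (f ^^ k0) p"
    proof
      assume "u' \<in> (f ^^ n) ` {c..x}"
      then show ?thesis using that[of k1] k(1) unfolding u'_def by auto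
    next
      assume "t' \<in> (f ^^ n) ` {c..x}"
      then show ?thesis using that[of k2] k(1) unfolding t'_def by auto
    qed
    have "(f ^^ (k - k0 + n)) r = c"
      using k0(1,3) unfolding c_def by (metis comp_apply funpow_add le_add_diff_inverse2 less_imp_le)
    moreover have "r \<in> {a<..<b}" using k0(2) c x_facts(2) by auto
    moreover have "k - k0 + n \<ge> 1" using n(1) by simp
    ultimately have "r < c" using right[of r "k - k0 + n"] c(1) by simp
    then show False using k0(2) by simp
  qed
  have "finite (L - F)"
  proof (rule ccontr)
    assume inf: "infinite (L - F)"
    \<comment> \<open>The components of \<open>F\<close> that have points to the left of
      \<open>l\<close>. Two points outside \<open>F\<close> with equal index sets have no point of
      \<open>F\<close> between them, and there are only finitely many index sets.\<close>
    define ix where "ix l = {j \<in> {1..q}. \<exists>y\<in>(f ^^ j) ` N. y < l}" for l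
    have "finite (ix ` (L - F))"
      by (rule finite_subset[of _ "Pow {1..q}"]) (auto simp: ix_def)
    then obtain l0 where "infinite {l \<in> L - F. ix l = ix l0}"
      using pigeonhole_infinite[OF inf] by blast
    then obtain u v t where uvt: "u \<in> L - F" "v \<in> L - F" "t \<in> L - F" "u < v" "v < t" "ix u = ix t"
      by (rule infinite_three) (auto intro: that)
    have "{u..t} \<inter> F = {}"
    proof (rule ccontr)
      assume "\<not> ?thesis"
      then obtain c where "c \<in> F" "c \<in> {u..t}" by blast
      then obtain j where c: "c \<in> {u..t}" "j \<in> {1..q}" "c \<in> (f ^^ j) ` N" unfolding F_def by blast
      have "(f ^^ j) ` N \<subseteq> F" using c(2) F_image by auto
      then have "c \<noteq> t" "u \<notin> (f ^^ j) ` N" using c(3) uvt by auto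
      then have "c < t" using c(1) by auto
      then have "j \<in> ix t" unfolding ix_def using c(2,3) by blast
      then have "j \<in> ix u" using uvt(6) by simp
      then obtain c' where c': "c' \<in> (f ^^ j) ` N" "c' < u" unfolding ix_def by blast
      then have "u \<in> (f ^^ j) ` N"
        using connectedD_interval[OF image_closed(2), of c' j c u] c(1,3) by auto
      then show False using \<open>u \<notin> _\<close> by blast
    qed
    then show False using three uvt by blast
  qed
  moreover have "L - F \<subseteq> f ` (L - F)"
  proof
    fix l assume l: "l \<in> L - F"
    then obtain l' where "l' \<in> L" "f l' = l" using omega_preimage[OF p(1)] unfolding L_def by blast
    then show "l \<in> f ` (L - F)" using l F_facts(2) by auto
  qed
  ultimately have "f ` (L - F) = L - F"
    by (metis card_image_le card_seteq finite_imageI)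
  moreover have "x \<in> L - F" using p(2) F_facts(3) unfolding L_def by blast
  moreover have "f x \<in> F" using x_image_in_F[of 1] by simp
  ultimately show False by blast
qed

text \<open>Orbits of neighbourhoods of \<open>x\<close> are dense in \<open>{x..y}\<close>, and
  those of the left half suffice. Some point of it lands just left of \<open>z\<close>, while the
  same iterate takes \<open>x\<close> to \<open>s\<close> or beyond; the intermediate value theorem
  covers what lies between. Such coverings will be chained in \<open>limit_in_omega\<close>.\<close>

lemma left_covers:
  assumes lim: "orbit_set f {x..y} \<subseteq> near_lim f x" and e: "e > 0" "a < x - e" and e': "e' > 0"
  obtains n u where "n \<ge> 1" "z - e' < u" "x < u" "u < z" "{u..z} \<subseteq> (f ^^ n) ` {x - e..x}"
proof -
  define A where "A = {x - e..x}"
  have A01: "A \<subseteq> {0..1}" "A \<subseteq> {a<..<b}"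
    using e x_facts(2,4) U_bounds unfolding A_def by auto
  obtain d where d: "d > 0" "{x - d<..<x + d} \<inter> F = {}" "{x - d<..<x + d} \<subseteq> {a<..<b}"
    and le: "x + d \<le> b" by (rule gap)
  \<comment> \<open>A return near \<open>x\<close> must start to the left of \<open>x\<close>, since
    points on the right are trapped in \<open>F\<close>. The same iterate throws \<open>x\<close> to
    the right across the gap, so the image of \<open>{c..x}\<close> covers \<open>t\<close>.\<close>
  have right_part: "t \<in> orbit_set f A" if t: "x < t" "t < x + d" for t
  proof -
    define T where "T = {x - min e d<..<t}"
    have T: "open T" "x \<in> T" "T \<subseteq> {x - d<..<x + d}" using t e(1) d(1) unfolding T_def by auto
    obtain k c where kc: "k \<ge> 1" "c \<in> T" "(f ^^ k) c \<in> T"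
      using nonwandering_return[OF x_facts(1) T(1,2)] by metis
    have cx: "c < x"
    proof (rule ccontr)
      assume "\<not> ?thesis"
      then have "c \<in> N" using kc(2) t le N_eq s_bounds order_facts unfolding T_def by auto
      then have "(f ^^ k) c \<in> F" using F_image[OF kc(1)] by blast
      then show False using kc(3) T(3) d(2) by blast
    qed
    have cA: "{c..x} \<subseteq> A" using kc(2) unfolding T_def A_def by auto
    have "x < (f ^^ k) x" using all_right[of c k x] kc T(3) d(3) x_facts(2) by blast
    moreover have "(f ^^ k) x \<in> F" using x_image_in_F[OF kc(1)] .
    then have "(f ^^ k) x \<notin> {x - d<..<x + d}" using d(2) by blast
    ultimately have "t \<le> (f ^^ k) x" using t d(1) by auto
    moreover have "(f ^^ k) c \<le> t" using kc(3) unfolding T_def by auto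
    ultimately have "t \<in> (f ^^ k) ` {c..x}"
      using cx by (intro funpow_ivt[OF _ order_trans[OF cA A01(1)], of c x]) auto
    then show ?thesis using cA unfolding orbit_set_def by blast
  qed
  define V where "V = {max x (z - e')<..<z}"
  have V: "open V" "V \<noteq> {}" "V \<subseteq> {x..y}" using xz e' order_facts unfolding V_def by auto
  have "min e d > 0" using e(1) d(1) by simp
  then obtain n where n: "nbhd_seq x n \<subseteq> {x - min e d<..<x + min e d}" using nbhd_seq_small by blast
  have "V \<subseteq> closure (orbit_set f (nbhd_seq x n))"
    using V(3) orbit_set_superset[of "{x..y}" f] lim unfolding lim_orbit_def by blast
  then have "V \<inter> orbit_set f (nbhd_seq x n) \<noteq> {}"
    using open_Int_closure_eq_empty[OF V(1), of "orbit_set f (nbhd_seq x n)"] V(2) by blast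
  then obtain k c where kc: "c \<in> nbhd_seq x n" "(f ^^ k) c \<in> V" unfolding orbit_set_def by blast
  obtain k c where kc: "c \<in> A" "(f ^^ k) c \<in> V"
  proof (cases "c \<le> x")
    case True
    moreover have "c \<in> {x - min e d<..<x + min e d}" using kc(1) n by blast
    ultimately show ?thesis using that[of c k] kc(2) unfolding A_def by auto
  next
    case False
    moreover have "c \<in> {x - min e d<..<x + min e d}" using kc(1) n by blast
    ultimately have "c \<in> orbit_set f A" by (intro right_part) auto
    then obtain i c' where "c' \<in> A" "c = (f ^^ i) c'" unfolding orbit_set_def by blast
    then show ?thesis using that[of c' "k + i"] kc(2) by (simp add: funpow_add)
  qed
  have "k \<ge> 1" using kc unfolding A_def V_def by (cases k) auto
  have "V \<subseteq> {a<..<b}" unfolding V_def using order_facts by auto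
  then have "x < (f ^^ k) x" using all_right[of c k x] kc A01(2) \<open>k \<ge> 1\<close> x_facts(2) by blast
  then have "s \<le> (f ^^ k) x" using image_boundary[OF \<open>k \<ge> 1\<close>] by auto
  then have zk: "z \<le> (f ^^ k) x" using s_bounds order_facts by simp
  have "{(f ^^ k) c..z} \<subseteq> (f ^^ k) ` A"
  proof
    fix t assume "t \<in> {(f ^^ k) c..z}"
    moreover have "connected A" "x \<in> A" unfolding A_def using e(1) by auto
    ultimately show "t \<in> (f ^^ k) ` A" using zk A01(1) kc(1) by (intro funpow_ivt[of A c x k t]) auto
  qed
  then show ?thesis using that[OF \<open>k \<ge> 1\<close>, of "(f ^^ k) c"] kc(2) unfolding V_def A_def by auto
qed

end

section \<open>Classification\<close>

context interval_map
begin

lemma nonwandering_closed: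
  assumes X: "\<And>n. X n \<in> nonwandering f" "X \<longlonglongrightarrow> p"
  shows "p \<in> nonwandering f"
proof -
  have "closed {0..1::real}" by simp
  moreover have "X n \<in> {0..1}" for n using X(1)[of n] unfolding nonwandering_def by blast
  ultimately have p01: "p \<in> {0..1}" using X(2) closed_sequentially by blast
  have "\<exists>n\<ge>1. (f ^^ n) ` V \<inter> V \<noteq> {}" if V: "nbhd_in {0..1} p V" for V
  proof -
    obtain T where T: "openin (top_of_set {0..1}) T" "p \<in> T" "T \<subseteq> V"
      using V unfolding nbhd_in_def by blast
    obtain O1 where O1: "open O1" "T = {0..1} \<inter> O1" using T(1) unfolding openin_open by blast
    then have "\<forall>\<^sub>F n in sequentially. X n \<in> O1"
      using X(2) T(2) by (intro topological_tendstoD) auto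
    then obtain n where n: "X n \<in> O1" using eventually_sequentially by auto
    obtain k w where kw: "k \<ge> 1" "w \<in> O1" "w \<in> {0..1}" "(f ^^ k) w \<in> O1" "(f ^^ k) w \<in> {0..1}"
      by (rule nonwandering_return[OF X(1) O1(1) n])
    then have "w \<in> V" "(f ^^ k) w \<in> V" using O1(2) T(3) by auto
    then show ?thesis using kw(1) by blast
  qed
  then show ?thesis unfolding nonwandering_def using p01 by blast
qed

text \<open>In the limit \<open>f ^^ q\<close> maps \<open>p\<close> to \<open>r\<close>, while it
  maps \<open>r\<close> both to \<open>r\<close> and to \<open>p\<close>.\<close>

lemma limit_fixed:
  assumes lim: "X \<longlonglongrightarrow> p" "A \<longlonglongrightarrow> r" "B \<longlonglongrightarrow> r"
    and mem: "\<And>n. X n \<in> {0..1}" "\<And>n. 0 \<le> A n" "\<And>n. B n \<le> 1"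
    and ret: "\<And>n. \<exists>s v. A n \<le> s \<and> s \<le> B n \<and> A n \<le> v \<and> v \<le> B n \<and>
      (f ^^ q) (X n) = s \<and> (f ^^ q) s = s \<and> (f ^^ q) v = X n"
  shows "p = r" "(f ^^ q) p = p"
proof -
  obtain s v where sv: "\<And>n. A n \<le> s n" "\<And>n. s n \<le> B n" "\<And>n. A n \<le> v n" "\<And>n. v n \<le> B n"
    and f: "\<And>n. (f ^^ q) (X n) = s n" "\<And>n. (f ^^ q) (s n) = s n" "\<And>n. (f ^^ q) (v n) = X n"
    using ret by metis
  have s: "s \<longlonglongrightarrow> r" by (rule tendsto_sandwich[OF _ _ lim(2,3)]) (use sv in auto)
  have v: "v \<longlonglongrightarrow> r" by (rule tendsto_sandwich[OF _ _ lim(2,3)]) (use sv in auto)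
  have sv01: "s n \<in> {0..1}" "v n \<in> {0..1}" for n
    using sv[of n] mem(2,3)[of n] by auto
  have cl: "closed {0..1::real}" by simp
  have pr: "p \<in> {0..1}" "r \<in> {0..1}"
    using lim(1) s mem(1) sv01(1) closed_sequentially[OF cl] by blast+
  have *: "(\<lambda>n. (f ^^ q) (Y n)) \<longlonglongrightarrow> (f ^^ q) t" if "Y \<longlonglongrightarrow> t" "\<And>n. Y n \<in> {0..1}" "t \<in> {0..1}" for Y t
    using continuous_on_tendsto_compose[OF funpow_cont that(1,3)] that(2) by simp
  have "(f ^^ q) p = r" using *[OF lim(1) mem(1) pr(1)] s LIMSEQ_unique unfolding f(1) by blast
  moreover have "(f ^^ q) r = r" using *[OF s sv01(1) pr(2)] s LIMSEQ_unique unfolding f(2) by blast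
  moreover have "(f ^^ q) r = p" using *[OF v sv01(2) pr(2)] lim(1) LIMSEQ_unique unfolding f(3) by blast
  ultimately show "p = r" "(f ^^ q) p = p" by auto
qed

lemma solenoidal_Inter:
  assumes "generating f I"
  shows "solenoidal_for f I (\<Inter>j. orbit_set f (I j))"
proof -
  have "\<And>j. closed (orbit_set f (I j)) \<and> f ` orbit_set f (I j) \<subseteq> orbit_set f (I j)"
    using assms orbit_periodic_closed unfolding generating_def by blast
  then have "closed (\<Inter>j. orbit_set f (I j))" "f ` (\<Inter>j. orbit_set f (I j)) \<subseteq> (\<Inter>j. orbit_set f (I j))"
    by (auto simp: image_subset_iff)
  then show ?thesis using assms unfolding solenoidal_for_def by blast
qed

text \<open>A point of \<open>L n\<close> can be pulled back through the coverings to a point of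
  \<open>L 0\<close> with the prescribed itinerary; compactness yields one point for all
  \<open>n\<close>. The times \<open>T\<close> are the partial sums of \<open>t\<close>.\<close>

lemma iterated_cover:
  fixes L :: "nat \<Rightarrow> real set"
  assumes L: "\<And>n. compact (L n)" "\<And>n. L n \<noteq> {}" "\<And>n. L n \<subseteq> {0..1}"
    and t: "\<And>n. t n \<ge> 1" "\<And>n. L (Suc n) \<subseteq> (f ^^ t n) ` L n"
  obtains p and T :: "nat \<Rightarrow> nat" where "p \<in> {0..1}" "strict_mono T" "\<And>n. (f ^^ T n) p \<in> L n"
proof -
  define T where "T n = (\<Sum>i<n. t i)" for n
  have T_Suc: "T (Suc n) = t n + T n" for n unfolding T_def by simp
  have pull: "\<exists>p\<in>L 0. (f ^^ T n) p = y \<and> (\<forall>i\<le>n. (f ^^ T i) p \<in> L i)" if "y \<in> L n" for n y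
    using that
  proof (induction n arbitrary: y)
    case 0 then show ?case by (intro bexI[of _ y]) (auto simp: T_def)
  next
    case (Suc n)
    then obtain y' where y': "y' \<in> L n" "y = (f ^^ t n) y'" using t(2)[of n] by blast
    then obtain p where p: "p \<in> L 0" "(f ^^ T n) p = y'" "\<forall>i\<le>n. (f ^^ T i) p \<in> L i"
      using Suc.IH by blast
    then have "(f ^^ T (Suc n)) p = y" using y' T_Suc by (simp add: funpow_add)
    then show ?case using p Suc.prems by (intro bexI[of _ p]) (auto simp: le_Suc_eq)
  qed
  define C where "C n = (\<Inter>i\<le>n. L 0 \<inter> (f ^^ T i) -` L i)" for n
  have "closed (L 0 \<inter> (f ^^ T i) -` L i)" for i
    using L by (intro continuous_closed_preimage funpow_cont_sub compact_imp_closed) auto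
  then have "closed (C n)" for n unfolding C_def by (intro closed_INT) auto
  moreover have "C n \<subseteq> L 0" for n unfolding C_def by blast
  ultimately have "compact (C n)" for n using L(1)[of 0] by (metis compact_Int_closed inf.absorb_iff2)
  moreover have "C n \<noteq> {}" for n
  proof -
    obtain y where "y \<in> L n" using L(2) by blast
    then obtain p where "p \<in> L 0" "\<forall>i\<le>n. (f ^^ T i) p \<in> L i" using pull by blast
    then have "p \<in> C n" unfolding C_def by auto
    then show ?thesis by blast
  qed
  moreover have "C n \<subseteq> C k" if "k \<le> n" for k n unfolding C_def using that by (intro INF_superset_mono) auto
  ultimately have "(\<Inter>n. C n) \<noteq> {}" using compact_nest[of C] by auto
  then obtain p where "\<And>n. p \<in> C n" by blast
  then have p: "p \<in> L 0" "\<And>n. (f ^^ T n) p \<in> L n" unfolding C_def by auto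
  have "strict_mono T" unfolding strict_mono_Suc_iff using T_Suc t(1) by (simp add: Suc_le_eq)
  then show ?thesis using that[of p T] p L(3)[of 0] by blast
qed

end

section \<open>The order of the nonwandering points\<close>

context right_moving
begin

text \<open>The inclusion in \<open>near_lim f x\<close> goes beyond the final claim. It is what
  makes the intervals of different points nested and what \<open>left_covers\<close> needs.\<close>

definition basic_point :: "real \<Rightarrow> real \<Rightarrow> nat \<Rightarrow> bool" where
  "basic_point x y k \<longleftrightarrow> periodic_interval f {x..y} k \<and> orbit_set f {x..y} \<subseteq> near_lim f x \<and>
     in_Omega_basic f {x..y} x"

lemma nested_interval:
  assumes x: "x \<in> NW" "x' \<in> NW" "x < x'" and J: "periodic_interval f {x..y} k"
    and I: "periodic_interval f {z..w} q" "z \<le> x'" "x' \<le> w" and A: "A \<subseteq> {x<..<b}"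
    and sub: "{z..w} \<subseteq> closure (orbit_set f A)"
  shows "{z..w} \<subseteq> {x..y}"
proof -
  have b: "b \<le> y" using periodic_reaches_b[OF J] x(1) by auto
  then have "A \<subseteq> {x..y}" using A by auto
  then have "closure (orbit_set f A) \<subseteq> orbit_set f {x..y}"
    using orbit_set_mono orbit_periodic_closed(1)[OF J] by (intro closure_minimal) auto
  then have "{z..w} \<subseteq> orbit_set f {x..y}" using sub by blast
  moreover have "x' \<in> {z..w} \<inter> {x..y}" using I(2,3) x b by auto
  ultimately show ?thesis using cyc_connected0[OF periodic_imp_cyc[OF J], of "{z..w}"] by auto
qed

lemma pair_exists:
  assumes x: "x \<in> NW" "x' \<in> NW" "x < x'" and J: "periodic_interval f {x..y} k"
  shows "\<exists>z w q. nested_pair f a b x y k z w q"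
proof -
  \<comment> \<open>Neighbourhoods of \<open>x'\<close> of this radius stay within
    \<open>{x<..<b}\<close>, hence within the interval of \<open>x\<close>.\<close>
  define d where "d = min (x' - x) (b - x')"
  have d: "d > 0" using x unfolding d_def by auto
  obtain z w q A where I: "periodic_interval f {z..w} q" "x' - d < z" "z \<le> x'" "b \<le> w"
    "A \<subseteq> {x' - d<..<x' + d}" "{z..w} \<subseteq> closure (orbit_set f A)"
    using periodic_near[OF x(2) d] by metis
  have "{x' - d<..<x' + d} \<subseteq> {x<..<b}" unfolding d_def by auto
  then have "A \<subseteq> {x<..<b}" using I(5) by blast
  moreover have "x' \<le> w" using I(4) x(2) by auto
  ultimately have "{z..w} \<subseteq> {x..y}" using nested_interval[OF x J I(1,3)] I(6) by blast
  moreover have "x < z" "z < b" using I(2,3) x unfolding d_def by auto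
  ultimately have "nested_pair f a b x y k z w q"
    using x(1) J I(1) by unfold_locales auto
  then show ?thesis by blast
qed

lemma pair_basic:
  assumes x: "x \<in> NW" "x' \<in> NW" "x < x'" and J: "basic_point x y k" "basic_point x' y' q"
  shows "nested_pair f a b x y k x' y' q"
proof -
  have per: "periodic_interval f {x..y} k" "periodic_interval f {x'..y'} q"
    and lim: "orbit_set f {x'..y'} \<subseteq> near_lim f x'" using J unfolding basic_point_def by auto
  define d where "d = min (x' - x) (b - x')"
  have d: "d > 0" using x unfolding d_def by auto
  obtain n where n: "nbhd_seq x' n \<subseteq> {x' - d<..<x' + d}" using nbhd_seq_small[OF d] by blast
  have "{x' - d<..<x' + d} \<subseteq> {x<..<b}" unfolding d_def by auto
  then have "nbhd_seq x' n \<subseteq> {x<..<b}" using n by blast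
  moreover have "{x'..y'} \<subseteq> closure (orbit_set f (nbhd_seq x' n))"
    using lim orbit_set_superset[of "{x'..y'}" f] unfolding lim_orbit_def by blast
  moreover have "x' \<le> y'" using per(2) unfolding periodic_interval_def by auto
  ultimately have "{x'..y'} \<subseteq> {x..y}" using nested_interval[OF x per] by auto
  then show ?thesis using x per by unfold_locales auto
qed

text \<open>The later point \<open>x'\<close> rules out the alternative in which
  \<open>{x<..<b}\<close> is wandering, and it provides the inner interval of a nested pair.\<close>

lemma not_last:
  assumes x: "x \<in> NW" "x' \<in> NW" "x < x'"
  shows "\<exists>y k. basic_point x y k" "finite (orbit f x)" "x \<notin> omega_map f"
    "\<exists>d>0. nonwandering f \<inter> {x<..<x + d} = {}"
proof -
  have "nonwandering f \<inter> {x<..<b} \<noteq> {}" using x by auto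
  then obtain y k where yk: "basic_point x y k"
    using nonwandering_dichotomy[OF x(1)] unfolding basic_point_def by blast
  then show "\<exists>y k. basic_point x y k" by blast
  obtain z w q where "nested_pair f a b x y k z w q"
    using pair_exists[OF x, of y k] yk unfolding basic_point_def by blast
  then interpret nested_pair f a b x y k z w q .
  show "finite (orbit f x)" by (rule finite_orbit_x)
  show "x \<notin> omega_map f" by (rule not_omega)
  show "\<exists>d>0. nonwandering f \<inter> {x<..<x + d} = {}" using no_near_right by metis
qed

lemma b_01: "b \<in> {0..1}"
  using U_bounds ab by auto

text \<open>A limit \<open>p > a\<close> would be nonwandering and accumulated from the right,
  against \<open>not_last\<close>. If \<open>p = a\<close>, the intervals grow along the sequence
  and their periods divide the previous ones, so they are finally constant; then
  \<open>limit_fixed\<close> identifies \<open>a\<close> with the limit of the right ends, which is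
  at least \<open>b\<close>.\<close>

lemma no_descending:
  assumes X: "\<And>n. X n \<in> NW" "\<And>n. X (Suc n) < X n"
  shows False
proof -
  have dec: "decseq X" using X(2) by (intro decseq_SucI less_imp_le)
  obtain p where p: "X \<longlonglongrightarrow> p" "\<And>n. p \<le> X n"
    using decseq_convergent[OF dec, of a] X(1) by (metis IntD2 greaterThanLessThan_iff less_imp_le)
  have pX: "p < X n" for n using p(2)[of "Suc n"] X(2)[of n] by simp
  have "a \<le> p" using p(1) X(1) by (intro LIMSEQ_le_const[of X]) (auto simp: less_imp_le)
  show False
  proof (cases "a < p")
    case True
    have "p \<in> nonwandering f" using nonwandering_closed[OF _ p(1)] X(1) by blast
    then have pNW: "p \<in> NW" using True pX[of 0] X(1)[of 0] by auto
    obtain d where d: "d > 0" "nonwandering f \<inter> {p<..<p + d} = {}"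
      using not_last(4)[OF pNW X(1)[of 0] pX] by blast
    obtain n where "X n < p + d"
      using order_tendstoD(2)[OF p(1), of "p + d"] d(1) unfolding eventually_sequentially by auto
    then show False using d(2) pX[of n] X(1)[of n] by auto
  next
    case False
    then have pa: "p = a" using \<open>a \<le> p\<close> by simp
    \<comment> \<open>The shift guarantees that each point has the nonwandering point
      \<open>X n\<close> to its right.\<close>
    define W where "W n = X (Suc n)" for n
    have W: "W n \<in> NW" "W (Suc n) < W n" for n using X unfolding W_def by auto
    have "\<exists>y k. basic_point (W n) y k" for n
      unfolding W_def by (rule not_last(1)[OF X(1) X(1) X(2)])
    then obtain Y k where Yk: "\<And>n. basic_point (W n) (Y n) (k n)" by metis
    have pair: "nested_pair f a b (W (Suc n)) (Y (Suc n)) (k (Suc n)) (W n) (Y n) (k n)" for n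
      by (rule pair_basic[OF W(1) W(1) W(2) Yk Yk])
    have kdvd: "k (Suc n) dvd k n" for n using nested_pair.m_dvd_q[OF pair] .
    have kpos: "k n \<ge> 1" for n using Yk[of n] unfolding basic_point_def periodic_interval_def by blast
    have kle: "k (Suc n) \<le> k n" for n using kdvd[of n] kpos[of n] by (intro dvd_imp_le) auto
    obtain N where N: "\<And>n. k N \<le> k n" using ex_has_least_nat[of "\<lambda>_. True" 0 k] by auto
    have const: "k n = k N" if "n \<ge> N" for n
      using lift_Suc_antimono_le[of k, OF kle that] N[of n] by simp
    define q where "q = k N"
    have pairq: "nested_pair f a b (W (Suc (n + N))) (Y (Suc (n + N))) q (W (n + N)) (Y (n + N)) q" for n
      using pair[of "n + N"] const[of "n + N"] const[of "Suc (n + N)"] unfolding q_def by simp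
    have Y01: "Y n \<le> 1" "b \<le> Y n" for n
      using nested_pair.order_facts[OF pair, of n] by auto
    have W01: "W n \<in> {0..1}" for n using W(1)[of n] U01 by blast
    have "Y n \<le> Y (Suc n)" for n using nested_pair.order_facts(5)[OF pair] .
    then have "incseq Y" by (rule incseq_SucI)
    then obtain r where r: "Y \<longlonglongrightarrow> r" using incseq_convergent[of Y 1] Y01(1) by metis
    have rN: "(\<lambda>n. Y (n + N)) \<longlonglongrightarrow> r" "(\<lambda>n. Y (Suc (n + N))) \<longlonglongrightarrow> r"
      using LIMSEQ_ignore_initial_segment[OF r, of N] LIMSEQ_ignore_initial_segment[OF r, of "Suc N"] by auto
    have Wl: "(\<lambda>n. W (Suc (n + N))) \<longlonglongrightarrow> p"
      unfolding W_def using LIMSEQ_ignore_initial_segment[OF p(1), of "N + 2"] by simp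
    have Y0: "0 \<le> Y n" for n using Y01(2)[of n] U_bounds ab by simp
    have "p = r" by (rule limit_fixed(1)[OF Wl rN W01 Y0 Y01(1) nested_pair.return_points[OF pairq]])
    moreover have "b \<le> r" using r Y01(2) by (intro LIMSEQ_le_const[of Y]) auto
    ultimately show False using pa ab by simp
  qed
qed

lemma NW_min:
  assumes "T \<subseteq> NW" "T \<noteq> {}" shows "\<exists>t\<in>T. \<forall>u\<in>T. t \<le> u"
proof (rule ccontr)
  assume "\<not> ?thesis"
  then have "\<exists>u. t \<in> T \<longrightarrow> u \<in> T \<and> u < t" for t by (meson not_le)
  then obtain g where g: "\<And>t. t \<in> T \<Longrightarrow> g t \<in> T \<and> g t < t" by metis
  obtain t0 where "t0 \<in> T" using assms(2) by blast
  then have mem: "(g ^^ n) t0 \<in> T" for n by (induction n) (use g in auto)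
  have "(g ^^ Suc n) t0 < (g ^^ n) t0" for n using g[OF mem[of n]] by simp
  then show False using no_descending[of "\<lambda>n. (g ^^ n) t0"] mem assms(1) by blast
qed

lemma finite_case:
  assumes fin: "finite NW" and ne: "NW \<noteq> {}"
  shows "possibility2 f a b"
proof -
  define n where "n = card NW"
  define l where "l = sorted_list_of_set NW"
  define x where "x i = l ! (i - 1)" for i
  \<comment> \<open>Only for \<open>i = n\<close> can there be no such interval; then
    \<open>y n\<close> is arbitrary and the solenoidal alternative is used.\<close>
  define y where "y i = (SOME y. \<exists>k. basic_point (x i) y k)" for i
  have n: "n \<ge> 1" unfolding n_def using fin ne by (simp add: Suc_le_eq card_gt_0_iff)
  have l: "sorted_wrt (<) l" "set l = NW" "length l = n"
    unfolding l_def n_def using fin by (auto simp: strict_sorted_list_of_set)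
  have mono: "x i < x j" if "1 \<le> i" "i < j" "j \<le> n" for i j
    using l(1,3) that unfolding x_def sorted_wrt_iff_nth_less by auto
  have mem: "x i \<in> NW" if "1 \<le> i" "i \<le> n" for i
    unfolding x_def using l(2,3) that nth_mem[of "i - 1" l] by auto
  have range: "x ` {1..n} = NW"
  proof
    show "x ` {1..n} \<subseteq> NW" using mem by auto
    show "NW \<subseteq> x ` {1..n}"
    proof
      fix u assume "u \<in> NW"
      then have "u \<in> set l" using l(2) by blast
      then obtain i where "i < n" "u = l ! i" using l(3) by (metis in_set_conv_nth)
      then have "u = x (Suc i)" "Suc i \<in> {1..n}" unfolding x_def by auto
      then show "u \<in> x ` {1..n}" by blast
    qed
  qed
  have someb: "\<exists>k. basic_point (x i) (y i) k" if "\<exists>y k. basic_point (x i) y k" for i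
    unfolding y_def using that by (rule someI_ex)
  have inner: "\<exists>k. basic_point (x i) (y i) k" "finite (orbit f (x i))" "x i \<notin> omega_map f" if "i \<in> {1..<n}" for i
  proof -
    have i: "x i \<in> NW" "x n \<in> NW" "x i < x n" using that mem[of i] mem[of n] mono[of i n] n by auto
    show "\<exists>k. basic_point (x i) (y i) k" by (rule someb[OF not_last(1)[OF i]])
    show "finite (orbit f (x i))" "x i \<notin> omega_map f"
      by (rule not_last(2)[OF i], rule not_last(3)[OF i])
  qed
  have nest: "{x j..y j} \<subseteq> {x i..y i}"
    if ij: "1 \<le> i" "i < j" "j \<le> n" "\<exists>k. basic_point (x i) (y i) k" "\<exists>k. basic_point (x j) (y j) k" for i j
  proof -
    obtain k1 k2 where "basic_point (x i) (y i) k1" "basic_point (x j) (y j) k2" using ij(4,5) by blast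
    then have "nested_pair f a b (x i) (y i) k1 (x j) (y j) k2"
      using pair_basic[of "x i" "x j"] mem[of i] mem[of j] mono[of i j] ij(1-3) by auto
    then show ?thesis by (rule nested_pair.sub)
  qed
  have last: "(\<exists>S. solenoidal f S \<and> x n \<in> S) \<or> (\<exists>k. basic_point (x n) (y n) k)"
  proof -
    consider I where "generating f I" "\<forall>j. x n \<in> I j" | "\<exists>y k. basic_point (x n) y k"
      using nonwandering_dichotomy[OF mem[of n]] n unfolding basic_point_def by blast
    then show ?thesis
    proof cases
      case 1
      then have "x n \<in> (\<Inter>j. orbit_set f (I j))" using orbit_set_superset by blast
      then show ?thesis using solenoidal_Inter[OF 1(1)] unfolding solenoidal_def by blast
    next
      case 2 then show ?thesis using someb by blast
    qed
  qed
  show ?thesis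
    unfolding possibility2_def
  proof (rule exI[of _ n], rule exI[of _ x], rule exI[of _ y], intro conjI)
    show "strict_mono_on {1..n} x" using mono by (intro strict_mono_onI) auto
    show "NW = x ` {1..n}" using range by simp
    show "\<forall>i\<in>{1..<n}. finite (orbit f (x i))" using inner(2) by blast
    show "x ` {1..<n} \<inter> omega_map f = {}" using inner(3) by blast
    show "\<forall>i\<in>{1..<n}. (\<exists>k. periodic_interval f {x i..y i} k) \<and> in_Omega_basic f {x i..y i} (x i)"
      using inner(1) unfolding basic_point_def by blast
    show "\<forall>i. 1 \<le> i \<and> i + 2 \<le> n \<longrightarrow> {x (i + 1)..y (i + 1)} \<subseteq> {x i..y i}"
      using nest inner(1) by auto
    show "(\<exists>S. solenoidal f S \<and> x n \<in> S) \<or> (\<exists>k. periodic_interval f {x n..y n} k) \<and>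
      in_Omega_basic f {x n..y n} (x n) \<and> (2 \<le> n \<longrightarrow> {x n..y n} \<subseteq> {x (n - 1)..y (n - 1)})"
    proof (cases "\<exists>k. basic_point (x n) (y n) k")
      case True
      have "2 \<le> n \<longrightarrow> {x n..y n} \<subseteq> {x (n - 1)..y (n - 1)}"
        using nest[of "n - 1" n] inner(1)[of "n - 1"] True by auto
      then show ?thesis using True unfolding basic_point_def by blast
    next
      case False then show ?thesis using last by blast
    qed
  qed (rule n)
qed

lemma enumerate_NW:
  assumes inf: "infinite NW"
  obtains X :: "nat \<Rightarrow> real" where "\<And>n. X n \<in> NW" "\<And>n. X n < X (Suc n)"
    "\<And>u. u \<in> NW \<Longrightarrow> u \<in> range X \<or> (\<forall>n. X n < u)"
proof -
  \<comment> \<open>Finiteness of the part up to \<open>t\<close> is the invariant: as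
    \<open>NW\<close> is infinite, some point remains beyond \<open>t\<close>, and
    \<open>NW_min\<close> gives the next one.\<close>
  define P where "P = (\<lambda>(n::nat) t. t \<in> NW \<and> finite {u \<in> NW. u \<le> t} \<and> (n = 0 \<longrightarrow> (\<forall>u\<in>NW. t \<le> u)))"
  define Q where "Q = (\<lambda>(n::nat) t t'. t < t' \<and> (\<forall>u\<in>NW. t < u \<longrightarrow> t' \<le> u))"
  have "\<exists>X. \<forall>n. P n (X n) \<and> Q n (X n) (X (Suc n))"
  proof (rule dependent_nat_choice)
    obtain t where t: "t \<in> NW" "\<forall>u\<in>NW. t \<le> u" using NW_min[of NW] inf by fastforce
    then have "{u \<in> NW. u \<le> t} \<subseteq> {t}" by force
    then have "P 0 t" unfolding P_def using t finite_subset by blast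
    then show "\<exists>t. P 0 t" by blast
    fix t n assume P: "P n t"
    define R where "R = {u \<in> NW. t < u}"
    have "R \<noteq> {}"
    proof
      assume "R = {}"
      then have "NW \<subseteq> {u \<in> NW. u \<le> t}" unfolding R_def by force
      then show False using P inf finite_subset unfolding P_def by blast
    qed
    then obtain t' where t': "t' \<in> R" "\<forall>u\<in>R. t' \<le> u"
      using NW_min[of R] unfolding R_def by blast
    have "{u \<in> NW. u \<le> t'} \<subseteq> insert t' {u \<in> NW. u \<le> t}"
      using t'(2) unfolding R_def by force
    then have "finite {u \<in> NW. u \<le> t'}" using P finite_subset unfolding P_def by blast
    then have "P (Suc n) t'" "Q n t t'" using t' unfolding P_def Q_def R_def by auto
    then show "\<exists>t'. P (Suc n) t' \<and> Q n t t'" by blast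
  qed
  then obtain X where X: "\<And>n. P n (X n)" "\<And>n. Q n (X n) (X (Suc n))" by blast
  have "u \<in> range X \<or> (\<forall>n. X n < u)" if u: "u \<in> NW" for u
  proof (cases "\<exists>n. u \<le> X n")
    case True
    define n where "n = (LEAST n. u \<le> X n)"
    have n: "u \<le> X n" unfolding n_def using True by (rule LeastI_ex)
    have "X n \<le> u"
    proof (cases n)
      case 0 then show ?thesis using X(1)[of 0] u unfolding P_def by auto
    next
      case (Suc k)
      then have "X k < u"
        using not_less_Least[of k "\<lambda>n. u \<le> X n"] unfolding n_def[symmetric] by simp
      then show ?thesis using X(2)[of k] u Suc unfolding Q_def by auto
    qed
    then show ?thesis using n by (metis antisym rangeI)
  next
    case False then show ?thesis by (meson not_le)
  qed
  then show ?thesis using that[of X] X unfolding P_def Q_def by blast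
qed

text \<open>By \<open>left_covers\<close> some iterate of a left neighbourhood of \<open>X n\<close>
  covers a left neighbourhood of \<open>X (Suc n)\<close>. One point follows the whole chain, and it
  tends to \<open>l\<close> along the chosen times.\<close>

lemma limit_in_omega:
  assumes X: "\<And>n. X n \<in> NW" "\<And>n. X n < X (Suc n)" "X \<longlonglongrightarrow> l"
    and Y: "\<And>n. basic_point (X n) (Y n) (k n)"
  shows "l \<in> omega_map f"
proof -
  \<comment> \<open>The bound \<open>1 / real (Suc n)\<close> makes the left neighbourhoods shrink,
    so that following the chain means convergence to \<open>l\<close>.\<close>
  define P where "P = (\<lambda>n e. e > 0 \<and> a < X n - e \<and> e \<le> 1 / real (Suc n))"
  define Q where "Q = (\<lambda>n e e'. \<exists>t\<ge>1. {X (Suc n) - e'..X (Suc n)} \<subseteq> (f ^^ t) ` {X n - e..X n})"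
  have "\<exists>E. \<forall>n. P n (E n) \<and> Q n (E n) (E (Suc n))"
  proof (rule dependent_nat_choice)
    have "a < X 0" using X(1)[of 0] by auto
    then obtain t where "a < t" "t < X 0" using dense by blast
    then have "P 0 (min (X 0 - t) 1)" unfolding P_def by (auto simp: min_def)
    then have "\<exists>e. P 0 e" by blast
    then show "\<exists>e. P 0 e" .
    fix e n assume P: "P n e"
    interpret nested_pair f a b "X n" "Y n" "k n" "X (Suc n)" "Y (Suc n)" "k (Suc n)"
      by (rule pair_basic[OF X(1) X(1) X(2) Y Y])
    have lim: "orbit_set f {X n..Y n} \<subseteq> near_lim f (X n)" using Y unfolding basic_point_def by blast
    have pos: "1 / real (Suc (Suc n)) > 0" by simp
    obtain t u where tu: "t \<ge> 1" "X (Suc n) - 1 / real (Suc (Suc n)) < u" "X n < u" "u < X (Suc n)"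
      "{u..X (Suc n)} \<subseteq> (f ^^ t) ` {X n - e..X n}"
      using left_covers[OF lim _ _ pos, of e] P unfolding P_def by blast
    then have "P (Suc n) (X (Suc n) - u)" unfolding P_def using X(1)[of n] by auto
    moreover have "Q n e (X (Suc n) - u)" unfolding Q_def using tu by auto
    ultimately show "\<exists>e'. P (Suc n) e' \<and> Q n e e'" by blast
  qed
  then obtain E where E: "\<And>n. P n (E n)" "\<And>n. Q n (E n) (E (Suc n))" by blast
  define L where "L n = {X n - E n..X n}" for n
  have "\<exists>t\<ge>1. L (Suc n) \<subseteq> (f ^^ t) ` L n" for n using E(2)[of n] unfolding Q_def L_def by blast
  then obtain t where t: "\<And>n. t n \<ge> 1" "\<And>n. L (Suc n) \<subseteq> (f ^^ t n) ` L n" by metis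
  have L: "compact (L n)" "L n \<noteq> {}" "L n \<subseteq> {0..1}" for n
    using E(1)[of n] X(1)[of n] U_bounds unfolding L_def P_def by auto
  obtain p T where p: "p \<in> {0..1}" "strict_mono T" "\<And>n. (f ^^ T n) p \<in> L n"
    by (rule iterated_cover[where L = L and t = t, OF L t]) (rule that)
  have "(\<lambda>n. 1 / real (Suc n)) \<longlonglongrightarrow> 0"
    using LIMSEQ_inverse_real_of_nat by (simp add: inverse_eq_divide)
  then have low: "(\<lambda>n. X n - 1 / real (Suc n)) \<longlonglongrightarrow> l"
    using tendsto_diff[OF X(3)] by fastforce
  have between: "X n - 1 / real (Suc n) \<le> (f ^^ T n) p" "(f ^^ T n) p \<le> X n" for n
    using p(3)[of n] E(1)[of n] unfolding L_def P_def by auto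
  have "(\<lambda>n. (f ^^ T n) p) \<longlonglongrightarrow> l"
    by (rule tendsto_sandwich[OF _ _ low X(3)]) (use between in auto)
  then show ?thesis using p(1,2) unfolding omega_map_def omega_point_def by blast
qed

text \<open>With unbounded periods the limit \<open>l\<close> gives possibility 3 if
  \<open>l < b\<close> and possibility 4 if \<open>l = b\<close>. Bounded periods are finally
  constant, and then the returns force \<open>l = b\<close>.\<close>

lemma infinite_case:
  assumes inf: "infinite NW" and compl: "complementary f a b"
  shows "possibility3 f a b \<or> possibility4 f a b"
proof -
  obtain X where X: "\<And>n. X n \<in> NW" "\<And>n. X n < X (Suc n)"
    and enum: "\<And>u. u \<in> NW \<Longrightarrow> u \<in> range X \<or> (\<forall>n. X n < u)"
    by (rule enumerate_NW[OF inf]) (rule that)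
  have mono: "strict_mono X" using X(2) by (simp add: strict_mono_Suc_iff)
  have "\<exists>y k. basic_point (X n) y k" for n by (rule not_last(1)[OF X(1) X(1) X(2)])
  then obtain Y k where Y: "\<And>n. basic_point (X n) (Y n) (k n)" by metis
  have fin: "finite (orbit f (X n))" "X n \<notin> omega_map f" for n
    by (rule not_last(2)[OF X(1) X(1) X(2)], rule not_last(3)[OF X(1) X(1) X(2)])
  have pair: "nested_pair f a b (X n) (Y n) (k n) (X (Suc n)) (Y (Suc n)) (k (Suc n))" for n
    by (rule pair_basic[OF X(1) X(1) X(2) Y Y])
  have per: "periodic_interval f {X n..Y n} (k n)" "in_Omega_basic f {X n..Y n} (X n)" for n
    using Y[of n] unfolding basic_point_def by auto
  have nest: "{X (Suc n)..Y (Suc n)} \<subseteq> {X n..Y n}" for n using nested_pair.sub[OF pair] .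
  have k1: "k n \<ge> 1" for n using per(1)[of n] unfolding periodic_interval_def by blast
  have kdvd: "k n dvd k (Suc n)" for n using nested_pair.m_dvd_q[OF pair] .
  have kle: "k n \<le> k (Suc n)" for n using kdvd[of n] k1[of "Suc n"] by (intro dvd_imp_le) auto
  have Yb: "b \<le> Y n" "Y n \<le> 1" for n using nested_pair.order_facts[OF pair, of n] by auto
  have "incseq X" using X(2) by (intro incseq_SucI less_imp_le)
  then obtain l where l: "X \<longlonglongrightarrow> l" "\<And>n. X n \<le> l"
    using incseq_convergent[of X b] X(1) by (metis IntD2 greaterThanLessThan_iff less_imp_le)
  have Xl: "X n < l" for n using l(2)[of "Suc n"] X(2)[of n] by simp
  have lb: "l \<le> b" using l(1) X(1) by (intro LIMSEQ_le_const2[of X]) (auto simp: less_imp_le)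
  have al: "a < l" using Xl[of 0] X(1)[of 0] by auto
  have lJ: "l \<in> {X n..Y n}" for n using l(2)[of n] lb Yb(1)[of n] by simp
  have Ydec: "Y (Suc n) \<le> Y n" for n using nest[of n] Yb[of "Suc n"] X(1)[of "Suc n"] by auto
  have top: "u \<in> range X \<or> l \<le> u" if "u \<in> NW" for u
  proof -
    have "l \<le> u" if "\<forall>n. X n < u"
      using l(1) that by (intro LIMSEQ_le_const2[of X]) (auto simp: less_imp_le)
    then show ?thesis using enum[OF that] by blast
  qed
  show ?thesis
  proof (cases "filterlim k at_top sequentially")
    case k: True
    have gen: "generating f (\<lambda>i. {X i..Y i})" unfolding generating_def using per(1) nest k by blast
    show ?thesis
    proof (cases "l < b")
      case True
      have lNW: "l \<in> NW" using nonwandering_closed[OF _ l(1)] X(1) al True by auto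
      have "{l<..<b} \<subseteq> {X n..Y n}" for n using l(2)[of n] Yb(1)[of n] by auto
      then have "nonwandering f \<inter> {l<..<b} = {}" by (rule wandering_interval[OF per(1) k])
      then have "NW \<subseteq> range X \<union> {l}" using top by force
      then have "NW = range X \<union> {l}" using X(1) lNW by blast
      moreover have "l \<in> omega_map f" by (rule limit_in_omega[OF X l(1) Y])
      moreover have "l \<in> (\<Inter>i. orbit_set f {X i..Y i})" using lJ orbit_set_superset by blast
      ultimately have "possibility3 f a b"
        unfolding possibility3_def
        using mono l(1) gen per(2) fin by - (rule exI[of _ X], rule exI[of _ l], rule exI[of _ Y], auto)
      then show ?thesis ..
    next
      case False
      then have [simp]: "l = b" using lb by simp
      have NW: "NW = range X" using top X(1) by force
      have Int: "(\<Inter>i. {X i..Y i}) = {b}"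
      proof
        show "{b} \<subseteq> (\<Inter>i. {X i..Y i})" using lJ by auto
        show "(\<Inter>i. {X i..Y i}) \<subseteq> {b}"
        proof
          fix z assume z: "z \<in> (\<Inter>i. {X i..Y i})"
          have "b \<le> z" using l(1) z by (intro LIMSEQ_le_const2[of X b z]) auto
          show "z \<in> {b}"
          proof (rule ccontr)
            assume "z \<notin> {b}"
            then have bz: "b < z" using \<open>b \<le> z\<close> by simp
            have "z \<in> {X 0..Y 0}" using z by blast
            then have z1: "z \<le> 1" using Yb(2)[of 0] by simp
            \<comment> \<open>A periodic point between \<open>b\<close> and \<open>z\<close> would
              lie in all the intervals, so each \<open>k n\<close> would divide its period. Without
              such points \<open>{a<..<z}\<close> extends \<open>{a<..<b}\<close>, against
              maximality.\<close>
            have "{a<..<z} \<inter> Per f = {}"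
            proof (rule ccontr)
              assume "\<not> ?thesis"
              then obtain r where r: "r \<in> {a<..<z}" "r \<in> Per f" by blast
              then have "r \<notin> {a<..<b}" using no_Per by blast
              then have rb: "b \<le> r" "r < z" using r(1) by auto
              have rJ: "r \<in> {X n..Y n}" for n
              proof -
                have "z \<in> {X n..Y n}" using z by blast
                then show ?thesis using rb X(1)[of n] by auto
              qed
              obtain c where c: "c \<ge> 1" "(f ^^ c) r = r" using r(2) unfolding Per_def by blast
              have "k n dvd c" for n
              proof (rule cyc_dvd[OF periodic_imp_cyc[OF per(1)[of n]]])
                have "(f ^^ c) r \<in> (f ^^ c) ` {X n..Y n}" using rJ by (rule imageI)
                then show "(f ^^ c) ` {X n..Y n} \<inter> {X n..Y n} \<noteq> {}" using c(2) rJ by auto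
              qed
              then have "k n \<le> c" for n using c(1) by (intro dvd_imp_le) auto
              moreover obtain n where "k n \<ge> Suc c"
                using k unfolding filterlim_at_top eventually_sequentially by blast
              ultimately show False by (metis not_less_eq_eq)
            qed
            then have "{a<..<z} \<inter> closure (Per f) = {}"
              using open_Int_closure_eq_empty[of "{a<..<z}" "Per f"] by simp
            moreover have "{a<..<b} \<subseteq> {a<..<z}" "{a<..<z} \<subseteq> {0..1}"
              using bz z1 U_bounds by auto
            ultimately have "{a<..<z} = {a<..<b}" using compl unfolding complementary_def by blast
            moreover have "b \<in> {a<..<z}" using bz ab by simp
            ultimately show False by simp
          qed
        qed
      qed
      have "solenoidal_for f (\<lambda>i. {X i..Y i}) (\<Inter>j. orbit_set f {X j..Y j})"
        using solenoidal_Inter[OF gen] .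
      moreover have "b \<in> (\<Inter>j. orbit_set f {X j..Y j})" using lJ orbit_set_superset by force
      ultimately have "possibility4 f a b"
        unfolding possibility4_def
        using mono l(1) NW fin per nest Int k gen
        by - (rule exI[of _ X], rule exI[of _ Y], rule exI[of _ k], auto)
      then show ?thesis ..
    qed
  next
    case k: False
    then obtain N where N: "\<And>n. n \<ge> N \<Longrightarrow> k n = k N"
      using mono_nat_dichotomy[of k, OF kle] by blast
    define q where "q = k N"
    have pairq: "nested_pair f a b (X (n + N)) (Y (n + N)) q (X (Suc (n + N))) (Y (Suc (n + N))) q" for n
      using pair[of "n + N"] N[of "n + N"] N[of "Suc (n + N)"] unfolding q_def by simp
    have "decseq Y" using Ydec by (rule decseq_SucI)
    then obtain r where r: "Y \<longlonglongrightarrow> r" using decseq_convergent[of Y b] Yb(1) by metis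
    have rN: "(\<lambda>n. Y (n + N)) \<longlonglongrightarrow> r" "(\<lambda>n. Y (Suc (n + N))) \<longlonglongrightarrow> r"
      using LIMSEQ_ignore_initial_segment[OF r, of N] LIMSEQ_ignore_initial_segment[OF r, of "Suc N"] by auto
    have X01: "X n \<in> {0..1}" for n using X(1)[of n] U01 by blast
    have Y0: "0 \<le> Y n" for n using Yb(1)[of n] U_bounds ab by simp
    have Xl': "(\<lambda>n. X (n + N)) \<longlonglongrightarrow> l"
      using LIMSEQ_ignore_initial_segment[OF l(1)] .
    \<comment> \<open>The limits of the left and right ends coincide; being separated by
      \<open>b\<close>, they both equal \<open>b\<close>, which is fixed by
      \<open>f ^^ q\<close>.\<close>
    note lr = limit_fixed[OF Xl' rN(2,1) X01 Y0 Yb(2) nested_pair.return_points[OF pairq]]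
    have "b \<le> r" using r Yb(1) by (intro LIMSEQ_le_const[of Y]) auto
    then have [simp]: "l = b" "r = b" using lr(1) lb by auto
    have bPer: "b \<in> Per f" using lr(2) b_01 k1[of N] unfolding Per_def q_def by auto
    have NW: "NW = range X" using top X(1) by force
    have Int: "(\<Inter>i. {X i..Y i}) = {b}"
    proof
      show "{b} \<subseteq> (\<Inter>i. {X i..Y i})" using lJ by auto
      show "(\<Inter>i. {X i..Y i}) \<subseteq> {b}"
      proof
        fix z assume z: "z \<in> (\<Inter>i. {X i..Y i})"
        have "b \<le> z" using l(1) z by (intro LIMSEQ_le_const2[of X b z]) auto
        moreover have "z \<le> b" using r z by (intro LIMSEQ_le_const[of Y b z]) auto
        ultimately show "z \<in> {b}" by simp
      qed
    qed
    have "possibility4 f a b"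
      unfolding possibility4_def
      using mono l(1) NW fin per nest Int k bPer
      by - (rule exI[of _ X], rule exI[of _ Y], rule exI[of _ k], auto)
    then show ?thesis ..
  qed
qed

theorem right_moving_classification:
  assumes "complementary f a b"
  shows "possibility1 f a b \<or> possibility2 f a b \<or> possibility3 f a b \<or> possibility4 f a b"
  using finite_case infinite_case[OF _ assms] unfolding possibility1_def by blast

text \<open>Of two different omega-limit points in \<open>{a<..<b}\<close> the smaller one would be
  followed by a nonwandering point, against \<open>not_last\<close>.\<close>

theorem omega_card: "finite (omega_map f \<inter> {a<..<b}) \<and> card (omega_map f \<inter> {a<..<b}) \<le> 1"
proof -
  have "u = v" if "u \<in> omega_map f \<inter> {a<..<b}" "v \<in> omega_map f \<inter> {a<..<b}" for u v
  proof -
    have "u \<in> NW" "v \<in> NW" using that omega_nonwandering by auto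
    then show ?thesis using not_last(3)[of u v] not_last(3)[of v u] that by (metis IntD1 linorder_neqE)
  qed
  then have "\<exists>u. omega_map f \<inter> {a<..<b} \<subseteq> {u}" by blast
  then obtain u where u: "omega_map f \<inter> {a<..<b} \<subseteq> {u}" by blast
  then show ?thesis using finite_subset[OF u] card_mono[OF _ u] by auto
qed

end

section \<open>Reflection and the choice of orientation\<close>

lemma reflect_funpow: "(reflect f ^^ n) t = 1 - (f ^^ n) (1 - t)"
  by (induction n) (auto simp: reflect_def)

lemma reflect_interval_map:
  assumes "interval_map f" shows "interval_map (reflect f)"
proof -
  interpret interval_map f by fact
  have sub: "(\<lambda>t. 1 - t) ` {0..1} \<subseteq> {0..1::real}" by auto
  have "continuous_on {0..1} (\<lambda>t. f (1 - t))"
    by (rule continuous_on_compose2[OF cont _ sub]) (intro continuous_intros)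
  then have "continuous_on {0..1} (\<lambda>t. 1 - f (1 - t))" by (intro continuous_intros)
  then have "continuous_on {0..1} (reflect f)" unfolding reflect_def .
  moreover have "reflect f t \<in> {0..1}" if "t \<in> {0..1}" for t
  proof -
    have "f (1 - t) \<in> {0..1}" using self_map that by (auto simp: image_subset_iff)
    then show ?thesis unfolding reflect_def by auto
  qed
  ultimately show ?thesis by unfold_locales auto
qed

lemma reflect_Per: "Per (reflect f) = (\<lambda>t. 1 - t) ` Per f"
proof -
  have "t \<in> Per (reflect f) \<longleftrightarrow> 1 - t \<in> Per f" for t
    unfolding Per_def reflect_funpow by (auto simp: algebra_simps)
  note * = this
  show ?thesis
  proof (intro equalityI subsetI)
    fix y assume "y \<in> Per (reflect f)"
    then show "y \<in> (\<lambda>t. 1 - t) ` Per f" using *[of y] by (intro image_eqI[of _ _ "1 - y"]) auto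
  next
    fix y assume "y \<in> (\<lambda>t. 1 - t) ` Per f"
    then obtain u where "u \<in> Per f" "y = 1 - u" by blast
    then show "y \<in> Per (reflect f)" using *[of y] by simp
  qed
qed

lemma reflect_omega: "omega_map (reflect f) = (\<lambda>t. 1 - t) ` omega_map f"
proof -
  have pt: "1 - y \<in> omega_point f (1 - x)" if yx: "y \<in> omega_point (reflect f) x" for x y and f :: "real \<Rightarrow> real"
  proof -
    obtain r :: "nat \<Rightarrow> nat" where r: "strict_mono r" "(\<lambda>n. 1 - (f ^^ r n) (1 - x)) \<longlonglongrightarrow> y"
      using yx unfolding omega_point_def reflect_funpow by blast
    have "(\<lambda>n. 1 - (1 - (f ^^ r n) (1 - x))) \<longlonglongrightarrow> 1 - y"
      by (intro tendsto_intros r(2))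
    then show ?thesis using r(1) unfolding omega_point_def by auto
  qed
  have invol: "reflect (reflect f) = f" unfolding reflect_def by simp
  \<comment> \<open>Stated for every \<open>f\<close>, so that it applies to
    \<open>reflect f\<close> as well; as reflection is an involution, this yields the reverse
    inclusion.\<close>
  have "1 - y \<in> omega_map f" if y: "y \<in> omega_map (reflect f)" for y and f :: "real \<Rightarrow> real"
  proof -
    obtain x where x: "x \<in> {0..1}" "y \<in> omega_point (reflect f) x"
      using y unfolding omega_map_def by blast
    have "1 - x \<in> {0..1}" using x(1) by auto
    then show ?thesis using pt[OF x(2)] unfolding omega_map_def by blast
  qed
  note * = this
  show ?thesis
  proof (intro equalityI subsetI)
    fix y assume "y \<in> omega_map (reflect f)"
    then show "y \<in> (\<lambda>t. 1 - t) ` omega_map f"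
      using *[of y f] by (intro image_eqI[of _ _ "1 - y"]) auto
  next
    fix y assume "y \<in> (\<lambda>t. 1 - t) ` omega_map f"
    then obtain u where "u \<in> omega_map f" "y = 1 - u" by blast
    then show "y \<in> omega_map (reflect f)" using *[of u "reflect f"] invol by simp
  qed
qed

lemma reflect_image_interval: "(\<lambda>t. 1 - t) ` {c<..<d} = {1 - d<..<1 - c :: real}"
  by (auto simp: image_iff intro!: bexI[of _ "1 - _"])

lemma reflect_closure: "closure ((\<lambda>t. 1 - t) ` A) = (\<lambda>t. 1 - t) ` closure (A :: real set)"
proof -
  have sub: "(\<lambda>t. 1 - t) ` closure B \<subseteq> closure ((\<lambda>t. 1 - t) ` B)" for B :: "real set"
    by (rule image_closure_subset) (auto intro!: continuous_intros closure_subset)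
  have "(\<lambda>t. 1 - t) ` (\<lambda>t. 1 - t) ` B = B" for B :: "real set" by (simp add: image_image)
  then show ?thesis using sub[of A] sub[of "(\<lambda>t. 1 - t) ` A"] by (metis image_mono subset_antisym)
qed

lemma reflect_complementary:
  assumes "complementary f a b" shows "complementary (reflect f) (1 - b) (1 - a)"
proof -
  let ?r = "\<lambda>t::real. 1 - t"
  have inv: "?r ` ?r ` A = A" for A by (auto simp: image_image)
  have rI: "?r ` {c<..<d} = {1 - d<..<1 - c}" for c d by (rule reflect_image_interval)
  have rPer: "closure (Per (reflect f)) = ?r ` closure (Per f)" unfolding reflect_Per reflect_closure ..
  have r01: "?r ` {0..1} = {0..1}" by (auto simp: image_iff intro!: bexI[of _ "1 - _"])
  have mono: "?r ` A \<subseteq> ?r ` B \<longleftrightarrow> A \<subseteq> B" for A B by (auto simp: image_iff)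
  have disj: "?r ` A \<inter> ?r ` B = {} \<longleftrightarrow> A \<inter> B = {}" for A B by auto
  have *: "a < b" "{a<..<b} \<subseteq> {0..1}" "{a<..<b} \<inter> closure (Per f) = {}"
    "\<And>c d. {a<..<b} \<subseteq> {c<..<d} \<Longrightarrow> {c<..<d} \<subseteq> {0..1} \<Longrightarrow> {c<..<d} \<inter> closure (Per f) = {}
       \<Longrightarrow> {c<..<d} = {a<..<b}" using assms unfolding complementary_def by blast+
  have U: "{1 - b<..<1 - a} = ?r ` {a<..<b}" by (simp only: rI)
  show ?thesis
    unfolding complementary_def
  proof (intro conjI allI impI; (elim conjE)?)
    show "1 - b < 1 - a" using *(1) by simp
    show "{1 - b<..<1 - a} \<subseteq> {0..1}" using *(2) mono[of "{a<..<b}" "{0..1}"] U r01 by simp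
    show "{1 - b<..<1 - a} \<inter> closure (Per (reflect f)) = {}" unfolding U rPer disj by (rule *(3))
    fix c d :: real
    assume cd: "{1 - b<..<1 - a} \<subseteq> {c<..<d}" "{c<..<d} \<subseteq> {0..1}" "{c<..<d} \<inter> closure (Per (reflect f)) = {}"
    have V: "{c<..<d} = ?r ` {1 - d<..<1 - c}" by (simp only: rI) simp
    have "{1 - d<..<1 - c} = {a<..<b}"
    proof (rule *(4))
      show "{a<..<b} \<subseteq> {1 - d<..<1 - c}" using cd(1) unfolding U V mono .
      show "{1 - d<..<1 - c} \<subseteq> {0..1}"
        using cd(2) mono[of "{1 - d<..<1 - c}" "{0..1}"] V r01 by simp
      show "{1 - d<..<1 - c} \<inter> closure (Per f) = {}" using cd(3) unfolding V rPer disj .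
    qed
    then show "{c<..<d} = {1 - b<..<1 - a}" unfolding U V by simp
  qed
qed

text \<open>If \<open>x\<close> moves right under \<open>f ^^ m\<close> and \<open>y\<close> moves left under \<open>f ^^ n\<close>, then all iterates of these maps
  inherit the direction on the whole interval, which is absurd for \<open>f ^^ (m * n)\<close>.\<close>

lemma (in interval_map) one_direction:
  assumes U: "{a<..<b} \<subseteq> {0..1}" "{a<..<b} \<inter> Per f = {}"
    and x: "x \<in> {a<..<b}" "m \<ge> 1" "(f ^^ m) x \<in> {a<..<b}" "x < (f ^^ m) x"
    and y: "y \<in> {a<..<b}" "n \<ge> 1" "(f ^^ n) y \<in> {a<..<b}"
  shows "y < (f ^^ n) y"
proof (rule ccontr)
  assume neg: "\<not> ?thesis"
  note same = same_direction[OF U]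
  have "(f ^^ n) y \<noteq> y" using U y(1,2) unfolding Per_def by blast
  then have y': "(f ^^ n) y < y" using neg by simp
  have up: "x < (f ^^ (m * k)) x" if "k \<ge> 1" for k
    using that
  proof (induction k rule: dec_induct)
    case base then show ?case using x(4) by simp
  next
    case (step k)
    then have "m * k \<ge> 1" using x(2) by simp
    then have "(f ^^ m) x < (f ^^ (m * k)) ((f ^^ m) x)" using same[OF x(1,3)] step by blast
    moreover have "(f ^^ (m * Suc k)) x = (f ^^ (m * k)) ((f ^^ m) x)"
      by (simp only: mult_Suc_right add.commute[of m] funpow_add comp_def)
    ultimately show ?case using x(4) by simp
  qed
  have down: "(f ^^ (n * k)) y < y" if "k \<ge> 1" for k
    using that
  proof (induction k rule: dec_induct)
    case base then show ?case using y' by simp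
  next
    case (step k)
    then have k: "n * k \<ge> 1" using y(2) by simp
    then have "\<not> (f ^^ n) y < (f ^^ (n * k)) ((f ^^ n) y)" using same[OF y(1,3) k] step by auto
    moreover have "(f ^^ (n * Suc k)) y = (f ^^ (n * k)) ((f ^^ n) y)"
      by (simp only: mult_Suc_right add.commute[of n] funpow_add comp_def)
    ultimately show ?case using y' by simp
  qed
  have "m * n \<ge> 1" using x(2) y(2) by simp
  then show False using same[OF x(1) y(1), of "m * n"] up[OF y(2)] down[OF x(2)] by (simp add: mult.commute)
qed

theorem theorem7p6:
  fixes f :: "real \<Rightarrow> real" and a b :: real
  assumes "continuous_on {0..1} f"
    and "f ` {0..1} \<subseteq> {0..1}"
    and "complementary f a b"
  shows "(\<exists>g c d.
            ((g = f \<and> c = a \<and> d = b) \<or> (g = reflect f \<and> c = 1 - b \<and> d = 1 - a)) \<and>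
            (possibility1 g c d \<or> possibility2 g c d \<or> possibility3 g c d \<or> possibility4 g c d))
         \<and> (finite (omega_map f \<inter> {a<..<b}) \<and> card (omega_map f \<inter> {a<..<b}) \<le> 1)"
proof -
  interpret interval_map f by unfold_locales fact+
  have right_movingI: "right_moving g c d"
    if "interval_map g" "complementary g c d" "x \<in> {c<..<d}" "n \<ge> 1" "(g ^^ n) x \<in> {c<..<d}" "x < (g ^^ n) x"
    for g c d x n
  proof -
    interpret g: interval_map g by fact
    have U: "c < d" "{c<..<d} \<subseteq> {0..1}" "{c<..<d} \<inter> Per g = {}"
      using that(2) closure_subset[of "Per g"] unfolding complementary_def by blast+
    show ?thesis
      by unfold_locales (use U g.one_direction[OF U(2,3) that(3-6)] in auto)
  qed
  show ?thesis
  proof (cases "\<exists>x\<in>{a<..<b}. \<exists>n\<ge>1. (f ^^ n) x \<in> {a<..<b}")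
    \<comment> \<open>Without any return there is no direction to choose, but then there are no
      nonwandering points in \<open>{a<..<b}\<close> either.\<close>
    case False
    have "nonwandering f \<inter> {a<..<b} = {}"
    proof (rule ccontr)
      assume "\<not> ?thesis"
      then obtain x where "x \<in> nonwandering f" "x \<in> {a<..<b}" by blast
      then show False using nonwandering_return[of x f "{a<..<b}"] False by (metis open_greaterThanLessThan)
    qed
    moreover from this have "omega_map f \<inter> {a<..<b} = {}" using omega_nonwandering by blast
    ultimately show ?thesis unfolding possibility1_def by auto
  next
    case True
    then obtain x n where x: "x \<in> {a<..<b}" "n \<ge> 1" "(f ^^ n) x \<in> {a<..<b}" by blast
    have "{a<..<b} \<inter> Per f = {}" "{a<..<b} \<subseteq> {0..1}"
      using assms(3) closure_subset[of "Per f"] unfolding complementary_def by blast+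
    then have "(f ^^ n) x \<noteq> x" using x unfolding Per_def by blast
    then consider "x < (f ^^ n) x" | "(f ^^ n) x < x" by linarith
    then show ?thesis
    proof cases
      case 1
      then interpret right_moving f a b using right_movingI[OF interval_map_axioms assms(3) x] by blast
      show ?thesis using right_moving_classification[OF assms(3)] omega_card by blast
    next
      case 2
      have rm: "right_moving (reflect f) (1 - b) (1 - a)"
        by (rule right_movingI[OF reflect_interval_map[OF interval_map_axioms] reflect_complementary[OF assms(3)],
              of "1 - x" n]) (use x 2 in \<open>auto simp: reflect_funpow\<close>)
      have "omega_map (reflect f) \<inter> {1 - b<..<1 - a} = (\<lambda>t. 1 - t) ` (omega_map f \<inter> {a<..<b})"
        unfolding reflect_omega reflect_image_interval[symmetric] by (subst image_Int) (auto simp: inj_def)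
      moreover have "inj_on (\<lambda>t::real. 1 - t) (omega_map f \<inter> {a<..<b})"
        by (auto simp: inj_on_def)
      ultimately have "finite (omega_map f \<inter> {a<..<b}) \<and> card (omega_map f \<inter> {a<..<b}) \<le> 1"
        using right_moving.omega_card[OF rm] by (metis card_image finite_imageD)
      then show ?thesis
        using right_moving.right_moving_classification[OF rm reflect_complementary[OF assms(3)]] by blast
    qed
  qed
qed

end
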